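(* For all integers $m\ge3$ and $q\ge2$, \[ q^{m-2}+q^{m-3}\le H_m(q)\le q^{m-2}+H_{m-1}(q), \] with $H_2(q)=1$. Consequently: (a) $H_m(q)\le\sum_{j=2}^{m-2}q^j$ for all $m\ge5$ and $q\ge2$; (b) for each fixed $m\ge4$, $H_m(q)=q^{m-2}+q^{m-3}+O_m(q^{m-4})$ as $q\to\infty$; (c) the lower bound is attained for $m=3,4,5$, i.e. $H_m(q)=q^{m-2}+q^{m-3}$ for $m\in\{3,4,5\}$ and all $q\ge2$; (d) $q^4+q^3\le H_6(q)\le q^4+q^3+q^2$ for all $q\ge2$.
   Context: An ordered real $m$-alphabet is a strictly increasing tuple $T=(t_0<\cdots<t_{m-1})$ of real numbers. For an integer $q\ge1$, an order-preserving integer $q$-model of $T$ is a strictly increasing tuple of integers $S=(s_0<\cdots<s_{m-1})$ such that for every $1\le h\le q$ and all index lists $i_1,\dots,i_h$, $j_1,\dots,j_h$ (repetitions allowed), $\sum_{\nu=1}^h t_{i_\nu}=\sum_{\nu=1}^h t_{j_\nu}$ if and only if $\sum_{\nu=1}^h s_{i_\nu}=\sum_{\nu=1}^h s_{j_\nu}$. The diameter of $S$ is $s_{m-1}-s_0$. $H_m(q)$ denotes the least integer $D$ such that every ordered real $m$-alphabet has an order-preserving integer $q$-model of diameter at most $D$. $O_m$ means that the implied constant may depend on $m$. *)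

theory Defs
  imports Complex_Main "HOL-Library.Landau_Symbols"
begin

definition ordered_alphabet :: "nat \<Rightarrow> 'a::linorder list \<Rightarrow> bool" where
  "ordered_alphabet m T \<longleftrightarrow> length T = m \<and> sorted_wrt (<) T"

definition order_preserving_model :: "nat \<Rightarrow> real list \<Rightarrow> int list \<Rightarrow> bool" where
  "order_preserving_model q T S \<longleftrightarrow>
     ordered_alphabet (length T) S \<and>
     (\<forall>h is js. 1 \<le> h \<and> h \<le> q \<and> length is = h \<and> length js = h \<and>
        set is \<subseteq> {..<length T} \<and> set js \<subseteq> {..<length T} \<longrightarrow>
        ((\<Sum>i\<leftarrow>is. T ! i) = (\<Sum>j\<leftarrow>js. T ! j) \<longleftrightarrow>
         (\<Sum>i\<leftarrow>is. S ! i) = (\<Sum>j\<leftarrow>js. S ! j)))"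

definition diameter :: "int list \<Rightarrow> int" where
  "diameter S = last S - hd S"

definition universal_bound :: "nat \<Rightarrow> nat \<Rightarrow> nat \<Rightarrow> bool" where
  "universal_bound m q D \<longleftrightarrow>
     (\<forall>T :: real list. ordered_alphabet m T \<longrightarrow>
        (\<exists>S. order_preserving_model q T S \<and> diameter S \<le> int D))"

(* Diameters of nonempty increasing tuples are nonnegative, so for m \<ge> 1 the least
   integer bound is the least natural one.  LEAST is only meaningful if some bound
   exists, so that existence has to be asserted separately. *)
definition H :: "nat \<Rightarrow> nat \<Rightarrow> nat" where
  "H m q = (LEAST D. universal_bound m q D)"

end

theory Submission
  imports Defs "Jordan_Normal_Form.Determinant"
begin

text \<open>
  \<^bold>\<open>Upper bound.\<close>  The short relations of an alphabet \<open>T\<close> cut out a rational subspace, and the short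
  vectors divide its order cone into sign cells.  An extreme ray of a cell is the solution of \<open>m - 2\<close>
  short equations, and a determinant whose rows have positive and negative parts of sum at most \<open>q\<close>
  is at most \<open>q\<^bsup>m - 2\<^esup>\<close>; so the ray has an integer generator of diameter at most \<open>q\<^bsup>m - 2\<^esup>\<close>.
  A generic point of a facet of the order cone is an alphabet with fewer letters, hence has a model
  \<open>s'\<close> of diameter at most \<open>H\<^bsub>m - 1\<^esub>(q)\<close>.  If \<open>r\<close> is a ray off that facet of a cell having \<open>s'\<close> in
  its closure, then no cancellation occurs in \<open>s' + r\<close>, which is therefore a model of \<open>T\<close>.

  \<^bold>\<open>Lower bound.\<close>  In \<open>0, 1, q+1, q(q+1), q\<^sup>2(q+1), \<dots>\<close> the first three letters have no short relation,
  while each later letter is tied to its predecessor by a relation of length \<open>q\<close>.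

  \<^bold>\<open>Four and five letters.\<close>  A short relation of length below \<open>q\<close> improves the determinant bound, and
  so does closing a gap that shortens the only relation.  This leaves a few shapes of a single
  relation of length \<open>q\<close>, and the alphabets without relations; for these a model is written down, of
  \<open>T\<close> itself or of one of its facets.
\<close>

subsection \<open>Determinants with bounded row sums\<close>

text \<open>The recursion alone is not sharp: from \<open>H 3 q = q + 1\<close> it gives
  \<open>q^2 + q + 1\<close> for four letters, and from \<open>H 4 q = q^2 + q\<close> it gives
  \<open>q^3 + q^2 + q\<close> for five, so 1 and then \<open>q\<close> remain to be saved. A
  diameter arises as a sum, facet plus ray, and either summand may yield the saving. For five
  letters, a facet model of diameter \<open>q^2\<close> affords a ray of \<open>q^3\<close>, whereas
  a relation of length at most \<open>q - 1\<close> shortens the ray to \<open>(q - 1) * q^2\<close>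
  and leaves \<open>q^2 + q\<close> for the facet. Two independent relations make the facet rigid
  and hence cheap. What remains is a single relation of length exactly \<open>q\<close>, up to
  proportionality, or none at all; there tuples have to be exhibited. From six letters on the
  recursion is merely iterated, which is where the uncertainty \<open>q^2\<close> for
  \<open>H 6 q\<close> comes from. Positive and negative parts of a row are bounded separately,
  because fixing the first letter at 0 deletes a column and destroys the balance of a short
  vector.\<close>

lemma sum_insert_index:
  fixes f :: "nat \<Rightarrow> 'a::comm_monoid_add"
  assumes "j < Suc k"
  shows "(\<Sum>l<k. f (insert_index j l)) = (\<Sum>l\<in>{..<Suc k} - {j}. f l)"
proof -
  have "(\<Sum>l\<in>{..<Suc k} - {j}. f l) = sum f (insert_index j ` {..<k})"
    using insert_index_image[of j k] assms by (simp add: lessThan_atLeast0)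
  also have "\<dots> = (\<Sum>l<k. f (insert_index j l))"
    by (simp add: sum.reindex[OF insert_index_inj_on] o_def)
  finally show ?thesis by simp
qed

text \<open>The value 0 acts as one more coordinate, whose weight makes up for positive and negative
  parts of different size. With 0 included in the range of \<open>c\<close>, the sum is at most
  \<open>p\<close> times the spread \<open>M - m\<close>, and the two bounds on \<open>c\<close>
  keep this spread below \<open>K\<close>.\<close>

lemma abs_weighted_sum_le:
  fixes a c :: "'a \<Rightarrow> int"
  assumes "finite S" and pos: "(\<Sum>i\<in>S. max 0 (a i)) \<le> p" and neg: "(\<Sum>i\<in>S. max 0 (- a i)) \<le> p"
    and c: "\<And>i. i \<in> S \<Longrightarrow> \<bar>c i\<bar> \<le> K" and cc: "\<And>i j. i \<in> S \<Longrightarrow> j \<in> S \<Longrightarrow> \<bar>c i - c j\<bar> \<le> K"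
    and K: "0 \<le> K"
  shows "\<bar>\<Sum>i\<in>S. a i * c i\<bar> \<le> p * K"
proof -
  define M where "M = Max (insert 0 (c ` S))"
  define m where "m = Min (insert 0 (c ` S))"
  have M: "M \<in> insert 0 (c ` S)" unfolding M_def by (rule Max_in) (use assms(1) in auto)
  have m: "m \<in> insert 0 (c ` S)" unfolding m_def by (rule Min_in) (use assms(1) in auto)
  have MS: "0 \<le> M" "\<And>i. i \<in> S \<Longrightarrow> c i \<le> M" and mS: "m \<le> 0" "\<And>i. i \<in> S \<Longrightarrow> m \<le> c i"
    unfolding M_def m_def using assms(1) by (auto intro: Max_ge Min_le simp del: Max_insert Min_insert)
  have Mm: "M - m \<le> K"
    using M m c cc K by fastforce
  define P where "P = (\<Sum>i\<in>S. max 0 (a i))"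
  define N where "N = (\<Sum>i\<in>S. max 0 (- a i))"
  have split: "(\<Sum>i\<in>S. a i * c i) = (\<Sum>i\<in>S. max 0 (a i) * c i) - (\<Sum>i\<in>S. max 0 (- a i) * c i)"
    unfolding sum_subtractf[symmetric] by (rule sum.cong) (auto simp: max_def algebra_simps)
  have P0: "0 \<le> P" and N0: "0 \<le> N" unfolding P_def N_def by (auto intro: sum_nonneg)
  have w: "m * w \<le> w * c i" "w * c i \<le> M * w" if "i \<in> S" "0 \<le> w" for i w
    using MS(2)[OF that(1)] mS(2)[OF that(1)] that(2) by (simp_all add: mult.commute[of w] mult_right_mono)
  have b: "m * P \<le> (\<Sum>i\<in>S. max 0 (a i) * c i)" "(\<Sum>i\<in>S. max 0 (a i) * c i) \<le> M * P"
     "m * N \<le> (\<Sum>i\<in>S. max 0 (- a i) * c i)" "(\<Sum>i\<in>S. max 0 (- a i) * c i) \<le> M * N"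
    unfolding P_def N_def sum_distrib_left by (auto intro!: sum_mono w)
  have "M * P \<le> M * p" "M * N \<le> M * p" "m * p \<le> m * P" "m * p \<le> m * N"
    using pos neg MS(1) mS(1) by (auto simp: P_def N_def mult_left_mono mult_left_mono_neg)
  moreover have "(M - m) * p \<le> K * p"
    using Mm P0 pos by (intro mult_right_mono) (auto simp: P_def)
  ultimately show ?thesis unfolding split using b by (auto simp: algebra_simps abs_le_iff)
qed

text \<open>The determinant is affine in each row, so it is extremal when the last row is a multiple of
  some \<open>e\<^sub>i\<close> or \<open>e\<^sub>i - e\<^sub>j\<close>; in the latter case adding column \<open>i\<close> to column \<open>j\<close>
  reduces to the former without increasing the positive or negative row sums.\<close>

lemma abs_det_le_prod:
  fixes A :: "int mat"
  assumes "A \<in> carrier_mat k k"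
    and "\<And>i. i < k \<Longrightarrow> (\<Sum>j<k. max 0 (A $$ (i,j))) \<le> p i"
    and "\<And>i. i < k \<Longrightarrow> (\<Sum>j<k. max 0 (- A $$ (i,j))) \<le> p i"
  shows "\<bar>det A\<bar> \<le> (\<Prod>i<k. p i)"
  using assms
proof (induction k arbitrary: A)
  case 0
  then show ?case by simp
next
  case (Suc k)
  note A = Suc.prems(1)
  define K where "K = (\<Prod>i<k. p i)"
  define c where "c j = cofactor A k j" for j
  have p0: "0 \<le> p i" if "i < Suc k" for i
    using Suc.prems(2)[OF that] by (meson order_trans sum_nonneg max.cobounded1)
  have K0: "0 \<le> K" unfolding K_def using p0 by (intro prod_nonneg) auto
  \<comment> \<open>The induction hypothesis is also needed for a matrix other than
    \<open>A\<close>; only the rows above the last and the columns other than \<open>j\<close> enter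
    the cofactor.\<close>
  have sub: "\<bar>cofactor B k j\<bar> \<le> K"
    if B: "B \<in> carrier_mat (Suc k) (Suc k)" and j: "j < Suc k"
    and bp: "\<And>i. i < k \<Longrightarrow> (\<Sum>l\<in>{..<Suc k}-{j}. max 0 (B $$ (i,l))) \<le> p i"
    and bn: "\<And>i. i < k \<Longrightarrow> (\<Sum>l\<in>{..<Suc k}-{j}. max 0 (- B $$ (i,l))) \<le> p i" for B j
  proof -
    have D: "mat_delete B k j \<in> carrier_mat k k" using mat_delete_carrier[OF B, of k j] by simp
    have e: "mat_delete B k j $$ (i,l) = B $$ (i, insert_index j l)" if "i < k" "l < k" for i l
      using mat_delete_index[OF B _ j that, of k] that by simp
    have "(\<Sum>l<k. max 0 (mat_delete B k j $$ (i,l))) \<le> p i" if "i < k" for i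
      using bp[OF that] e[OF that] sum_insert_index[OF j, of "\<lambda>l. max 0 (B $$ (i,l))"] by simp
    moreover have "(\<Sum>l<k. max 0 (- mat_delete B k j $$ (i,l))) \<le> p i" if "i < k" for i
      using bn[OF that] e[OF that] sum_insert_index[OF j, of "\<lambda>l. max 0 (- B $$ (i,l))"] by simp
    ultimately have "\<bar>det (mat_delete B k j)\<bar> \<le> K" unfolding K_def by (rule Suc.IH[OF D])
    then show ?thesis by (simp add: cofactor_def abs_mult power_abs)
  qed
  have c1: "\<bar>c j\<bar> \<le> K" if j: "j < Suc k" for j
    unfolding c_def
  proof (rule sub[OF A j])
    fix i assume i: "i < k"
    show "(\<Sum>l\<in>{..<Suc k}-{j}. max 0 (A $$ (i,l))) \<le> p i"
      by (rule order_trans[OF sum_mono2 Suc.prems(2)]) (use i in auto)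
    show "(\<Sum>l\<in>{..<Suc k}-{j}. max 0 (- A $$ (i,l))) \<le> p i"
      by (rule order_trans[OF sum_mono2 Suc.prems(3)]) (use i in auto)
  qed
  have c2: "\<bar>c i - c j\<bar> \<le> K" if i: "i < Suc k" and j: "j < Suc k" for i j
  proof (cases "i = j")
    case True then show ?thesis using K0 by simp
  next
    case ij: False
    \<comment> \<open>With last row \<open>e_i - e_j\<close>, the difference of two cofactors
      becomes a determinant.\<close>
    define B where "B = mat (Suc k) (Suc k) (\<lambda>(r,l). if r = k then (if l = i then 1 else if l = j then -1 else 0) else A $$ (r,l))"
    have B: "B \<in> carrier_mat (Suc k) (Suc k)" by (simp add: B_def)
    have cB: "cofactor B k l = c l" if "l < Suc k" for l
    proof -
      have "mat_delete B k l = mat_delete A k l"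
        by (rule eq_matI) (use A in \<open>auto simp: mat_delete_def B_def\<close>)
      then show ?thesis by (simp add: c_def cofactor_def)
    qed
    have "det B = (\<Sum>l<Suc k. B $$ (k,l) * cofactor B k l)"
      by (rule laplace_expansion_row[OF B]) simp
    also have "\<dots> = (\<Sum>l<Suc k. (if l = i then c l else 0) - (if l = j then c l else 0))"
      by (rule sum.cong) (use ij cB in \<open>auto simp: B_def\<close>)
    also have "\<dots> = c i - c j" using i j by (simp add: sum_subtractf del: sum.lessThan_Suc)
    finally have dB: "det B = c i - c j" .
    \<comment> \<open>This column operation turns the last row into \<open>e_i\<close>, so that the
      determinant is again a single cofactor.\<close>
    define B' where "B' = addcol 1 j i B"
    have B': "B' \<in> carrier_mat (Suc k) (Suc k)" unfolding B'_def using B by (intro carrier_matI) auto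
    have dB': "det B' = det B" unfolding B'_def by (rule det_addcol[OF i _ B]) (use ij in simp)
    have eB': "B' $$ (r,l) = (if l = j then B $$ (r,i) + B $$ (r,j) else B $$ (r,l))" if "r < Suc k" "l < Suc k" for r l
      unfolding B'_def using B that by auto
    have "det B' = (\<Sum>l<Suc k. B' $$ (k,l) * cofactor B' k l)"
      by (rule laplace_expansion_row[OF B']) simp
    also have "\<dots> = (\<Sum>l<Suc k. if l = i then cofactor B' k l else 0)"
      by (rule sum.cong) (use ij i j in \<open>auto simp: eB', auto simp: B_def\<close>)
    also have "\<dots> = cofactor B' k i" using i by (simp del: sum.lessThan_Suc)
    finally have d: "c i - c j = cofactor B' k i" using dB dB' by simp
    have merge: "(\<Sum>l\<in>{..<Suc k}-{i}. max 0 (s * B' $$ (r,l))) \<le> (\<Sum>l<Suc k. max 0 (s * A $$ (r,l)))"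
      if r: "r < k" and s: "s = 1 \<or> s = -1" for r s
    proof -
      have eA: "B' $$ (r,l) = (if l = j then A $$ (r,i) + A $$ (r,j) else A $$ (r,l))" if "l < Suc k" for l
        using eB'[of r l] r that i j by (auto simp: B_def)
      let ?R = "{..<Suc k}-{i}-{j}"
      have s1: "{..<Suc k} = insert i (insert j ?R)" "{..<Suc k}-{i} = insert j ?R" using i j ij by auto
      have "(\<Sum>l\<in>{..<Suc k}-{i}. max 0 (s * B' $$ (r,l))) = max 0 (s * B' $$ (r,j)) + (\<Sum>l\<in>?R. max 0 (s * B' $$ (r,l)))"
        by (subst s1(2), rule sum.insert) auto
      also have "(\<Sum>l\<in>?R. max 0 (s * B' $$ (r,l))) = (\<Sum>l\<in>?R. max 0 (s * A $$ (r,l)))"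
        by (rule sum.cong) (auto simp: eA)
      also have "max 0 (s * B' $$ (r,j)) \<le> max 0 (s * A $$ (r,i)) + max 0 (s * A $$ (r,j))"
        using j s by (auto simp: eA distrib_left)
      also have "max 0 (s * A $$ (r,i)) + max 0 (s * A $$ (r,j)) + (\<Sum>l\<in>?R. max 0 (s * A $$ (r,l)))
         = (\<Sum>l<Suc k. max 0 (s * A $$ (r,l)))"
      proof -
        have "(\<Sum>l<Suc k. max 0 (s * A $$ (r,l))) = max 0 (s * A $$ (r,i)) + (\<Sum>l\<in>insert j ?R. max 0 (s * A $$ (r,l)))"
          by (subst s1(1), rule sum.insert) (use ij in auto)
        also have "(\<Sum>l\<in>insert j ?R. max 0 (s * A $$ (r,l))) = max 0 (s * A $$ (r,j)) + (\<Sum>l\<in>?R. max 0 (s * A $$ (r,l)))"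
          by (rule sum.insert) auto
        finally show ?thesis by simp
      qed
      finally show ?thesis by simp
    qed
    show ?thesis unfolding d
    proof (rule sub[OF B' i])
      fix r assume r: "r < k"
      show "(\<Sum>l\<in>{..<Suc k}-{i}. max 0 (B' $$ (r,l))) \<le> p r"
        using merge[OF r, of 1] Suc.prems(2)[of r] r by simp
      show "(\<Sum>l\<in>{..<Suc k}-{i}. max 0 (- B' $$ (r,l))) \<le> p r"
        using merge[OF r, of "-1"] Suc.prems(3)[of r] r by simp
    qed
  qed
  have "det A = (\<Sum>j<Suc k. A $$ (k,j) * c j)"
    unfolding c_def by (rule laplace_expansion_row[OF A]) simp
  moreover have "\<bar>\<Sum>j<Suc k. A $$ (k,j) * c j\<bar> \<le> p k * K"
    by (rule abs_weighted_sum_le) (use Suc.prems(2,3)[of k] c1 c2 K0 in auto)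
  ultimately show ?case by (simp add: K_def mult.commute)
qed

section \<open>Integer kernel vectors from bordered minors\<close>

definition minor_mat :: "(nat \<Rightarrow> int) list \<Rightarrow> nat list \<Rightarrow> int mat" where
  "minor_mat xs js = mat (length xs) (length js) (\<lambda>(i,j). (xs ! i) (js ! j))"

lemma laplace_minor_mat:
  assumes "length js = Suc (length xs)"
  shows "det (minor_mat (xs @ [x]) js) =
    (\<Sum>l<length js. x (js ! l) * ((-1) ^ (length xs + l) * det (minor_mat xs (take l js @ drop (Suc l) js))))"
proof -
  have "det (minor_mat (xs @ [x]) js) =
     (\<Sum>l<length js. minor_mat (xs @ [x]) js $$ (length xs, l) * cofactor (minor_mat (xs @ [x]) js) (length xs) l)"
    by (rule laplace_expansion_row) (use assms in \<open>auto simp: minor_mat_def\<close>)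
  also have "\<dots> = (\<Sum>l<length js. x (js ! l) * ((-1) ^ (length xs + l) * det (minor_mat xs (take l js @ drop (Suc l) js))))"
  proof (rule sum.cong[OF refl])
    fix l assume "l \<in> {..<length js}"
    then have l: "l < length js" by simp
    have "mat_delete (minor_mat (xs @ [x]) js) (length xs) l = minor_mat xs (take l js @ drop (Suc l) js)"
      by (rule eq_matI) (use l in \<open>auto simp: mat_delete_def minor_mat_def nth_append\<close>)
    then show "minor_mat (xs @ [x]) js $$ (length xs, l) * cofactor (minor_mat (xs @ [x]) js) (length xs) l =
       x (js ! l) * ((-1) ^ (length xs + l) * det (minor_mat xs (take l js @ drop (Suc l) js)))"
      using l assms by (simp add: cofactor_def) (simp add: minor_mat_def)
  qed
  finally show ?thesis .
qed

lemma sum_nth_distinct: "distinct js \<Longrightarrow> (\<Sum>l<length js. f (js ! l)) = sum f (set js)"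
  by (rule sum.reindex_bij_betw[OF bij_betw_nth]) auto

lemma sum_nth_distinct_le:
  fixes f :: "nat \<Rightarrow> int"
  assumes "distinct js" "set js \<subseteq> S" "finite S" "\<And>i. i \<in> S \<Longrightarrow> 0 \<le> f i"
  shows "(\<Sum>l<length js. f (js ! l)) \<le> sum f S"
proof -
  have "(\<Sum>l<length js. f (js ! l)) = sum f (set js)"
    by (rule sum_nth_distinct[OF assms(1)])
  also have "\<dots> \<le> sum f S" by (rule sum_mono2) (use assms in auto)
  finally show ?thesis .
qed

lemma abs_det_minor_mat_le:
  assumes len: "length xs = length js" and js: "distinct js" "set js \<subseteq> S" "finite S"
    and b: "\<And>i. i < length xs \<Longrightarrow> (\<Sum>j\<in>S. max 0 ((xs ! i) j)) \<le> p i"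
      "\<And>i. i < length xs \<Longrightarrow> (\<Sum>j\<in>S. max 0 (- (xs ! i) j)) \<le> p i"
  shows "\<bar>det (minor_mat xs js)\<bar> \<le> (\<Prod>i<length xs. p i)"
proof (rule abs_det_le_prod)
  show "minor_mat xs js \<in> carrier_mat (length xs) (length xs)" using len by (simp add: minor_mat_def)
  fix i assume i: "i < length xs"
  have e: "minor_mat xs js $$ (i,j) = (xs ! i) (js ! j)" if "j < length xs" for j
    using that i len by (simp add: minor_mat_def)
  show "(\<Sum>j<length xs. max 0 (minor_mat xs js $$ (i, j))) \<le> p i"
    using sum_nth_distinct_le[OF js, of "\<lambda>j. max 0 ((xs ! i) j)"] b(1)[OF i] e len by auto
  show "(\<Sum>j<length xs. max 0 (- minor_mat xs js $$ (i, j))) \<le> p i"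
    using sum_nth_distinct_le[OF js, of "\<lambda>j. max 0 (- (xs ! i) j)"] b(2)[OF i] e len by auto
qed

lemma det_nonzero_kernel_trivial:
  fixes A :: "int mat" and y :: "nat \<Rightarrow> real"
  assumes A: "A \<in> carrier_mat n n" and d: "det A \<noteq> 0"
    and y: "\<And>i. i < n \<Longrightarrow> (\<Sum>j<n. real_of_int (A $$ (i,j)) * y j) = 0" and j: "j < n"
  shows "y j = 0"
proof -
  let ?A = "map_mat real_of_int A"
  have A': "?A \<in> carrier_mat n n" using A by simp
  have "det ?A = real_of_int (det A)" by (rule of_int_hom.hom_det)
  then have "det ?A \<noteq> 0" using d by simp
  moreover have "?A *\<^sub>v vec n y = 0\<^sub>v n"
    by (rule eq_vecI) (use A y in \<open>auto simp: scalar_prod_def lessThan_atLeast0\<close>)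
  ultimately have "vec n y = 0\<^sub>v n"
    using det_0_iff_vec_prod_zero[OF A'] by (metis vec_carrier)
  then show ?thesis using j by (metis index_vec index_zero_vec(1))
qed

text \<open>The cofactors of a nonzero minor of maximal size, bordered by one more column, are orthogonal
  to all of \<open>Z\<close>; the row \<open>v\<close> is kept in the minor for the sake of its smaller bound \<open>p\<close>.\<close>

lemma integer_kernel_vector:
  fixes Z :: "(nat \<Rightarrow> int) set" and v :: "nat \<Rightarrow> int" and y :: "nat \<Rightarrow> real"
  assumes S: "finite S" and v: "v \<in> Z" "i0 \<in> S" "v i0 \<noteq> 0"
    and y: "\<And>x. x \<in> Z \<Longrightarrow> (\<Sum>i\<in>S. real_of_int (x i) * y i) = 0" "i1 \<in> S" "y i1 \<noteq> 0"
    and vb: "(\<Sum>i\<in>S. max 0 (v i)) \<le> p" "(\<Sum>i\<in>S. max 0 (- v i)) \<le> p"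
    and Q: "1 \<le> q" and Zb: "\<And>x. x \<in> Z \<Longrightarrow> (\<Sum>i\<in>S. max 0 (x i)) \<le> q" "\<And>x. x \<in> Z \<Longrightarrow> (\<Sum>i\<in>S. max 0 (- x i)) \<le> q"
  obtains r :: "nat \<Rightarrow> int" where "\<And>x. x \<in> Z \<Longrightarrow> (\<Sum>i\<in>S. x i * r i) = 0"
    "\<exists>i\<in>S. r i \<noteq> 0" "\<And>i. \<bar>r i\<bar> \<le> p * q ^ (card S - 2)" "\<And>i. i \<notin> S \<Longrightarrow> r i = 0"
proof -
  define P where "P k \<longleftrightarrow> (\<exists>xs js. length xs = k \<and> length js = Suc k \<and> set xs \<subseteq> Z \<and>
     distinct js \<and> set js \<subseteq> S \<and> det (minor_mat (v # xs) js) \<noteq> 0)" for k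
  have "minor_mat [v] [i0] \<in> carrier_mat 1 1" by (simp add: minor_mat_def)
  then have "det (minor_mat [v] [i0]) = v i0" by (simp add: det_single) (simp add: minor_mat_def)
  then have P0: "P 0" using v unfolding P_def by (intro exI[of _ "[]"] exI[of _ "[i0]"]) auto
  \<comment> \<open>A nonzero minor on all columns of \<open>S\<close> would force the kernel vector
    \<open>y\<close> to vanish on \<open>S\<close>. So a column is left for bordering, and
    \<open>k\<close> is at most \<open>card S - 2\<close>.\<close>
  have lt: "Suc k < card S" if Pk: "P k" for k
  proof -
    obtain xs js where *: "length xs = k" "length js = Suc k" "set xs \<subseteq> Z" "distinct js" "set js \<subseteq> S"
      "det (minor_mat (v # xs) js) \<noteq> 0" using Pk P_def by blast
    have c: "card (set js) = Suc k" using * distinct_card by fastforce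
    have "Suc k \<le> card S" using card_mono[OF S *(5)] c by simp
    moreover have "Suc k \<noteq> card S"
    proof
      assume "Suc k = card S"
      then have js: "set js = S" using card_subset_eq[OF S *(5)] c by simp
      then obtain l where l: "l < Suc k" "js ! l = i1" using y(2) *(2) by (metis in_set_conv_nth)
      have "y (js ! l) = 0"
      proof (rule det_nonzero_kernel_trivial[where n = "Suc k" and y = "\<lambda>l. y (js ! l)"])
        show "minor_mat (v # xs) js \<in> carrier_mat (Suc k) (Suc k)" using * by (simp add: minor_mat_def)
        fix i assume i: "i < Suc k"
        have z: "(v # xs) ! i \<in> Z" using i * v(1) by (metis length_Cons nth_mem set_ConsD subsetD)
        have "(\<Sum>j<Suc k. real_of_int (minor_mat (v # xs) js $$ (i, j)) * y (js ! j))
            = (\<Sum>j<length js. real_of_int (((v # xs) ! i) (js ! j)) * y (js ! j))"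
          using i * by (intro sum.cong) (auto simp: minor_mat_def)
        also have "\<dots> = (\<Sum>j\<in>set js. real_of_int (((v # xs) ! i) j) * y j)"
          by (rule sum_nth_distinct[OF *(4)])
        also have "\<dots> = 0" using y(1)[OF z] js by simp
        finally show "(\<Sum>j<Suc k. real_of_int (minor_mat (v # xs) js $$ (i, j)) * y (js ! j)) = 0" .
      qed (use l * in auto)
      then show False using l y by simp
    qed
    ultimately show ?thesis by simp
  qed
  then have bd: "\<forall>k. P k \<longrightarrow> k \<le> card S" by (meson Suc_lessD less_imp_le)
  define k where "k = (GREATEST k. P k)"
  have Pk: "P k" unfolding k_def using GreatestI_nat[of P 0 "card S"] P0 bd by blast
  have mx: "\<not> P (Suc k)"
  proof
    assume "P (Suc k)"
    then have "Suc k \<le> k" unfolding k_def by (rule Greatest_le_nat) (use bd in blast)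
    then show False by simp
  qed
  obtain xs js where *: "length xs = k" "length js = Suc k" "set xs \<subseteq> Z" "distinct js" "set js \<subseteq> S"
      "det (minor_mat (v # xs) js) \<noteq> 0" using Pk P_def by blast
  have "set js \<noteq> S" using lt[OF Pk] * distinct_card[OF *(4)] by auto
  then obtain j0 where j0: "j0 \<in> S" "j0 \<notin> set js" using *(5) by blast
  define js' where "js' = js @ [j0]"
  have js': "length js' = Suc (Suc k)" "distinct js'" "set js' \<subseteq> S" using * j0 by (auto simp: js'_def)
  define c where "c l = (-1) ^ (length (v # xs) + l) * det (minor_mat (v # xs) (take l js' @ drop (Suc l) js'))" for l
  define r where "r j = (\<Sum>l<length js'. if js' ! l = j then c l else 0)" for j
  have rr: "r (js' ! l) = c l" if "l < length js'" for l
  proof -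
    have "r (js' ! l) = (\<Sum>l'<length js'. if l' = l then c l else 0)"
      unfolding r_def by (rule sum.cong) (use js'(2) that in \<open>auto simp: nth_eq_iff_index_eq\<close>)
    then show ?thesis using that by simp
  qed
  have r0: "r j = 0" if "j \<notin> set js'" for j
    unfolding r_def by (rule sum.neutral) (use that in \<open>auto\<close>)
  have xr: "(\<Sum>i\<in>S. x i * r i) = det (minor_mat (v # xs @ [x]) js')" for x
  proof -
    have "(\<Sum>i\<in>S. x i * r i) = (\<Sum>i\<in>set js'. x i * r i)"
      by (rule sum.mono_neutral_right) (use S js' r0 in auto)
    also have "\<dots> = (\<Sum>l<length js'. x (js' ! l) * r (js' ! l))"
      by (rule sum_nth_distinct[OF js'(2), symmetric])
    also have "\<dots> = (\<Sum>l<length js'. x (js' ! l) * c l)" using rr by simp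
    also have "\<dots> = det (minor_mat ((v # xs) @ [x]) js')"
      unfolding c_def by (rule laplace_minor_mat[symmetric]) (use js' * in auto)
    finally show ?thesis by simp
  qed
  show thesis
  proof (rule that[of r])
    fix x assume x: "x \<in> Z"
    have "\<not> (set (xs @ [x]) \<subseteq> Z \<and> det (minor_mat (v # xs @ [x]) js') \<noteq> 0)"
      using mx js' *(1) unfolding P_def by (metis length_append_singleton)
    then show "(\<Sum>i\<in>S. x i * r i) = 0" using xr[of x] x *(3) by auto
  next
    \<comment> \<open>The cofactor at the new column is, up to sign, the nonzero minor
      itself.\<close>
    have "r j0 = c (Suc k)" using rr[of "Suc k"] js'(1) *(2) by (simp add: js'_def nth_append)
    also have "\<dots> \<noteq> 0" using *(2,6) by (simp add: c_def js'_def)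
    finally show "\<exists>i\<in>S. r i \<noteq> 0" using j0 by blast
  next
    fix i
    have q0: "0 \<le> p" using vb(1) by (meson order_trans sum_nonneg max.cobounded1)
    have le: "p * q ^ k \<le> p * q ^ (card S - 2)"
      using lt[OF Pk] Q q0 by (intro mult_left_mono power_increasing) auto
    show "\<bar>r i\<bar> \<le> p * q ^ (card S - 2)"
    proof (cases "i \<in> set js'")
      case False
      have "0 \<le> p * q ^ k" using q0 Q by auto
      then show ?thesis using r0[OF False] le by simp
    next
      case True
      then obtain l where l: "l < length js'" "i = js' ! l" by (metis in_set_conv_nth)
      let ?pb = "\<lambda>i. if i = 0 then p else q"
      have "\<bar>det (minor_mat (v # xs) (take l js' @ drop (Suc l) js'))\<bar> \<le> (\<Prod>i<length (v # xs). ?pb i)"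
      proof (rule abs_det_minor_mat_le)
        show "distinct (take l js' @ drop (Suc l) js')"
          using js'(2) by (simp add: set_take_disj_set_drop_if_distinct)
        show "set (take l js' @ drop (Suc l) js') \<subseteq> S"
          using js'(3) by (auto dest: in_set_takeD in_set_dropD)
        fix i assume i: "i < length (v # xs)"
        have "(v # xs) ! i \<in> Z" using i *(3) v(1) by (metis nth_mem set_ConsD subsetD)
        then show "(\<Sum>j\<in>S. max 0 (((v # xs) ! i) j)) \<le> ?pb i" "(\<Sum>j\<in>S. max 0 (- ((v # xs) ! i) j)) \<le> ?pb i"
          using vb Zb by (cases i; simp)+
      qed (use S js' l * in auto)
      also have "(\<Prod>i<length (v # xs). ?pb i) = p * q ^ k" by (simp add: prod.lessThan_Suc_shift *(1) del: prod.lessThan_Suc)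
      finally show ?thesis using rr[OF l(1)] l(2) le by (simp add: c_def abs_mult power_abs)
    qed
  next
    show "r i = 0" if "i \<notin> S" for i using r0 that js'(3) by blast
  qed
qed

subsection \<open>Short vectors and models\<close>

text \<open>Two index lists of the same length \<open>h \<le> q\<close> matter only through the difference of their
  counting functions; these differences are the short vectors.  Alphabets are functions on
  \<open>{..<m}\<close>, and \<open>models\<close> also admits alphabets with repeated letters, which arise on the faces of
  order cones.\<close>

definition shorts :: "nat \<Rightarrow> nat \<Rightarrow> (nat \<Rightarrow> int) set" where
  "shorts m q = {x. (\<forall>i\<ge>m. x i = 0) \<and> (\<Sum>i<m. x i) = 0 \<and> (\<Sum>i<m. max 0 (x i)) \<le> int q}"

definition ip :: "nat \<Rightarrow> (nat \<Rightarrow> int) \<Rightarrow> (nat \<Rightarrow> real) \<Rightarrow> real" where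
  "ip m x y = (\<Sum>i<m. real_of_int (x i) * y i)"

definition gap :: "nat \<Rightarrow> nat \<Rightarrow> int" where
  "gap i j = (if j = Suc i then 1 else if j = i then -1 else 0)"

definition winc :: "nat \<Rightarrow> (nat \<Rightarrow> 'a::linorder) \<Rightarrow> bool" where
  "winc m t \<longleftrightarrow> (\<forall>i. Suc i < m \<longrightarrow> t i \<le> t (Suc i))"

definition sinc :: "nat \<Rightarrow> (nat \<Rightarrow> 'a::linorder) \<Rightarrow> bool" where
  "sinc m t \<longleftrightarrow> (\<forall>i. Suc i < m \<longrightarrow> t i < t (Suc i))"

text \<open>Weak monotonicity suffices: for \<open>q \<ge> 1\<close> the gaps are short vectors
  themselves, so \<open>s\<close> repeats a letter exactly where \<open>t\<close> does.\<close>

definition models :: "nat \<Rightarrow> nat \<Rightarrow> (nat \<Rightarrow> real) \<Rightarrow> (nat \<Rightarrow> int) \<Rightarrow> bool" where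
  "models m q t s \<longleftrightarrow> winc m s \<and> (\<forall>x\<in>shorts m q. ip m x t = 0 \<longleftrightarrow> ip m x (\<lambda>i. real_of_int (s i)) = 0)"

definition has_model :: "nat \<Rightarrow> nat \<Rightarrow> (nat \<Rightarrow> real) \<Rightarrow> int \<Rightarrow> bool" where
  "has_model m q t D \<longleftrightarrow> (\<exists>s. models m q t s \<and> s (m - 1) - s 0 \<le> D)"

definition bnd :: "nat \<Rightarrow> nat \<Rightarrow> int \<Rightarrow> bool" where
  "bnd m q D \<longleftrightarrow> (\<forall>t. sinc m t \<longrightarrow> has_model m q t D)"

definition flat :: "nat \<Rightarrow> nat \<Rightarrow> (nat \<Rightarrow> real) \<Rightarrow> (nat \<Rightarrow> real) set" where
  "flat m q t = {z. \<forall>x\<in>shorts m q. ip m x t = 0 \<longrightarrow> ip m x z = 0}"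

lemma ip_add: "ip m x (\<lambda>i. y i + z i) = ip m x y + ip m x z"
  by (simp add: ip_def distrib_left sum.distrib)

lemma ip_diff: "ip m x (\<lambda>i. y i - z i) = ip m x y - ip m x z"
  by (simp add: ip_def right_diff_distrib sum_subtractf)

lemma ip_scale: "ip m x (\<lambda>i. c * y i) = c * ip m x y"
  by (simp add: ip_def sum_distrib_left mult.left_commute)

lemma ip_const: "x \<in> shorts m q \<Longrightarrow> ip m x (\<lambda>i. c) = 0"
proof -
  assume x: "x \<in> shorts m q"
  have "ip m x (\<lambda>i. c) = real_of_int (\<Sum>i<m. x i) * c" by (simp add: ip_def sum_distrib_right)
  also have "(\<Sum>i<m. x i) = 0" using x by (simp add: shorts_def)
  finally show ?thesis by simp
qed

lemma ip_cong: "(\<And>i. i < m \<Longrightarrow> y i = z i) \<Longrightarrow> ip m x y = ip m x z"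
  by (simp add: ip_def)

lemma ip_gap: "Suc i < m \<Longrightarrow> ip m (gap i) y = y (Suc i) - y i"
proof -
  assume m: "Suc i < m"
  have "ip m (gap i) y = (\<Sum>j<m. (if j = Suc i then y j else 0) - (if j = i then y j else 0))"
    unfolding ip_def by (rule sum.cong) (auto simp: gap_def)
  then show ?thesis using m by (simp add: sum_subtractf)
qed

lemma gap_shorts: "Suc i < m \<Longrightarrow> 1 \<le> q \<Longrightarrow> gap i \<in> shorts m q"
proof -
  assume m: "Suc i < m" and q: "1 \<le> q"
  have "(\<Sum>j<m. gap i j) = (\<Sum>j<m. (if j = Suc i then 1 else 0) - (if j = i then 1 else 0))"
    by (rule sum.cong) (auto simp: gap_def)
  moreover have "(\<Sum>j<m. max 0 (gap i j)) = (\<Sum>j<m. (if j = Suc i then 1 else 0))"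
    by (rule sum.cong) (auto simp: gap_def)
  ultimately show ?thesis using m q by (auto simp: shorts_def sum_subtractf gap_def)
qed

lemma shorts_neg_sum: "x \<in> shorts m q \<Longrightarrow> (\<Sum>i<m. max 0 (- x i)) \<le> int q"
proof -
  assume x: "x \<in> shorts m q"
  have "(\<Sum>i<m. max 0 (- x i)) = (\<Sum>i<m. max 0 (x i) - x i)"
    by (rule sum.cong) auto
  then show ?thesis using x by (simp add: sum_subtractf shorts_def)
qed

lemma shorts_abs_le: "x \<in> shorts m q \<Longrightarrow> \<bar>x i\<bar> \<le> int q"
proof (cases "i < m")
  case True
  assume x: "x \<in> shorts m q"
  have "max 0 (x i) \<le> (\<Sum>i<m. max 0 (x i))" "max 0 (- x i) \<le> (\<Sum>i<m. max 0 (- x i))"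
    by (rule member_le_sum; use True in auto)+
  then show ?thesis using x shorts_neg_sum[OF x] by (auto simp: shorts_def)
qed (auto simp: shorts_def)

lemma finite_shorts: "finite (shorts m q)"
proof (rule finite_subset)
  show "shorts m q \<subseteq> {f. \<forall>i. (i \<in> {..<m} \<longrightarrow> f i \<in> {- int q..int q}) \<and> (i \<notin> {..<m} \<longrightarrow> f i = 0)}"
  proof
    fix x assume x: "x \<in> shorts m q"
    have "x i \<in> {- int q..int q}" for i using shorts_abs_le[OF x, of i] by (auto simp: abs_le_iff)
    moreover have "x i = 0" if "i \<notin> {..<m}" for i using x that by (auto simp: shorts_def)
    ultimately show "x \<in> {f. \<forall>i. (i \<in> {..<m} \<longrightarrow> f i \<in> {- int q..int q}) \<and> (i \<notin> {..<m} \<longrightarrow> f i = 0)}"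
      by simp
  qed
  show "finite {f :: nat \<Rightarrow> int. \<forall>i. (i \<in> {..<m} \<longrightarrow> f i \<in> {- int q..int q}) \<and> (i \<notin> {..<m} \<longrightarrow> f i = 0)}"
    by (rule finite_set_of_finite_funs) auto
qed

lemma shorts_mono: "p \<le> q \<Longrightarrow> shorts m p \<subseteq> shorts m q"
  by (auto simp: shorts_def)

lemma winc_le: "winc m t \<Longrightarrow> i \<le> j \<Longrightarrow> j < m \<Longrightarrow> t i \<le> t j"
proof (induction j)
  case (Suc j)
  then show ?case by (cases "i = Suc j") (auto simp: winc_def intro: order_trans)
qed auto

lemma sinc_imp_winc: "sinc m t \<Longrightarrow> winc m t"
  by (auto simp: sinc_def winc_def less_imp_le)

lemma sinc_less: "sinc m t \<Longrightarrow> i < j \<Longrightarrow> j < m \<Longrightarrow> t i < t j"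
proof (induction j)
  case (Suc j)
  then show ?case by (cases "i = j") (auto simp: sinc_def intro: less_trans)
qed auto

lemma const_if_gaps_zero:
  "(\<And>j. Suc j < m \<Longrightarrow> z (Suc j) = z j) \<Longrightarrow> i < m \<Longrightarrow> z i = z 0"
  by (induction i) auto

lemma has_model_mono: "has_model m q t D \<Longrightarrow> D \<le> D' \<Longrightarrow> has_model m q t D'"
  by (auto simp: has_model_def)

subsection \<open>Integer rays of sign cells\<close>

text \<open>Short vectors annihilate constants, so letter 0 can be pinned at 0 and its column
  dropped. This leaves \<open>m - 1\<close> columns, hence minors with at most \<open>m - 2\<close>
  rows. The two forms of \<open>B\<close> correspond to having a relation of length at most
  \<open>p\<close> among the rows or not.\<close>

lemma integer_kernel_shorts:
  assumes m: "3 \<le> m" and q: "1 \<le> q" and Z: "Z \<subseteq> shorts m q"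
    and y: "\<And>x. x \<in> Z \<Longrightarrow> ip m x y = 0" "i1 < m" "y i1 \<noteq> y 0"
    and B: "(\<exists>v\<in>Z \<inter> shorts m p. v \<noteq> (\<lambda>_. 0)) \<and> B = int p * int q ^ (m - 3) \<or> B = int q ^ (m - 2)"
  obtains r :: "nat \<Rightarrow> int" where "r 0 = 0" "\<And>x. x \<in> Z \<Longrightarrow> ip m x (\<lambda>i. real_of_int (r i)) = 0"
    "\<exists>i<m. r i \<noteq> 0" "\<And>i. \<bar>r i\<bar> \<le> B"
proof (cases "\<exists>v\<in>Z. v \<noteq> (\<lambda>_. 0)")
  case False
  then have B': "B = int q ^ (m - 2)" using B by auto
  \<comment> \<open>Here \<open>Z\<close> contains at most the zero vector, so any nonzero vector
    that is 0 at letter 0 serves.\<close>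
  show thesis
  proof (rule that[of "\<lambda>i. if i = 1 then 1 else 0"])
    show "\<exists>i<m. (if i = 1 then 1 else 0 :: int) \<noteq> 0" using m by (intro exI[of _ 1]) auto
    show "\<bar>if i = 1 then 1 else 0 :: int\<bar> \<le> B" for i :: nat using q B' by simp
  qed (use False in \<open>auto simp: ip_def\<close>)
next
  case True
  note concl = that
  define S where "S = {1..<m}"
  have Sm: "{..<m} = insert 0 S" "0 \<notin> S" "finite S" using m by (auto simp: S_def)
  have sumS: "(\<Sum>i<m. f i) = f 0 + (\<Sum>i\<in>S. f i)" for f :: "nat \<Rightarrow> 'b::comm_monoid_add"
    unfolding Sm(1) using Sm(2,3) by simp
  have main: thesis if v: "v \<in> Z" "v \<in> shorts m p'" "v \<noteq> (\<lambda>_. 0)" and Bp: "B = int p' * int q ^ (m - 3)" for v p'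
  proof -
    have "\<exists>i0\<in>S. v i0 \<noteq> 0"
    proof (rule ccontr)
      assume "\<not> ?thesis"
      then have *: "\<forall>i\<in>S. v i = 0" by auto
      then have "v 0 = 0" using v(2) sumS[of v] by (simp add: shorts_def)
      moreover have "v i = 0" if "i \<notin> S" "i \<noteq> 0" for i using that v(2) by (auto simp: shorts_def S_def)
      ultimately have "v = (\<lambda>_. 0)" using * by (auto simp: fun_eq_iff)
      then show False using v(3) by simp
    qed
    then obtain i0 where i0: "i0 \<in> S" "v i0 \<noteq> 0" by auto
    have pos: "(\<Sum>i\<in>S. max 0 (x i)) \<le> int k" "(\<Sum>i\<in>S. max 0 (- x i)) \<le> int k" if "x \<in> shorts m k" for x k
      using that sumS[of "\<lambda>i. max 0 (x i)"] sumS[of "\<lambda>i. max 0 (- x i)"] shorts_neg_sum[OF that]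
      by (auto simp: shorts_def)
    have i1: "i1 \<in> S" using y(2,3) by (cases "i1 = 0") (auto simp: S_def)
    have e: "ip m x w = (\<Sum>i\<in>S. real_of_int (x i) * (w i - w 0))" if "x \<in> shorts m q" for x w
    proof -
      have "ip m x w = ip m x (\<lambda>i. w i - w 0)" using ip_const[OF that, of "w 0"] by (simp add: ip_diff)
      then show ?thesis by (simp add: ip_def sumS)
    qed
    obtain r :: "nat \<Rightarrow> int" where r: "\<And>x. x \<in> Z \<Longrightarrow> (\<Sum>i\<in>S. x i * r i) = 0"
      "\<exists>i\<in>S. r i \<noteq> 0" "\<And>i. \<bar>r i\<bar> \<le> int p' * int q ^ (card S - 2)" "\<And>i. i \<notin> S \<Longrightarrow> r i = 0"
    proof (rule integer_kernel_vector[where y = "\<lambda>i. y i - y 0" and p = "int p'" and q = "int q", OF Sm(3) v(1) i0])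
      show "(\<Sum>i\<in>S. real_of_int (x i) * (y i - y 0)) = 0" if "x \<in> Z" for x
        using y(1)[OF that] e that Z by auto
      show "i1 \<in> S" "y i1 - y 0 \<noteq> 0" using i1 y(3) by auto
      show "1 \<le> int q" using q by simp
      show "(\<Sum>i\<in>S. max 0 (v i)) \<le> int p'" "(\<Sum>i\<in>S. max 0 (- v i)) \<le> int p'"
        by (rule pos[OF v(2)])+
      fix x assume "x \<in> Z"
      then have x: "x \<in> shorts m q" using Z by auto
      show "(\<Sum>i\<in>S. max 0 (x i)) \<le> int q" "(\<Sum>i\<in>S. max 0 (- x i)) \<le> int q"
        by (rule pos[OF x])+
    qed auto
    show thesis
    proof (rule concl[of r])
      show r0: "r 0 = 0" using r(4) Sm(2) by simp
      show "ip m x (\<lambda>i. real_of_int (r i)) = 0" if "x \<in> Z" for x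
      proof -
        have "real_of_int (\<Sum>i\<in>S. x i * r i) = 0" using r(1)[OF that] by simp
        then show ?thesis using e[of x "\<lambda>i. real_of_int (r i)"] that Z r0 by auto
      qed
      show "\<exists>i<m. r i \<noteq> 0" using r(2) by (auto simp: S_def)
      show "\<bar>r i\<bar> \<le> B" for i using r(3)[of i] Bp by (simp add: S_def eval_nat_numeral)
    qed
  qed
  obtain v0 where v0: "v0 \<in> Z" "v0 \<noteq> (\<lambda>_. 0)" using True by auto
  from B show thesis
  proof
    assume "(\<exists>v\<in>Z \<inter> shorts m p. v \<noteq> (\<lambda>_. 0)) \<and> B = int p * int q ^ (m - 3)"
    then show thesis using main by blast
  next
    assume "B = int q ^ (m - 2)"
    then have "B = int q * int q ^ (m - 3)" using m
      by (metis Suc_diff_le diff_Suc_Suc numeral_2_eq_2 numeral_3_eq_3 power_Suc)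
    then show thesis using main[OF v0(1) _ v0(2)] Z v0(1) by blast
  qed
qed

text \<open>A vector of the closed sign cell of \<open>t\<close> that is off the wall of gap \<open>i\<close> and annihilated by as
  many short vectors as possible is proportional, up to constants, to the integer kernel vector:
  otherwise it could be moved inside the cell, keeping gap \<open>i\<close>, until a further short vector
  vanishes.\<close>

lemma integer_ray:
  assumes m: "3 \<le> m" and q: "1 \<le> q" and t: "sinc m t" and i: "Suc i < m" and pq: "p \<le> q"
    and B: "(\<exists>v\<in>shorts m p. v \<noteq> (\<lambda>_. 0) \<and> ip m v t = 0) \<and> B = int p * int q ^ (m - 3) \<or> B = int q ^ (m - 2)"
  obtains r :: "nat \<Rightarrow> int" where "(\<lambda>j. real_of_int (r j)) \<in> flat m q t"
    "\<And>x. x \<in> shorts m q \<Longrightarrow> 0 \<le> ip m x t * ip m x (\<lambda>j. real_of_int (r j))"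
    "r i < r (Suc i)" "r (m - 1) - r 0 \<le> B"
proof -
  define C where "C = {y \<in> flat m q t. (\<forall>x\<in>shorts m q. 0 \<le> ip m x t * ip m x y) \<and> y i < y (Suc i)}"
  define Z where "Z y = {x \<in> shorts m q. ip m x y = 0}" for y
  have finZ: "finite (Z y)" for y unfolding Z_def using finite_shorts by auto
  have tC: "t \<in> C" using t i by (auto simp: C_def flat_def sinc_def)
  have "card (Z y) < Suc (card (shorts m q))" for y
    by (simp add: Z_def card_mono finite_shorts less_Suc_eq_le)
  then obtain y where yC: "y \<in> C" and ymax: "\<And>y'. y' \<in> C \<Longrightarrow> card (Z y') \<le> card (Z y)"
    using ex_has_greatest_nat[of "\<lambda>y. y \<in> C" t "\<lambda>y. card (Z y)" "Suc (card (shorts m q))"] tC by auto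
  have yf: "y i < y (Suc i)" and ycell: "\<And>x. x \<in> shorts m q \<Longrightarrow> 0 \<le> ip m x t * ip m x y"
    and yflat: "\<And>x. x \<in> shorts m q \<Longrightarrow> ip m x t = 0 \<Longrightarrow> ip m x y = 0"
    using yC by (auto simp: C_def flat_def)
  have "\<exists>i1<m. y i1 \<noteq> y 0"
  proof (cases "y i = y 0")
    case True then show ?thesis using yf i by (intro exI[of _ "Suc i"]) auto
  next
    case False then show ?thesis using i by (intro exI[of _ i]) auto
  qed
  then obtain i1 where i1: "i1 < m" "y i1 \<noteq> y 0" by blast
  obtain r :: "nat \<Rightarrow> int" where r: "r 0 = 0" "\<And>x. x \<in> Z y \<Longrightarrow> ip m x (\<lambda>i. real_of_int (r i)) = 0"
    "\<exists>i<m. r i \<noteq> 0" "\<And>i. \<bar>r i\<bar> \<le> B"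
  proof (rule integer_kernel_shorts[OF m q, of "Z y" y i1 p B])
    have "v \<in> Z y" if "v \<in> shorts m p" "ip m v t = 0" for v
      using that yflat shorts_mono[OF pq] by (auto simp: Z_def)
    then show "(\<exists>v\<in>Z y \<inter> shorts m p. v \<noteq> (\<lambda>_. 0)) \<and> B = int p * int q ^ (m - 3) \<or> B = int q ^ (m - 2)"
      using B by blast
  qed (use i1 in \<open>auto simp: Z_def\<close>)
  \<comment> \<open>Subtracting \<open>c * y\<close> closes gap \<open>i\<close> in
    \<open>z\<close>, so moving \<open>y\<close> along \<open>z\<close> leaves its gap
    \<open>i\<close> as it is.\<close>
  define c where "c = (real_of_int (r (Suc i)) - real_of_int (r i)) / (y (Suc i) - y i)"
  define z where "z = (\<lambda>j. real_of_int (r j) - c * y j)"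
  have zi: "z (Suc i) = z i" using yf by (simp add: z_def c_def field_simps)
  have ipz: "ip m x z = ip m x (\<lambda>j. real_of_int (r j)) - c * ip m x y" for x
    by (simp add: z_def ip_diff ip_scale)
  have zZ: "ip m x z = 0" if "x \<in> Z y" for x using r(2)[OF that] that ipz by (simp add: Z_def)
  have zc: "z (Suc j) = z j" if j: "Suc j < m" for j
  proof (rule ccontr)
    assume ne: "z (Suc j) \<noteq> z j"
    \<comment> \<open>The sign is chosen such that gap \<open>j\<close> shrinks along
      \<open>w\<close>; hence a wall is met.\<close>
    define w where "w = (\<lambda>l. (if z (Suc j) < z j then 1 else -1) * z l)"
    have ipw: "ip m x w = (if z (Suc j) < z j then 1 else -1) * ip m x z" for x
      unfolding w_def by (rule ip_scale)
    define X where "X = {x \<in> shorts m q. ip m x t * ip m x w < 0}"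
    have gX: "gap j \<in> X"
    proof -
      have "ip m (gap j) t > 0" using t j by (simp add: ip_gap sinc_def)
      moreover have "ip m (gap j) w < 0" using ne j unfolding ipw by (auto simp: ip_gap)
      ultimately show ?thesis using j q by (simp add: X_def gap_shorts mult_less_0_iff)
    qed
    have finX: "finite X" unfolding X_def using finite_shorts by auto
    \<comment> \<open>\<open>f x\<close> is the distance along \<open>w\<close> at which
      \<open>x\<close> vanishes, and \<open>x0\<close> is a wall met first.\<close>
    define f where "f x = - ip m x y / ip m x w" for x
    have Xpos: "0 < f x" if "x \<in> X" for x
    proof -
      have x: "x \<in> shorts m q" "ip m x t * ip m x w < 0" using that by (auto simp: X_def)
      have "ip m x y \<noteq> 0" using x zZ[of x] ipw[of x] by (auto simp: Z_def)
      then show ?thesis using ycell[OF x(1)] x(2)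
        by (auto simp: f_def zero_less_divide_iff divide_less_0_iff mult_less_0_iff zero_le_mult_iff)
    qed
    obtain x0 where x0: "x0 \<in> X" "\<And>x. x \<in> X \<Longrightarrow> f x0 \<le> f x"
      using finX gX by (metis arg_min_if_finite(1) arg_min_least empty_iff)
    define y' where "y' = (\<lambda>l. y l + f x0 * w l)"
    have ipy': "ip m x y' = ip m x y + f x0 * ip m x w" for x
      by (simp add: y'_def ip_add ip_scale)
    have sub: "Z y \<subseteq> Z y'" using zZ by (auto simp: Z_def ipy' ipw)
    have "ip m x0 w \<noteq> 0" using x0(1) by (auto simp: X_def)
    then have x0': "x0 \<in> Z y'" using x0(1) by (auto simp: Z_def X_def ipy' f_def)
    have "ip m x0 y \<noteq> 0" using Xpos[OF x0(1)] by (auto simp: f_def)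
    then have "Z y \<subset> Z y'" using sub x0' by (auto simp: Z_def)
    then have "card (Z y) < card (Z y')" by (rule psubset_card_mono[OF finZ])
    moreover have "y' \<in> C"
      unfolding C_def
    proof (intro CollectI conjI ballI)
      show "y' \<in> flat m q t" using yflat sub by (auto simp: flat_def Z_def)
      show "y' i < y' (Suc i)" using yf zi by (simp add: y'_def w_def)
      fix x assume x: "x \<in> shorts m q"
      show "0 \<le> ip m x t * ip m x y'"
      proof (cases "x \<in> X")
        case False
        then have "0 \<le> ip m x t * ip m x w" using x by (auto simp: X_def)
        then have "0 \<le> f x0 * (ip m x t * ip m x w)" using Xpos[OF x0(1)] by simp
        then show ?thesis using ycell[OF x] by (simp add: ipy' distrib_left mult.left_commute)
      next
        case True
        then have tw: "ip m x t * ip m x w < 0" by (auto simp: X_def)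
        then have "ip m x w \<noteq> 0" by auto
        then have "ip m x y = - f x * ip m x w" by (simp add: f_def)
        then have eq: "ip m x t * ip m x y' = (f x0 - f x) * (ip m x t * ip m x w)"
          by (simp add: ipy' algebra_simps)
        show ?thesis unfolding eq by (rule mult_nonpos_nonpos) (use x0(2)[OF True] tw in auto)
      qed
    qed
    ultimately show False using ymax by fastforce
  qed
  have rc: "real_of_int (r j) = c * y j + z 0" if "j < m" for j
    using const_if_gaps_zero[of m z j] zc that by (simp add: z_def)
  have c0: "c \<noteq> 0"
  proof
    assume "c = 0"
    have rz: "real_of_int (r j) = z 0" if "j < m" for j
      using rc[OF that] unfolding \<open>c = 0\<close> by linarith
    obtain j where j: "j < m" "r j \<noteq> 0" using r(3) by blast
    have "real_of_int (r j) = real_of_int (r 0)" using rz[OF j(1)] rz[of 0] m by linarith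
    then show False using r(1) j(2) by simp
  qed
  have ipr: "ip m x (\<lambda>j. real_of_int (r j)) = c * ip m x y" if "x \<in> shorts m q" for x
  proof -
    have "ip m x (\<lambda>j. real_of_int (r j)) = ip m x (\<lambda>j. c * y j + z 0)"
      by (rule ip_cong) (use rc in auto)
    then show ?thesis using ip_const[OF that] by (simp add: ip_add ip_scale)
  qed
  \<comment> \<open>Modulo constants the kernel vector is \<open>c\<close> times \<open>y\<close>
    with \<open>c\<close> of either sign; negation puts it on the side of \<open>y\<close>.\<close>
  define s where "s = (\<lambda>j. (if c > 0 then r j else - r j))"
  have ips: "ip m x (\<lambda>j. real_of_int (s j)) = \<bar>c\<bar> * ip m x y" if "x \<in> shorts m q" for x
  proof (cases "c > 0")
    case True then show ?thesis using ipr[OF that] by (simp add: s_def)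
  next
    case False
    have "ip m x (\<lambda>j. real_of_int (s j)) = - ip m x (\<lambda>j. real_of_int (r j))"
      using False by (simp add: s_def ip_def sum_negf)
    then show ?thesis using False ipr[OF that] by simp
  qed
  show thesis
  proof (rule that[of s])
    show "(\<lambda>j. real_of_int (s j)) \<in> flat m q t" using yflat ips by (auto simp: flat_def)
    show "0 \<le> ip m x t * ip m x (\<lambda>j. real_of_int (s j))" if "x \<in> shorts m q" for x
    proof -
      have "0 \<le> \<bar>c\<bar> * (ip m x t * ip m x y)" using ycell[OF that] by simp
      then show ?thesis by (simp add: ips[OF that] mult.left_commute)
    qed
    have "real_of_int (s (Suc i)) - real_of_int (s i) = \<bar>c\<bar> * (y (Suc i) - y i)"
      using ips[OF gap_shorts[OF i q]] by (simp add: ip_gap[OF i])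
    also have "\<dots> > 0" using c0 yf by simp
    finally show "s i < s (Suc i)" by simp
    show "s (m - 1) - s 0 \<le> B" using r(1) r(4)[of "m - 1"] by (auto simp: s_def)
  qed
qed

subsection \<open>Generic facet points and the recursion\<close>

text \<open>If \<open>e\<close> is below every \<open>abs (a x) / (abs (b x) + 1)\<close>, the
  perturbation cannot change the sign of a nonzero \<open>a x\<close>.\<close>

lemma small_positive:
  fixes a b :: "'a \<Rightarrow> real"
  assumes "finite X"
  obtains e :: real where "0 < e" "\<And>x. x \<in> X \<Longrightarrow> a x \<noteq> 0 \<Longrightarrow> 0 < a x * (a x + e * b x)"
proof -
  define c where "c x = (if a x = 0 then 1 else \<bar>a x\<bar> / (\<bar>b x\<bar> + 1))" for x
  define e where "e = Min (insert 1 (c ` X)) / 2"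
  have cpos: "0 < c x" for x by (auto simp: c_def)
  have m: "0 < Min (insert 1 (c ` X))" using assms cpos by auto
  have e0: "0 < e" using m by (simp add: e_def)
  have "0 < a x * (a x + e * b x)" if x: "x \<in> X" "a x \<noteq> 0" for x
  proof -
    have "Min (insert 1 (c ` X)) \<le> c x" by (rule Min_le) (use assms x in auto)
    then have "e < c x" using m by (simp add: e_def)
    then have "e < \<bar>a x\<bar> / (\<bar>b x\<bar> + 1)" using x by (simp add: c_def)
    then have "e * (\<bar>b x\<bar> + 1) < \<bar>a x\<bar>" by (simp add: pos_less_divide_eq)
    then have "\<bar>e * b x\<bar> < \<bar>a x\<bar>" using e0 by (simp add: abs_mult distrib_left)
    then show ?thesis by (auto simp: zero_less_mult_iff abs_if split: if_splits)
  qed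
  with e0 show thesis by (rule that)
qed

definition linfun :: "((nat \<Rightarrow> real) \<Rightarrow> real) \<Rightarrow> bool" where
  "linfun f \<longleftrightarrow> (\<forall>y z e. f (\<lambda>i. y i + e * z i) = f y + e * f z)"

text \<open>A small multiple of a witness for the new functional makes that one nonzero and keeps
  the others nonzero.\<close>

lemma avoid_hyperplanes:
  assumes "finite F" and W: "\<And>y z e. y \<in> W \<Longrightarrow> z \<in> W \<Longrightarrow> (\<lambda>i. y i + e * z i) \<in> W" "w0 \<in> W"
    and "\<And>f. f \<in> F \<Longrightarrow> linfun f" "\<And>f. f \<in> F \<Longrightarrow> \<exists>w\<in>W. f w \<noteq> 0"
  shows "\<exists>w\<in>W. \<forall>f\<in>F. f w \<noteq> 0"
  using assms(1,4,5)
proof (induction F)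
  case empty
  then show ?case using W(2) by auto
next
  case (insert g F)
  then obtain w where w: "w \<in> W" "\<forall>f\<in>F. f w \<noteq> 0" by auto
  obtain w' where w': "w' \<in> W" "g w' \<noteq> 0" using insert.prems(2) by auto
  obtain e :: real where e: "0 < e" "\<And>f. f \<in> insert g F \<Longrightarrow> f w \<noteq> 0 \<Longrightarrow> 0 < f w * (f w + e * f w')"
    using small_positive[of "insert g F" "\<lambda>f. f w" "\<lambda>f. f w'"] insert.hyps(1) by auto
  have "f (\<lambda>i. w i + e * w' i) \<noteq> 0" if f: "f \<in> insert g F" for f
  proof -
    have "f (\<lambda>i. w i + e * w' i) = f w + e * f w'" using insert.prems(1)[OF f] by (auto simp: linfun_def)
    moreover have "f w + e * f w' \<noteq> 0"
    proof (cases "f w = 0")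
      case True
      then have "f = g" using f w(2) by auto
      then show ?thesis using True e(1) w'(2) by simp
    next
      case False then show ?thesis using e(2)[OF f] by auto
    qed
    ultimately show ?thesis by simp
  qed
  then show ?case using W(1)[OF w(1) w'(1)] by blast
qed

lemma flat_closed: "y \<in> flat m q t \<Longrightarrow> z \<in> flat m q t \<Longrightarrow> (\<lambda>i. y i + e * z i) \<in> flat m q t"
  by (auto simp: flat_def ip_add ip_scale)

text \<open>The short relations of \<open>t'\<close> are just those that hold on the whole section
  of \<open>flat m q t\<close> by the wall of gap \<open>i\<close>. Further letters may coincide, if
  closing gap \<open>i\<close> forces them to.\<close>

definition generic_on_facet :: "nat \<Rightarrow> nat \<Rightarrow> (nat \<Rightarrow> real) \<Rightarrow> nat \<Rightarrow> (nat \<Rightarrow> real) \<Rightarrow> bool" where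
  "generic_on_facet m q t i t' \<longleftrightarrow> Suc i < m \<and> t' \<in> flat m q t \<and> t' i = t' (Suc i) \<and>
     (\<forall>x\<in>shorts m q. ip m x t' = 0 \<longrightarrow> (\<forall>z\<in>flat m q t. z i = z (Suc i) \<longrightarrow> ip m x z = 0))"

text \<open>Adding to a model of a generic facet point \<open>t'\<close> an integer vector of an adjacent closed sign
  cell that leaves the facet: a short relation of the sum holds for both summands, hence vanishes on
  the facet and off it.\<close>

lemma model_from_facet:
  assumes m: "3 \<le> m" and q: "1 \<le> q" and t: "sinc m t" and pq: "p \<le> q"
    and B: "(\<exists>v\<in>shorts m p. v \<noteq> (\<lambda>_. 0) \<and> ip m v t = 0) \<and> B = int p * int q ^ (m - 3) \<or> B = int q ^ (m - 2)"
    and g: "generic_on_facet m q t i t'" and D: "has_model m q t' D"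
  shows "has_model m q t (D + B)"
proof -
  have i: "Suc i < m" and t'fl: "t' \<in> flat m q t"
    and gen: "\<And>x z. x \<in> shorts m q \<Longrightarrow> ip m x t' = 0 \<Longrightarrow> z \<in> flat m q t \<Longrightarrow> z i = z (Suc i) \<Longrightarrow> ip m x z = 0"
    using g by (auto simp: generic_on_facet_def)
  obtain s' where s': "models m q t' s'" "s' (m - 1) - s' 0 \<le> D" using D by (auto simp: has_model_def)
  define S where "S = (\<lambda>j. real_of_int (s' j))"
  have ipS: "ip m x t' = 0 \<longleftrightarrow> ip m x S = 0" if "x \<in> shorts m q" for x
    using s'(1) that by (simp add: models_def S_def)
  obtain e :: real where e: "0 < e" "\<And>x. x \<in> shorts m q \<Longrightarrow> ip m x S \<noteq> 0 \<Longrightarrow> 0 < ip m x S * (ip m x S + e * ip m x t)"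
    using small_positive[of "shorts m q" "\<lambda>x. ip m x S" "\<lambda>x. ip m x t"] finite_shorts by auto
  \<comment> \<open>A small step from \<open>S\<close> along \<open>t\<close> gives a strictly
    increasing alphabet that keeps the relations of \<open>t\<close> and has \<open>S\<close> in its
    closed cell. The ray is taken in the cell of \<open>te\<close>, which need not be that of
    \<open>t\<close>.\<close>
  define te where "te = (\<lambda>j. S j + e * t j)"
  have ipte: "ip m x te = ip m x S + e * ip m x t" for x by (simp add: te_def ip_add ip_scale)
  have zS: "ip m x S = 0" if "x \<in> shorts m q" "ip m x t = 0" for x
    using that t'fl ipS by (auto simp: flat_def)
  have "sinc m te"
    unfolding sinc_def
  proof (intro allI impI)
    fix j assume j: "Suc j < m"
    have "S j \<le> S (Suc j)" using s'(1) j by (simp add: models_def winc_def S_def)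
    moreover have "e * t j < e * t (Suc j)" using t j e(1) by (simp add: sinc_def)
    ultimately show "te j < te (Suc j)" by (simp add: te_def)
  qed
  moreover have "(\<exists>v\<in>shorts m p. v \<noteq> (\<lambda>_. 0) \<and> ip m v te = 0) \<and> B = int p * int q ^ (m - 3) \<or> B = int q ^ (m - 2)"
  proof -
    have "ip m v te = 0" if "v \<in> shorts m p" "ip m v t = 0" for v
      using zS[of v] shorts_mono[OF pq] that by (auto simp: ipte)
    then show ?thesis using B by blast
  qed
  ultimately obtain r :: "nat \<Rightarrow> int" where r: "(\<lambda>j. real_of_int (r j)) \<in> flat m q te"
    "\<And>x. x \<in> shorts m q \<Longrightarrow> 0 \<le> ip m x te * ip m x (\<lambda>j. real_of_int (r j))"
    "r i < r (Suc i)" "r (m - 1) - r 0 \<le> B"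
    using integer_ray[OF m q _ i pq] by metis
  define R where "R = (\<lambda>j. real_of_int (r j))"
  have Rfl: "ip m x R = 0" if "x \<in> shorts m q" "ip m x t = 0" for x
    using r(1) that zS[OF that] by (auto simp: flat_def ipte R_def)
  have Rcell: "\<And>x. x \<in> shorts m q \<Longrightarrow> 0 \<le> ip m x te * ip m x R" using r(2) by (simp add: R_def)
  have Rw: "r j \<le> r (Suc j)" if j: "Suc j < m" for j
  proof -
    have "0 < te (Suc j) - te j" using \<open>sinc m te\<close> j by (simp add: sinc_def)
    moreover have "0 \<le> (te (Suc j) - te j) * (R (Suc j) - R j)"
      using Rcell[OF gap_shorts[OF j q]] by (simp add: ip_gap[OF j])
    ultimately show ?thesis by (simp add: zero_le_mult_iff R_def)
  qed
  have "models m q t (\<lambda>j. s' j + r j)"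
    unfolding models_def
  proof (intro conjI ballI)
    show "winc m (\<lambda>j. s' j + r j)" using s'(1) Rw by (auto simp: models_def winc_def intro: add_mono)
    fix x assume x: "x \<in> shorts m q"
    have sum: "ip m x (\<lambda>j. real_of_int (s' j + r j)) = ip m x S + ip m x R"
      by (simp add: S_def R_def ip_add)
    show "ip m x t = 0 \<longleftrightarrow> ip m x (\<lambda>j. real_of_int (s' j + r j)) = 0"
    proof
      assume "ip m x t = 0"
      then show "ip m x (\<lambda>j. real_of_int (s' j + r j)) = 0" using zS Rfl x sum by simp
    next
      assume "ip m x (\<lambda>j. real_of_int (s' j + r j)) = 0"
      then have RS: "ip m x R = - ip m x S" using sum by simp
      \<comment> \<open>\<open>S\<close> and \<open>R\<close> lie in the same closed cell, that of
        \<open>te\<close>, so their values at \<open>x\<close> cannot cancel.\<close>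
      have S0: "ip m x S = 0"
      proof (rule ccontr)
        assume ne: "ip m x S \<noteq> 0"
        have "0 < ip m x S * ip m x te" using e(2)[OF x ne] by (simp add: ipte)
        moreover have "ip m x te * ip m x S \<le> 0" using Rcell[OF x] by (simp add: RS)
        ultimately show False by (simp add: mult.commute)
      qed
      then have R0: "ip m x R = 0" and t'0: "ip m x t' = 0" using RS ipS[OF x] by auto
      \<comment> \<open>\<open>R - c * t\<close> has gap \<open>i\<close> closed, so genericity
        applies to it and \<open>ip m x R\<close> equals \<open>c * ip m x t\<close>.\<close>
      define c where "c = (R (Suc i) - R i) / (t (Suc i) - t i)"
      have ti: "0 < t (Suc i) - t i" using t i by (simp add: sinc_def)
      have c0: "0 < c" using ti r(3) by (simp add: c_def R_def)
      have "ip m x (\<lambda>j. R j + (- c) * t j) = 0"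
      proof (rule gen[OF x t'0])
        show "(\<lambda>j. R j + (- c) * t j) \<in> flat m q t"
          by (rule flat_closed) (use Rfl in \<open>auto simp: flat_def\<close>)
        have "c * (t (Suc i) - t i) = R (Suc i) - R i" using ti by (simp add: c_def)
        then show "R i + (- c) * t i = R (Suc i) + (- c) * t (Suc i)" by (simp add: algebra_simps)
      qed
      then have "ip m x R + (- c) * ip m x t = 0" unfolding ip_add ip_scale .
      then show "ip m x t = 0" using R0 c0 by simp
    qed
  qed
  moreover have "(s' (m - 1) + r (m - 1)) - (s' 0 + r 0) \<le> D + B" using s'(2) r(4) by simp
  ultimately show ?thesis unfolding has_model_def by blast
qed

text \<open>Subtracting from a generic \<open>z\<close> the multiple of \<open>t\<close> with the
  least slope \<open>rho i\<close> closes gap \<open>i\<close> and keeps the other gaps nonnegative.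
  The index \<open>i\<close> is known only afterwards, so \<open>z\<close> has to avoid the bad sets
  of all gaps at once: up to the factor \<open>t j - t (Suc j)\<close>, \<open>L x j z\<close> is
  the value of \<open>x\<close> at \<open>z - rho j * t\<close>.\<close>

lemma generic_facet_exists:
  assumes m: "2 \<le> m" and q: "1 \<le> q" and t: "sinc m t"
  obtains i t' where "generic_on_facet m q t i t'" "winc m t'"
proof -
  define L where "L x j z = ip m x t * (z (Suc j) - z j) - (t (Suc j) - t j) * ip m x z" for x j and z :: "nat \<Rightarrow> real"
  define F where "F = {L x j | x j. x \<in> shorts m q \<and> Suc j < m \<and> (\<exists>w\<in>flat m q t. L x j w \<noteq> 0)}"
  have "F \<subseteq> (\<lambda>(x,j). L x j) ` (shorts m q \<times> {..<m})" by (auto simp: F_def)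
  then have finF: "finite F" by (rule finite_subset) (use finite_shorts in auto)
  have "\<exists>z\<in>flat m q t. \<forall>f\<in>F. f z \<noteq> 0"
  proof (rule avoid_hyperplanes[OF finF])
    show "(\<lambda>_. 0) \<in> flat m q t" by (auto simp: flat_def ip_def)
    show "linfun f" if "f \<in> F" for f
      using that by (auto simp: F_def linfun_def L_def ip_add ip_scale algebra_simps)
    show "\<exists>w\<in>flat m q t. f w \<noteq> 0" if "f \<in> F" for f using that by (auto simp: F_def)
  qed (rule flat_closed)
  then obtain z where z: "z \<in> flat m q t" "\<And>f. f \<in> F \<Longrightarrow> f z \<noteq> 0" by blast
  define rho where "rho j = (z (Suc j) - z j) / (t (Suc j) - t j)" for j
  have tj: "0 < t (Suc j) - t j" if "Suc j < m" for j using t that by (simp add: sinc_def)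
  obtain i where i: "i \<in> {..<m - 1}" "\<And>j. j \<in> {..<m - 1} \<Longrightarrow> rho i \<le> rho j"
    using arg_min_if_finite(1)[of "{..<m - 1}" rho] arg_min_least[of "{..<m - 1}" _ rho] m
    by (metis One_nat_def Suc_le_lessD finite_lessThan lessThan_iff empty_iff numeral_2_eq_2 zero_less_diff)
  have im: "Suc i < m" using i(1) by auto
  define t' where "t' = (\<lambda>j. z j + (- rho i) * t j)"
  have gp: "t' (Suc j) - t' j = (rho j - rho i) * (t (Suc j) - t j)" if "Suc j < m" for j
  proof -
    have "z (Suc j) - z j = rho j * (t (Suc j) - t j)" using tj[OF that] by (simp add: rho_def)
    then show ?thesis by (simp add: t'_def algebra_simps)
  qed
  have "winc m t'"
    unfolding winc_def
  proof (intro allI impI)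
    fix j assume j: "Suc j < m"
    have "0 \<le> (rho j - rho i) * (t (Suc j) - t j)" using i(2)[of j] j tj[OF j] by auto
    then show "t' j \<le> t' (Suc j)" using gp[OF j] by simp
  qed
  moreover have "generic_on_facet m q t i t'"
    unfolding generic_on_facet_def
  proof (intro conjI ballI impI)
    show "Suc i < m" by fact
    show "t' \<in> flat m q t" unfolding t'_def by (rule flat_closed[OF z(1)]) (auto simp: flat_def)
    show "t' i = t' (Suc i)" using gp[OF im] by simp
    fix x w assume x: "x \<in> shorts m q" "ip m x t' = 0" and w: "w \<in> flat m q t" "w i = w (Suc i)"
    have "ip m x z = rho i * ip m x t" using x(2) unfolding t'_def ip_add ip_scale by simp
    moreover have "z (Suc i) - z i = rho i * (t (Suc i) - t i)" using tj[OF im] by (simp add: rho_def)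
    ultimately have "L x i z = 0" by (simp add: L_def)
    then have "L x i \<notin> F" using z(2) by blast
    then have "L x i w = 0" using x(1) im w(1) by (auto simp: F_def)
    then show "ip m x w = 0" using w(2) tj[OF im] by (simp add: L_def)
  qed
  ultimately show thesis using that by blast
qed

section \<open>Merging two adjacent letters\<close>

definition squash :: "nat \<Rightarrow> nat \<Rightarrow> nat" where "squash i j = (if j \<le> i then j else j - 1)"
definition unsquash :: "nat \<Rightarrow> nat \<Rightarrow> nat" where "unsquash i j = (if j \<le> i then j else Suc j)"
text \<open>The transpose of \<open>squash i\<close>: the coefficients of the two merged letters are
  added. \<open>unsquash i\<close> picks a representative of each class.\<close>

definition push :: "nat \<Rightarrow> (nat \<Rightarrow> int) \<Rightarrow> nat \<Rightarrow> int" where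
  "push i x j = (if j < i then x j else if j = i then x i + x (Suc i) else x (Suc j))"

lemma sum_push:
  fixes f :: "nat \<Rightarrow> 'a::comm_ring_1"
  assumes "Suc i < Suc m"
  shows "(\<Sum>j<m. of_int (push i x j) * f j) = (\<Sum>j<Suc m. of_int (x j) * f (squash i j))"
  using assms
proof (induction m)
  case (Suc m)
  show ?case
  proof (cases "i = m")
    case True
    have "(\<Sum>j<m. of_int (push i x j) * f j) = (\<Sum>j<m. of_int (x j) * f (squash i j))"
      by (rule sum.cong) (use True in \<open>auto simp: push_def squash_def\<close>)
    then show ?thesis using True by (simp add: push_def squash_def algebra_simps)
  next
    case False
    then show ?thesis using Suc by (simp add: push_def squash_def)
  qed
qed auto

text \<open>The positive part is subadditive, so merging letters never lengthens a relation.\<close>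

lemma sum_max_push_le:
  assumes "Suc i < Suc m"
  shows "(\<Sum>j<m. max 0 (push i x j)) \<le> (\<Sum>j<Suc m. max 0 (x j))"
  using assms
proof (induction m)
  case (Suc m)
  show ?case
  proof (cases "i = m")
    case True
    have "(\<Sum>j<m. max 0 (push i x j)) = (\<Sum>j<m. max 0 (x j))"
      by (rule sum.cong) (use True in \<open>auto simp: push_def\<close>)
    then show ?thesis using True by (auto simp: push_def)
  next
    case False
    then show ?thesis using Suc by (simp add: push_def)
  qed
qed auto

lemma push_shorts: "x \<in> shorts (Suc m) q \<Longrightarrow> Suc i < Suc m \<Longrightarrow> push i x \<in> shorts m q"
  using sum_push[of i m x "\<lambda>_. 1 :: int"] sum_max_push_le[of i m x]
  by (auto simp: shorts_def push_def)

lemma ip_push: "Suc i < Suc m \<Longrightarrow> ip m (push i x) u = ip (Suc m) x (\<lambda>j. u (squash i j))"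
  unfolding ip_def by (rule sum_push)

lemma squash_unsquash:
  fixes t' :: "nat \<Rightarrow> 'a"
  assumes "t' i = t' (Suc i)"
  shows "t' (unsquash i (squash i j)) = t' j"
proof -
  consider "j \<le> i" | "j = Suc i" | "j > Suc i" by linarith
  then show ?thesis by cases (use assms in \<open>auto simp: squash_def unsquash_def\<close>)
qed

lemma has_model_unsquash:
  assumes i: "Suc i < Suc m" and eq: "t' i = t' (Suc i)" and M: "has_model m q (\<lambda>j. t' (unsquash i j)) D"
  shows "has_model (Suc m) q t' D"
proof -
  let ?u = "\<lambda>j. t' (unsquash i j)"
  obtain s where s: "models m q ?u s" "s (m - 1) - s 0 \<le> D" using M by (auto simp: has_model_def)
  have "models (Suc m) q t' (\<lambda>j. s (squash i j))"
    unfolding models_def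
  proof (intro conjI ballI)
    show "winc (Suc m) (\<lambda>j. s (squash i j))"
      unfolding winc_def
    proof (intro allI impI)
      fix j assume j: "Suc j < Suc m"
      have w: "winc m s" using s(1) by (simp add: models_def)
      show "s (squash i j) \<le> s (squash i (Suc j))"
        by (rule winc_le[OF w]) (use i j in \<open>auto simp: squash_def\<close>)
    qed
    fix x assume x: "x \<in> shorts (Suc m) q"
    have "ip (Suc m) x t' = ip (Suc m) x (\<lambda>j. ?u (squash i j))"
      using squash_unsquash[of t', OF eq] by simp
    also have "\<dots> = ip m (push i x) ?u" by (rule ip_push[OF i, symmetric])
    finally show "ip (Suc m) x t' = 0 \<longleftrightarrow> ip (Suc m) x (\<lambda>j. real_of_int (s (squash i j))) = 0"
      using s(1) push_shorts[OF x i] ip_push[OF i, of x "\<lambda>j. real_of_int (s j)"] by (simp add: models_def)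
  qed
  moreover have "squash i (Suc m - 1) = m - 1" "squash i 0 = 0" using i by (auto simp: squash_def)
  ultimately show ?thesis using s(2) unfolding has_model_def by (intro exI[of _ "\<lambda>j. s (squash i j)"]) simp
qed

lemma winc_unsquash: "winc (Suc m) t' \<Longrightarrow> winc m (\<lambda>j. t' (unsquash i j))"
  unfolding winc_def
proof (intro allI impI)
  fix j assume w: "\<forall>i. Suc i < Suc m \<longrightarrow> t' i \<le> t' (Suc i)" and j: "Suc j < m"
  then have "t' j \<le> t' (Suc j)" "t' (Suc j) \<le> t' (Suc (Suc j))" by auto
  then show "t' (unsquash i j) \<le> t' (unsquash i (Suc j))" by (auto simp: unsquash_def)
qed

lemma shorts_restrict: "x \<in> shorts m q \<Longrightarrow> x \<in> shorts (Suc m) q"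
  by (auto simp: shorts_def)

lemma bnd_decrease:
  assumes "bnd (Suc m) q D" "1 \<le> m"
  shows "bnd m q D"
  unfolding bnd_def
proof (intro allI impI)
  fix t :: "nat \<Rightarrow> real" assume t: "sinc m t"
  define t1 where "t1 j = (if j < m then t j else t (m - 1) + 1)" for j
  have "sinc (Suc m) t1"
    unfolding sinc_def
  proof (intro allI impI)
    fix j assume "Suc j < Suc m"
    then show "t1 j < t1 (Suc j)"
      using t by (cases "Suc j < m") (auto simp: t1_def sinc_def simp: less_antisym dest: Suc_lessI)
  qed
  then obtain s where s: "models (Suc m) q t1 s" "s m - s 0 \<le> D"
    using assms(1) by (auto simp: bnd_def has_model_def)
  have e: "ip (Suc m) x y = ip m x y" if "x \<in> shorts m q" for x y
    using that by (auto simp: ip_def shorts_def)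
  have e1: "ip m x t1 = ip m x t" for x by (rule ip_cong) (simp add: t1_def)
  have w: "winc (Suc m) s" using s(1) by (simp add: models_def)
  have "models m q t s"
    unfolding models_def
  proof (intro conjI ballI)
    show "winc m s" using w by (simp add: winc_def)
    fix x assume x: "x \<in> shorts m q"
    show "ip m x t = 0 \<longleftrightarrow> ip m x (\<lambda>i. real_of_int (s i)) = 0"
    proof -
      have "ip (Suc m) x t1 = 0 \<longleftrightarrow> ip (Suc m) x (\<lambda>i. real_of_int (s i)) = 0"
        using s(1) shorts_restrict[OF x] by (simp add: models_def)
      then show ?thesis by (simp only: e[OF x] e1)
    qed
  qed
  moreover have "s (m - 1) \<le> s m" by (rule winc_le[OF w]) auto
  ultimately show "has_model m q t D" using s(2) unfolding has_model_def by (intro exI[of _ s]) simp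
qed

text \<open>Coinciding letters are merged pair by pair until the rest is strictly increasing;
  \<open>bnd_decrease\<close> carries the bound along.\<close>

lemma bnd_weak:
  assumes "bnd m q D" "1 \<le> m" "winc m t"
  shows "has_model m q t D"
  using assms
proof (induction m arbitrary: t)
  case (Suc m)
  show ?case
  proof (cases "sinc (Suc m) t")
    case True then show ?thesis using Suc.prems by (simp add: bnd_def)
  next
    case False
    then obtain i where i: "Suc i < Suc m" "t i = t (Suc i)"
      using Suc.prems(3) by (force simp: sinc_def winc_def)
    then have m: "1 \<le> m" by simp
    have "has_model m q (\<lambda>j. t (unsquash i j)) D"
      by (rule Suc.IH[OF bnd_decrease[OF Suc.prems(1) m] m winc_unsquash[OF Suc.prems(3)]])
    then show ?thesis by (rule has_model_unsquash[where t' = t, OF i])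
  qed
qed simp

theorem bnd_step:
  assumes m: "2 \<le> m" and q: "1 \<le> q" and b: "bnd m q D"
  shows "bnd (Suc m) q (D + int q ^ (m - 1))"
  unfolding bnd_def
proof (intro allI impI)
  fix t :: "nat \<Rightarrow> real" assume t: "sinc (Suc m) t"
  obtain i t' where g: "generic_on_facet (Suc m) q t i t'" "winc (Suc m) t'"
    using generic_facet_exists[of "Suc m" q t] m q t by auto
  have i: "Suc i < Suc m" "t' i = t' (Suc i)" using g(1) by (auto simp: generic_on_facet_def)
  have "has_model m q (\<lambda>j. t' (unsquash i j)) D"
    using bnd_weak[OF b _ winc_unsquash[OF g(2)]] m by simp
  then have *: "has_model (Suc m) q t' D" by (rule has_model_unsquash[where t' = t', OF i])
  show "has_model (Suc m) q t (D + int q ^ (m - 1))"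
    by (rule model_from_facet[OF _ q t order_refl _ g(1) *]) (use m in auto)
qed

subsection \<open>Alphabets as lists and the lower bound\<close>

lemma sum_list_count:
  fixes f :: "nat \<Rightarrow> 'a::comm_semiring_1"
  shows "set is \<subseteq> {..<m} \<Longrightarrow> (\<Sum>i\<leftarrow>is. f i) = (\<Sum>i<m. of_nat (count_list is i) * f i)"
proof (induction "is")
  case (Cons a as)
  have "(\<Sum>i<m. of_nat (count_list (a # as) i) * f i) =
      (\<Sum>i<m. (if i = a then f i else 0) + of_nat (count_list as i) * f i)"
    by (rule sum.cong) (auto simp: algebra_simps)
  then show ?case using Cons by (simp add: sum.distrib)
qed simp

lemma sum_list_replicate_map:
  fixes f :: "nat \<Rightarrow> 'a::comm_semiring_1"
  shows "(\<Sum>i\<leftarrow>concat (map (\<lambda>i. replicate (c i) i) [0..<m]). f i) = (\<Sum>i<m. of_nat (c i) * f i)"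
  by (induction m) (auto simp: sum_list_replicate map_replicate_const)

lemma order_preserving_model_iff:
  assumes len: "length T = m"
  shows "order_preserving_model q T S \<longleftrightarrow> ordered_alphabet m S \<and>
    (\<forall>x\<in>shorts m q. ip m x (\<lambda>i. T ! i) = 0 \<longleftrightarrow> ip m x (\<lambda>i. real_of_int (S ! i)) = 0)"
    (is "?L \<longleftrightarrow> ?O \<and> ?R")
proof
  assume L: ?L
  have O: ?O using L len by (simp add: order_preserving_model_def)
  have rel: "(\<Sum>i\<leftarrow>is. T ! i) = (\<Sum>j\<leftarrow>js. T ! j) \<longleftrightarrow> (\<Sum>i\<leftarrow>is. S ! i) = (\<Sum>j\<leftarrow>js. S ! j)"
    if "1 \<le> length is" "length is \<le> q" "length js = length is" "set is \<subseteq> {..<m}" "set js \<subseteq> {..<m}" for "is" js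
    using L that len unfolding order_preserving_model_def by blast
  have ?R
  proof
    fix x assume x: "x \<in> shorts m q"
    \<comment> \<open>\<open>mk c\<close> lists each index \<open>i\<close> exactly
      \<open>c i\<close> times; the positive and the negative part of \<open>x\<close> become two
      lists of equal length.\<close>
    define mk where "mk c = concat (map (\<lambda>i. replicate (c i) i) [0..<m])" for c :: "nat \<Rightarrow> nat"
    have setmk: "set (mk c) \<subseteq> {..<m}" for c by (auto simp: mk_def)
    let ?p = "\<lambda>i. nat (x i)" and ?n = "\<lambda>i. nat (- x i)"
    have lmk: "int (length (mk c)) = (\<Sum>i<m. int (c i))" for c
    proof -
      have "length (mk c) = (\<Sum>i\<leftarrow>mk c. 1)" by (simp add: sum_list_triv)
      also have "\<dots> = (\<Sum>i<m. c i)" unfolding mk_def by (subst sum_list_replicate_map) simp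
      finally show ?thesis by simp
    qed
    have d: "(\<Sum>i\<leftarrow>mk ?p. f i) - (\<Sum>i\<leftarrow>mk ?n. f i) = (\<Sum>i<m. of_int (x i) * f i)"
      for f :: "nat \<Rightarrow> 'a::comm_ring_1"
    proof -
      have "(\<Sum>i\<leftarrow>mk ?p. f i) - (\<Sum>i\<leftarrow>mk ?n. f i) = (\<Sum>i<m. of_nat (nat (x i)) * f i - of_nat (nat (- x i)) * f i)"
        unfolding mk_def sum_list_replicate_map by (simp add: sum_subtractf)
      also have "\<dots> = (\<Sum>i<m. of_int (x i) * f i)"
      proof (rule sum.cong[OF refl])
        fix i
        have "(of_int (x i) :: 'a) = of_nat (nat (x i)) - of_nat (nat (- x i))"
          by (cases "x i" rule: int_cases) (simp_all del: of_nat_Suc)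
        then show "of_nat (nat (x i)) * f i - of_nat (nat (- x i)) * f i = of_int (x i) * f i"
          by (simp only: left_diff_distrib)
      qed
      finally show ?thesis .
    qed
    have len1: "int (length (mk ?p)) = (\<Sum>i<m. max 0 (x i))"
      unfolding lmk by (rule sum.cong) auto
    have len2: "int (length (mk ?n)) = (\<Sum>i<m. max 0 (x i))"
    proof -
      have "int (length (mk ?n)) = (\<Sum>i<m. max 0 (x i) - x i)" unfolding lmk by (rule sum.cong) auto
      then show ?thesis using x by (simp add: sum_subtractf shorts_def)
    qed
    show "ip m x (\<lambda>i. T ! i) = 0 \<longleftrightarrow> ip m x (\<lambda>i. real_of_int (S ! i)) = 0"
    \<comment> \<open>Models are defined through lengths \<open>h \<ge> 1\<close>, so the zero
      vector is treated apart.\<close>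
    proof (cases "length (mk ?p) = 0")
      case True
      then have "mk ?p = []" "mk ?n = []" using len1 len2 by simp_all
      then have "ip m x f = 0" for f unfolding ip_def d[symmetric] by simp
      then show ?thesis by simp
    next
      case False
      have "(\<Sum>i\<leftarrow>mk ?p. T ! i) = (\<Sum>j\<leftarrow>mk ?n. T ! j) \<longleftrightarrow> (\<Sum>i\<leftarrow>mk ?p. S ! i) = (\<Sum>j\<leftarrow>mk ?n. S ! j)"
      proof (rule rel)
        show "length (mk ?p) \<le> q" using len1 x by (simp add: shorts_def)
        show "length (mk ?n) = length (mk ?p)" using len1 len2 by simp
      qed (use False setmk in \<open>auto simp: Suc_le_eq\<close>)
      moreover have "(\<Sum>i\<leftarrow>mk ?p. T ! i) = (\<Sum>j\<leftarrow>mk ?n. T ! j) \<longleftrightarrow> ip m x (\<lambda>i. T ! i) = 0"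
        unfolding ip_def d[symmetric] by simp
      moreover have "(\<Sum>i\<leftarrow>mk ?p. S ! i) = (\<Sum>j\<leftarrow>mk ?n. S ! j) \<longleftrightarrow> ip m x (\<lambda>i. real_of_int (S ! i)) = 0"
      proof -
        have "ip m x (\<lambda>i. real_of_int (S ! i)) = real_of_int (\<Sum>i<m. of_int (x i) * S ! i)"
          by (simp add: ip_def)
        then show ?thesis unfolding d[symmetric] by simp
      qed
      ultimately show ?thesis by simp
    qed
  qed
  with O show "?O \<and> ?R" by simp
next
  assume R: "?O \<and> ?R"
  show ?L
    unfolding order_preserving_model_def
  proof (intro conjI allI impI)
    show "ordered_alphabet (length T) S" using R len by simp
    fix h "is" js
    assume "1 \<le> h \<and> h \<le> q \<and> length is = h \<and> length js = h \<and> set is \<subseteq> {..<length T} \<and> set js \<subseteq> {..<length T}"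
    then have h: "h \<le> q" "length is = h" "length js = h" and s: "set is \<subseteq> {..<m}" "set js \<subseteq> {..<m}"
      using len by auto
    define x where "x i = int (count_list is i) - int (count_list js i)" for i
    have d: "(\<Sum>i\<leftarrow>is. f i) - (\<Sum>i\<leftarrow>js. f i) = (\<Sum>i<m. of_int (x i) * f i)" for f :: "nat \<Rightarrow> 'a::comm_ring_1"
      unfolding sum_list_count[OF s(1)] sum_list_count[OF s(2)]
      by (simp add: x_def sum_subtractf left_diff_distrib)
    have "x \<in> shorts m q"
      unfolding shorts_def
    proof (intro CollectI conjI allI impI)
      show "x i = 0" if "m \<le> i" for i
      proof -
        have "count_list is i = 0" using s(1) that unfolding count_list_0_iff by (meson lessThan_iff not_le subsetD)
        moreover have "count_list js i = 0" using s(2) that unfolding count_list_0_iff by (meson lessThan_iff not_le subsetD)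
        ultimately show ?thesis unfolding x_def by simp
      qed
      show "(\<Sum>i<m. x i) = 0"
        using d[of "\<lambda>_. 1 :: int"] h by (simp add: sum_list_triv)
      have "(\<Sum>i<m. max 0 (x i)) \<le> (\<Sum>i<m. int (count_list is i))"
        by (rule sum_mono) (auto simp: x_def)
      also have "\<dots> = int (length is)"
        using sum_list_count[OF s(1), of "\<lambda>_. 1 :: int"] by (simp add: sum_list_triv)
      finally show "(\<Sum>i<m. max 0 (x i)) \<le> int q" using h by simp
    qed
    then have "ip m x (\<lambda>i. T ! i) = 0 \<longleftrightarrow> ip m x (\<lambda>i. real_of_int (S ! i)) = 0" using R by blast
    moreover have "(\<Sum>i\<leftarrow>is. T ! i) = (\<Sum>j\<leftarrow>js. T ! j) \<longleftrightarrow> ip m x (\<lambda>i. T ! i) = 0"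
      unfolding ip_def d[symmetric] by simp
    moreover have "(\<Sum>i\<leftarrow>is. S ! i) = (\<Sum>j\<leftarrow>js. S ! j) \<longleftrightarrow> ip m x (\<lambda>i. real_of_int (S ! i)) = 0"
    proof -
      have "ip m x (\<lambda>i. real_of_int (S ! i)) = real_of_int (\<Sum>i<m. of_int (x i) * S ! i)"
        by (simp add: ip_def)
      then show ?thesis unfolding d[symmetric] by simp
    qed
    ultimately show "(\<Sum>i\<leftarrow>is. T ! i) = (\<Sum>j\<leftarrow>js. T ! j) \<longleftrightarrow> (\<Sum>i\<leftarrow>is. S ! i) = (\<Sum>j\<leftarrow>js. S ! j)"
      by (simp only:)
  qed
qed

lemma sinc_iff_sorted: "length T = m \<Longrightarrow> sinc m (\<lambda>i. T ! i) \<longleftrightarrow> sorted_wrt (<) T"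
  by (auto simp: sorted_wrt_iff_nth_less sinc_less) (auto simp: sinc_def)

lemma models_sinc:
  assumes "models m q t s" "sinc m t" "1 \<le> q"
  shows "sinc m s"
  unfolding sinc_def
proof (intro allI impI)
  fix i assume i: "Suc i < m"
  have "t i < t (Suc i)" using assms(2) i by (simp add: sinc_def)
  then have "ip m (gap i) t \<noteq> 0" using i by (simp add: ip_gap)
  then have "s (Suc i) \<noteq> s i"
    using assms(1) gap_shorts[OF i assms(3)] ip_gap[OF i, of "\<lambda>i. real_of_int (s i)"] by (auto simp: models_def)
  then show "s i < s (Suc i)" using assms(1) i by (auto simp: models_def winc_def order_le_less)
qed

lemma ip_nth_map: "ip m x (\<lambda>i. g (map f [0..<m] ! i)) = ip m x (\<lambda>i. g (f i))"
  by (rule ip_cong) simp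

lemma universal_bound_iff_bnd:
  assumes m: "1 \<le> m" and q: "1 \<le> q"
  shows "universal_bound m q D \<longleftrightarrow> bnd m q (int D)"
proof
  assume U: "universal_bound m q D"
  show "bnd m q (int D)"
    unfolding bnd_def
  proof (intro allI impI)
    fix t :: "nat \<Rightarrow> real" assume t: "sinc m t"
    let ?T = "map t [0..<m]"
    have "sorted_wrt (<) ?T" using sinc_less[OF t] by (auto simp: sorted_wrt_iff_nth_less)
    then have "ordered_alphabet m ?T" by (simp add: ordered_alphabet_def)
    then obtain S where S: "order_preserving_model q ?T S" "diameter S \<le> int D"
      using U unfolding universal_bound_def by blast
    have S': "length S = m" "sorted_wrt (<) S"
      "\<And>x. x \<in> shorts m q \<Longrightarrow> ip m x t = 0 \<longleftrightarrow> ip m x (\<lambda>i. real_of_int (S ! i)) = 0"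
      using S(1) order_preserving_model_iff[of ?T m q S] ip_nth_map[of m _ "\<lambda>x. x" t] by (auto simp: ordered_alphabet_def)
    have "models m q t (\<lambda>i. S ! i)"
      unfolding models_def using S'(3) sinc_iff_sorted[OF S'(1)] S'(2) sinc_imp_winc by blast
    moreover have "S ! (m - 1) - S ! 0 = diameter S"
      using S'(1) m by (cases S) (auto simp: diameter_def last_conv_nth)
    ultimately show "has_model m q t (int D)" using S(2) by (auto simp: has_model_def)
  qed
next
  assume b: "bnd m q (int D)"
  show "universal_bound m q D"
    unfolding universal_bound_def
  proof (intro allI impI)
    fix T :: "real list" assume T: "ordered_alphabet m T"
    then have lenT: "length T = m" and t: "sinc m (\<lambda>i. T ! i)"
      using sinc_iff_sorted[of T m] by (auto simp: ordered_alphabet_def)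
    obtain s where s: "models m q (\<lambda>i. T ! i) s" "s (m - 1) - s 0 \<le> int D"
      using b t unfolding bnd_def has_model_def by blast
    let ?S = "map s [0..<m]"
    have "sorted_wrt (<) ?S"
      using sinc_less[OF models_sinc[OF s(1) t q]] by (auto simp: sorted_wrt_iff_nth_less)
    then have "order_preserving_model q T ?S"
      unfolding order_preserving_model_iff[OF lenT]
      using s(1) ip_nth_map[of m _ real_of_int s] by (auto simp: models_def ordered_alphabet_def)
    moreover have "diameter ?S \<le> int D"
      using s(2) m by (simp add: diameter_def last_map hd_map)
    ultimately show "\<exists>S. order_preserving_model q T S \<and> diameter S \<le> int D" by blast
  qed
qed

section \<open>The lower bound\<close>

lemma sum_three:
  fixes f :: "nat \<Rightarrow> 'a::comm_monoid_add"
  assumes "a < m" "b < m" "c < m" "a \<noteq> b" "a \<noteq> c" "b \<noteq> c" "\<And>i. i < m \<Longrightarrow> i \<notin> {a,b,c} \<Longrightarrow> f i = 0"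
  shows "(\<Sum>i<m. f i) = f a + f b + f c"
proof -
  have "(\<Sum>i<m. f i) = (\<Sum>i\<in>{a,b,c}. f i)" by (rule sum.mono_neutral_right) (use assms in auto)
  then show ?thesis using assms by (simp add: add.assoc)
qed

definition three :: "nat \<Rightarrow> int \<Rightarrow> nat \<Rightarrow> int \<Rightarrow> nat \<Rightarrow> int \<Rightarrow> nat \<Rightarrow> int" where
  "three a u b v c w i = (if i = a then u else if i = b then v else if i = c then w else 0)"

lemma three_shorts:
  assumes "a < m" "b < m" "c < m" "a \<noteq> b" "a \<noteq> c" "b \<noteq> c" "u + v + w = 0"
    "max 0 u + max 0 v + max 0 w \<le> int q"
  shows "three a u b v c w \<in> shorts m q"
proof -
  have "(\<Sum>i<m. three a u b v c w i) = three a u b v c w a + three a u b v c w b + three a u b v c w c"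
    by (rule sum_three) (use assms in \<open>auto simp: three_def\<close>)
  moreover have "(\<Sum>i<m. max 0 (three a u b v c w i)) = max 0 (three a u b v c w a)
      + max 0 (three a u b v c w b) + max 0 (three a u b v c w c)"
    by (rule sum_three) (use assms in \<open>auto simp: three_def\<close>)
  ultimately show ?thesis using assms by (auto simp: shorts_def three_def)
qed

lemma ip_three:
  assumes "a < m" "b < m" "c < m" "a \<noteq> b" "a \<noteq> c" "b \<noteq> c"
  shows "ip m (three a u b v c w) y = u * y a + v * y b + w * y c"
proof -
  have "ip m (three a u b v c w) y = of_int (three a u b v c w a) * y a
    + of_int (three a u b v c w b) * y b + of_int (three a u b v c w c) * y c"
    unfolding ip_def by (rule sum_three) (use assms in \<open>auto simp: three_def\<close>)
  then show ?thesis using assms by (simp add: three_def)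
qed

lemma bnd_lower:
  assumes m: "3 \<le> m" and q: "2 \<le> q" and b: "bnd m q D"
  shows "(int q + 1) * int q ^ (m - 3) \<le> D"
proof -
  define t :: "nat \<Rightarrow> real" where
    "t j = (if j = 0 then 0 else if j = 1 then 1 else (real q + 1) * real q ^ (j - 2))" for j
  have "sinc m t"
    unfolding sinc_def
  proof (intro allI impI)
    fix i
    consider "i = 0" | "i = 1" | k where "i = Suc (Suc k)" by (metis One_nat_def not0_implies_Suc)
    then show "t i < t (Suc i)"
    proof cases
      case 3
      have "(real q + 1) * real q ^ k * 1 < (real q + 1) * real q ^ k * real q"
        using q by (intro mult_strict_left_mono) auto
      then show ?thesis using 3 by (simp add: t_def mult_ac)
    qed (use q in \<open>auto simp: t_def\<close>)
  qed
  then obtain s where s: "models m q t s" "s (m - 1) - s 0 \<le> D" using b by (auto simp: bnd_def has_model_def)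
  have inc: "sinc m s" using models_sinc[OF s(1) \<open>sinc m t\<close>] q by simp
  have rel: "ip m x t = 0 \<longleftrightarrow> ip m x (\<lambda>i. real_of_int (s i)) = 0" if "x \<in> shorts m q" for x
    using s(1) that by (simp add: models_def)
  have base: "int q + 1 \<le> s 2 - s 0"
  proof (rule ccontr)
    assume "\<not> ?thesis"
    then have le: "s 2 - s 0 \<le> int q" by simp
    have pos: "s 0 < s 1" "s 1 < s 2" using inc m by (auto simp: sinc_def numeral_2_eq_2)
    \<comment> \<open>This is the relation that any three integers satisfy; its length is
      \<open>s 2 - s 0\<close>, hence at most \<open>q\<close>. Transferred to
      \<open>0, 1, q + 1\<close> it makes \<open>s 2 - s 0\<close> a positive multiple of
      \<open>q + 1\<close>.\<close>
    let ?x = "three 0 (s 1 - s 2) 1 (s 2 - s 0) 2 (s 0 - s 1)"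
    have x: "?x \<in> shorts m q" by (rule three_shorts) (use m pos le in auto)
    have e: "ip m ?x y = real_of_int (s 1 - s 2) * y 0 + real_of_int (s 2 - s 0) * y 1 + real_of_int (s 0 - s 1) * y 2" for y
      by (rule ip_three) (use m in auto)
    have "ip m ?x (\<lambda>i. real_of_int (s i)) = 0" unfolding e by (simp add: algebra_simps)
    then have "ip m ?x t = 0" using rel[OF x] by simp
    then have "real_of_int (s 2 - s 0) = real_of_int ((s 1 - s 0) * (int q + 1))"
      unfolding e by (simp add: t_def algebra_simps)
    then have eq: "s 2 - s 0 = (s 1 - s 0) * (int q + 1)" by (simp only: of_int_eq_iff)
    have "1 * (int q + 1) \<le> s 2 - s 0" unfolding eq using pos by (intro mult_right_mono) auto
    then show False using le by simp
  qed
  have chain: "(int q + 1) * int q ^ k \<le> s (k + 2) - s 0" if "k + 2 < m" for k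
    using that
  proof (induction k)
    case 0 then show ?case using base by (simp add: numeral_2_eq_2)
  next
    case (Suc k)
    \<comment> \<open>The relation \<open>q * t (k + 2) = (q - 1) * t 0 + t (k + 3)\<close>, of
      length \<open>q\<close>, multiplies the distance from the first letter by
      \<open>q\<close>.\<close>
    let ?x = "three 0 (1 - int q) (k + 2) (int q) (k + 3) (-1)"
    have x: "?x \<in> shorts m q" by (rule three_shorts) (use Suc.prems q in auto)
    have e: "ip m ?x y = real_of_int (1 - int q) * y 0 + real_of_int (int q) * y (k + 2) + real_of_int (-1) * y (k + 3)" for y
      by (rule ip_three) (use Suc.prems in auto)
    have "ip m ?x t = 0" unfolding e by (simp add: t_def numeral_3_eq_3)
    then have "ip m ?x (\<lambda>i. real_of_int (s i)) = 0" using rel[OF x] by simp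
    then have "real_of_int (s (k + 3) - s 0) = real_of_int (int q * (s (k + 2) - s 0))"
      unfolding e by (simp add: algebra_simps)
    then have eq: "s (k + 3) - s 0 = int q * (s (k + 2) - s 0)" by (simp only: of_int_eq_iff)
    have "int q * ((int q + 1) * int q ^ k) \<le> int q * (s (k + 2) - s 0)"
      by (rule mult_left_mono[OF Suc.IH]) (use Suc.prems in auto)
    then show ?case using eq by (simp add: algebra_simps numeral_3_eq_3)
  qed
  have "m - 3 + 2 = m - 1" using m by simp
  then show ?thesis using chain[of "m - 3"] m s(2) by simp
qed

lemma bnd_2: "bnd 2 q 1"
  unfolding bnd_def has_model_def
proof (intro allI impI exI conjI)
  fix t :: "nat \<Rightarrow> real" assume t: "sinc 2 t"
  show "models 2 q t int"
    unfolding models_def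
  proof (intro conjI ballI)
    fix x assume "x \<in> shorts 2 q"
    then have "x 0 = - x 1" by (simp add: shorts_def numeral_2_eq_2)
    then have "ip 2 x y = real_of_int (x 1) * (y 1 - y 0)" for y
      by (simp add: ip_def numeral_2_eq_2 algebra_simps)
    moreover have "t 0 < t 1" using t by (simp add: sinc_def numeral_2_eq_2)
    ultimately show "ip 2 x t = 0 \<longleftrightarrow> ip 2 x (\<lambda>i. real_of_int (int i)) = 0" by simp
  qed (simp add: winc_def)
qed simp

lemma bnd_2_lower: "bnd 2 q D \<Longrightarrow> 1 \<le> q \<Longrightarrow> 1 \<le> D"
proof -
  assume b: "bnd 2 q D" and q: "1 \<le> q"
  have t: "sinc 2 real" by (simp add: sinc_def)
  then obtain s where s: "models 2 q real s" "s 1 - s 0 \<le> D" using b by (auto simp: bnd_def has_model_def)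
  show "1 \<le> D" using models_sinc[OF s(1) t q] s(2) by (simp add: sinc_def)
qed

section \<open>Existence, recursion and growth of \<open>H\<close>\<close>

lemma bnd_exists: "2 \<le> m \<Longrightarrow> 1 \<le> q \<Longrightarrow> \<exists>D. bnd m q (int D)"
proof (induction m rule: nat_induct_at_least)
  case base
  have "bnd 2 q (int 1)" using bnd_2 by simp
  then show ?case by blast
next
  case (Suc m)
  then obtain D where "bnd m q (int D)" by blast
  then have "bnd (Suc m) q (int (D + q ^ (m - 1)))" using bnd_step[of m q "int D"] Suc by simp
  then show ?case by blast
qed

lemma bnd_H: "2 \<le> m \<Longrightarrow> 1 \<le> q \<Longrightarrow> bnd m q (int (H m q))"
proof -
  assume m: "2 \<le> m" and q: "1 \<le> q"
  have "\<exists>D. universal_bound m q D" using bnd_exists[OF m q] universal_bound_iff_bnd[of m q] m q by auto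
  then have "universal_bound m q (H m q)" unfolding H_def by (rule LeastI_ex)
  then show ?thesis using universal_bound_iff_bnd[of m q] m q by auto
qed

lemma H_le: "bnd m q (int D) \<Longrightarrow> 2 \<le> m \<Longrightarrow> 1 \<le> q \<Longrightarrow> H m q \<le> D"
  unfolding H_def by (rule Least_le) (simp add: universal_bound_iff_bnd)

lemma H_ge:
  assumes m: "3 \<le> m" and q: "2 \<le> q"
  shows "q ^ (m - 2) + q ^ (m - 3) \<le> H m q"
proof -
  have "(int q + 1) * int q ^ (m - 3) \<le> int (H m q)"
    using bnd_lower[OF m q] bnd_H[of m q] m q by simp
  moreover have "m - 2 = Suc (m - 3)" using m by simp
  then have "(int q + 1) * int q ^ (m - 3) = int (q ^ (m - 2) + q ^ (m - 3))" by (simp add: algebra_simps)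
  ultimately show ?thesis by linarith
qed

lemma H_rec:
  assumes m: "3 \<le> m" and q: "1 \<le> q"
  shows "H m q \<le> q ^ (m - 2) + H (m - 1) q"
proof -
  have "bnd (Suc (m - 1)) q (int (H (m - 1) q) + int q ^ (m - 1 - 1))"
    by (rule bnd_step) (use m q bnd_H in auto)
  moreover have "Suc (m - 1) = m" "m - 1 - 1 = m - 2" using m by auto
  ultimately have "bnd m q (int (q ^ (m - 2) + H (m - 1) q))" by (simp add: add.commute)
  then show ?thesis using H_le m q by simp
qed

lemma H_2: "1 \<le> q \<Longrightarrow> H 2 q = 1"
proof -
  assume q: "1 \<le> q"
  have "H 2 q \<le> 1" by (rule H_le) (use bnd_2 q in auto)
  moreover have "1 \<le> int (H 2 q)" using bnd_2_lower[OF bnd_H[of 2 q] q] q by simp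
  ultimately show ?thesis by simp
qed

lemma H_le_mult_power: "2 \<le> m \<Longrightarrow> 1 \<le> q \<Longrightarrow> H m q \<le> m * q ^ (m - 2)"
proof (induction m rule: nat_induct_at_least)
  case base then show ?case by (simp add: H_2)
next
  case (Suc m)
  have "H (Suc m) q \<le> q ^ (m - 1) + H m q" using H_rec[of "Suc m" q] Suc by (simp add: numeral_2_eq_2)
  also have "H m q \<le> m * q ^ (m - 2)" using Suc by simp
  also have "q ^ (m - 2) \<le> q ^ (m - 1)" by (rule power_increasing) (use Suc in auto)
  finally show ?case by (simp add: numeral_2_eq_2)
qed

text \<open>Two steps of the recursion produce both leading terms, and the remaining
  \<open>H (m - 2) q\<close> is of order \<open>q ^ (m - 4)\<close>. The other direction is the
  lower bound.\<close>

lemma H_asymptotic: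
  assumes m: "4 \<le> m"
  shows "(\<lambda>q. real (H m q) - (real q ^ (m - 2) + real q ^ (m - 3))) \<in> O(\<lambda>q. real q ^ (m - 4))"
proof (rule bigoI[where c = "real (m - 2)"], rule eventually_sequentiallyI)
  fix q :: nat assume q: "2 \<le> q"
  have "H m q \<le> q ^ (m - 2) + H (m - 1) q" by (rule H_rec) (use m q in auto)
  also have "H (m - 1) q \<le> q ^ (m - 3) + H (m - 2) q"
    using H_rec[of "m - 1" q] m q by (simp add: numeral_3_eq_3 numeral_2_eq_2)
  also have "H (m - 2) q \<le> (m - 2) * q ^ (m - 4)" using H_le_mult_power[of "m - 2" q] m q by simp
  finally have "real (H m q) \<le> real (q ^ (m - 2) + (q ^ (m - 3) + (m - 2) * q ^ (m - 4)))" by (rule of_nat_mono) simp_all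
  moreover have "real (q ^ (m - 2) + q ^ (m - 3)) \<le> real (H m q)" by (rule of_nat_mono, rule H_ge) (use m q in auto)
  ultimately show "norm (real (H m q) - (real q ^ (m - 2) + real q ^ (m - 3))) \<le> real (m - 2) * norm (real q ^ (m - 4))"
    by simp
qed

subsection \<open>Short relations of explicit integer tuples\<close>

lemma quotient_between:
  fixes k m :: int
  assumes "x = m * k" "- (n * m) < x" "x < n' * m" "0 < m"
  shows "- n < k" "k < n'"
proof -
  have x: "x = k * m" using assms(1) by (rule trans[OF _ mult.commute])
  have "- n * m < k * m" using assms(2) unfolding x by (simp only: mult_minus_left)
  then show "- n < k" using mult_less_cancel_right_pos[OF assms(4)] by blast
  show "k < n'" using assms(3) mult_less_cancel_right_pos[OF assms(4)] unfolding x by blast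
qed

lemma quotient_abs_less:
  fixes k m :: int
  assumes "x = m * k" "\<bar>x\<bar> < n * m" "0 < m"
  shows "\<bar>k\<bar> < n"
proof -
  have "- (n * m) < x" "x < n * m" using assms(2) by linarith+
  from quotient_between[OF assms(1) this assms(3)] show ?thesis by linarith
qed

text \<open>Bounds for the positive parts turn the length condition into linear
  inequalities.\<close>

lemma max_sum_witness4:
  fixes x0 x1 x2 x3 :: int
  assumes "max 0 x0 + max 0 x1 + max 0 x2 + max 0 x3 \<le> q"
  obtains p0 p1 p2 p3 where "0 \<le> p0" "x0 \<le> p0" "0 \<le> p1" "x1 \<le> p1" "0 \<le> p2" "x2 \<le> p2"
    "0 \<le> p3" "x3 \<le> p3" "p0 + p1 + p2 + p3 \<le> q"
  by (rule that[OF _ _ _ _ _ _ _ _ assms]) auto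

lemma max_sum_witness5:
  fixes x0 x1 x2 x3 x4 :: int
  assumes "max 0 x0 + max 0 x1 + max 0 x2 + max 0 x3 + max 0 x4 \<le> q"
  obtains p0 p1 p2 p3 p4 where "0 \<le> p0" "x0 \<le> p0" "0 \<le> p1" "x1 \<le> p1" "0 \<le> p2" "x2 \<le> p2"
    "0 \<le> p3" "x3 \<le> p3" "0 \<le> p4" "x4 \<le> p4" "p0 + p1 + p2 + p3 + p4 \<le> q"
  by (rule that[OF _ _ _ _ _ _ _ _ _ _ assms]) auto

text \<open>Modulo \<open>q\<close> one gets \<open>x1 = q * y\<close>, with \<open>y\<close> 0 or 1
  by the sign assumption. If \<open>y = 0\<close>, then \<open>q + 1\<close> divides
  \<open>x2\<close>, which is too small; if \<open>y = 1\<close>, then \<open>x1\<close> exhausts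
  the positive length, whereas the equation asks for \<open>x2 = 1\<close>. So
  \<open>0, 1, q^2, q^2 + q\<close> can model every four letters without short relations.\<close>

lemma generic_letters_4_aux:
  fixes q x0 x1 x2 x3 :: int
  assumes q: "2 \<le> q" and x: "x0 + x1 + x2 + x3 = 0" "max 0 x0 + max 0 x1 + max 0 x2 + max 0 x3 \<le> q"
    and e: "x1 + q\<^sup>2 * x2 + (q\<^sup>2 + q) * x3 = 0" and s: "0 \<le> x1"
  shows "x0 = 0 \<and> x1 = 0 \<and> x2 = 0 \<and> x3 = 0"
proof -
  from x(2) obtain p0 p1 p2 p3 where "0 \<le> p0" "x0 \<le> p0" "0 \<le> p1" "x1 \<le> p1" "0 \<le> p2" "x2 \<le> p2"
    "0 \<le> p3" "x3 \<le> p3" "p0 + p1 + p2 + p3 \<le> q" by (rule max_sum_witness4)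
  note x = x(1) this
  have "x1 = q * (- q * x2 - (q + 1) * x3)" using e by (simp add: algebra_simps power2_eq_square)
  then obtain y where y: "x1 = q * y" by blast
  have "x1 \<le> q" "0 \<le> x1" using x s by linarith+
  then have "q * y \<le> q * 1" "0 \<le> q * y" using y by simp_all
  then have y01: "y = 0 \<or> y = 1" using q by (auto simp: zero_le_mult_iff)
  have "q * (y + q * x2 + (q + 1) * x3) = 0" using e y by (simp add: algebra_simps power2_eq_square)
  then have e': "y + q * x2 + (q + 1) * x3 = 0" using q by simp
  then have "x3 + y = q * (- x2 - x3)" by (simp add: algebra_simps)
  then obtain k where k: "x3 = q * k - y" "- x2 - x3 = k" by (metis add_diff_cancel_right')
  from y01 show ?thesis
  proof
    assume y0: "y = 0"
    have x2: "x2 = (q + 1) * (- k)" using k y0 by (simp add: algebra_simps)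
    have "\<bar>x2\<bar> < q + 1" using x by linarith
    then have "\<bar>- k\<bar> < 1" using quotient_abs_less[OF x2, of 1] q by simp
    then have "k = 0" by simp
    then show ?thesis using k y0 y x(1) by simp
  next
    assume y1: "y = 1"
    then have "x1 = q" using y by simp
    then have b: "x3 \<le> 0" "- q \<le> x3" "x2 \<le> 0" using x q by linarith+
    then have "q * k \<le> 1" "1 - q \<le> q * k" using k(1) y1 by linarith+
    then have l: "- (1 * q) < q * k" "q * k < 1 * q" using q by linarith+
    have "k = 0" using quotient_between[OF refl l] q by linarith
    then have "x3 = -1" "x2 = 1" using k y1 by simp_all
    then show ?thesis using b by simp
  qed
qed

lemma generic_letters_4:
  fixes q x0 x1 x2 x3 :: int
  assumes q: "2 \<le> q" and x: "x0 + x1 + x2 + x3 = 0" "max 0 x0 + max 0 x1 + max 0 x2 + max 0 x3 \<le> q"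
    and e: "x1 + q\<^sup>2 * x2 + (q\<^sup>2 + q) * x3 = 0"
  shows "x0 = 0 \<and> x1 = 0 \<and> x2 = 0 \<and> x3 = 0"
proof (cases "0 \<le> x1")
  case True then show ?thesis using generic_letters_4_aux[OF q x e] by simp
next
  case False
  have "max 0 (- x0) + max 0 (- x1) + max 0 (- x2) + max 0 (- x3) \<le> q" using x by linarith
  moreover have "- x1 + q\<^sup>2 * (- x2) + (q\<^sup>2 + q) * (- x3) = 0" using e by (simp add: algebra_simps)
  ultimately show ?thesis using generic_letters_4_aux[OF q, of "- x0" "- x1" "- x2" "- x3"] x False by simp
qed

text \<open>Division by \<open>q\<close> is used twice: it makes \<open>x1\<close> a multiple of
  \<open>q\<close> and, if \<open>x1 = 0\<close>, also \<open>x3\<close>. A coefficient equal to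
  \<open>q\<close> exhausts the positive length, and the others are then too restricted to satisfy
  the equation. The assumption \<open>s\<close> holds for \<open>x\<close> or for
  \<open>- x\<close>.\<close>

lemma generic_letters_5_aux:
  fixes q x0 x1 x2 x3 x4 :: int
  assumes q: "2 \<le> q" and x: "x0 + x1 + x2 + x3 + x4 = 0" "max 0 x0 + max 0 x1 + max 0 x2 + max 0 x3 + max 0 x4 \<le> q"
    and e: "x1 + q\<^sup>2 * x2 + (q ^ 3 + q\<^sup>2 - q) * x3 + (q ^ 3 + q\<^sup>2) * x4 = 0"
    and s: "0 < x1 \<or> x1 = 0 \<and> 0 \<le> x3"
  shows "x0 = 0 \<and> x1 = 0 \<and> x2 = 0 \<and> x3 = 0 \<and> x4 = 0"
proof -
  from x(2) obtain p0 p1 p2 p3 p4 where "0 \<le> p0" "x0 \<le> p0" "0 \<le> p1" "x1 \<le> p1" "0 \<le> p2" "x2 \<le> p2"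
    "0 \<le> p3" "x3 \<le> p3" "0 \<le> p4" "x4 \<le> p4" "p0 + p1 + p2 + p3 + p4 \<le> q" by (rule max_sum_witness5)
  note x = x(1) this
  have "x1 = q * (- q * x2 - (q\<^sup>2 + q - 1) * x3 - (q\<^sup>2 + q) * x4)"
    using e by (simp add: algebra_simps power2_eq_square power3_eq_cube)
  then obtain y where y: "x1 = q * y" by blast
  have "x1 \<le> q" "0 \<le> x1" using x s by linarith+
  then have "q * y \<le> q * 1" "0 \<le> q * y" using y by simp_all
  then have y01: "y = 0 \<or> y = 1" using q by (auto simp: zero_le_mult_iff)
  have "q * (y + q * x2 + (q\<^sup>2 + q - 1) * x3 + (q\<^sup>2 + q) * x4) = 0"
    using e y by (simp add: algebra_simps power2_eq_square power3_eq_cube)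
  then have e': "y + q * x2 + (q\<^sup>2 + q - 1) * x3 + (q\<^sup>2 + q) * x4 = 0" using q by simp
  from y01 show ?thesis
  proof
    assume y0: "y = 0"
    then have x10: "x1 = 0" and x3: "0 \<le> x3" using y s by auto
    have "x3 = q * (x2 + (q + 1) * x3 + (q + 1) * x4)" using e' y0 by (simp add: algebra_simps power2_eq_square)
    then obtain k where k: "x3 = q * k" by blast
    have "x3 \<le> q" using x by linarith
    then have "q * k \<le> q * 1" "0 \<le> q * k" using x3 k by simp_all
    then have k01: "k = 0 \<or> k = 1" using q by (auto simp: zero_le_mult_iff)
    have "q * (x2 + (q\<^sup>2 + q - 1) * k + (q + 1) * x4) = 0" using e' y0 k by (simp add: algebra_simps power2_eq_square)
    then have e2: "x2 + (q\<^sup>2 + q - 1) * k + (q + 1) * x4 = 0" using q by simp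
    from k01 show ?thesis
    proof
      assume k0: "k = 0"
      have x2: "x2 = (q + 1) * (- x4)" using e2 k0 by (simp add: algebra_simps)
      have "\<bar>x2\<bar> < q + 1" using x by linarith
      then have "\<bar>- x4\<bar> < 1" using quotient_abs_less[OF x2, of 1] q by simp
      then have "x4 = 0" by simp
      then show ?thesis using e2 k0 k x10 x(1) by simp
    next
      assume k1: "k = 1"
      have "x3 = q" using k k1 by simp
      then have b: "x2 \<le> 0" "- q \<le> x2" using x by linarith+
      have "x2 - 1 = (q + 1) * (- q - x4)" using e2 k1 by (simp add: algebra_simps power2_eq_square)
      then obtain l where l: "x2 - 1 = (q + 1) * l" "l = - q - x4" by blast
      have l': "- (2 * (q + 1)) < x2 - 1" "x2 - 1 < 0 * (q + 1)" using b q by (simp_all add: distrib_left)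
      have "l = -1" using quotient_between[OF l(1) l'] q by linarith
      then have "x2 = - q" "x4 = 1 - q" using l by simp_all
      then show ?thesis using x \<open>x3 = q\<close> q by linarith
    qed
  next
    assume y1: "y = 1"
    then have "x1 = q" using y by simp
    then have b: "x2 \<le> 0" "x3 \<le> 0" "x4 \<le> 0" "- q \<le> x3" "- q \<le> x2 + x3 + x4" using x q by linarith+
    have "x3 - 1 = q * (x2 + (q + 1) * x3 + (q + 1) * x4)" using e' y1 by (simp add: algebra_simps power2_eq_square)
    then obtain k where k: "x3 - 1 = q * k" "k = x2 + (q + 1) * x3 + (q + 1) * x4" by blast
    have k': "- (2 * q) < x3 - 1" "x3 - 1 < 0 * q" using b q by simp_all
    have "k = -1" using quotient_between[OF k(1) k'] q by linarith
    then have x3: "x3 = 1 - q" and f: "x2 + (q + 1) * (x3 + x4) = -1" using k by (simp_all add: algebra_simps)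
    \<comment> \<open>As \<open>x3 = 1 - q\<close>, one unit of negative length is left for
      \<open>x2\<close> and \<open>x4\<close>.\<close>
    have x24: "-1 \<le> x2 + x4" using b x3 by simp
    have "(q + 1) * (x3 + x4) \<le> (q + 1) * (1 - q)" by (rule mult_left_mono) (use b x3 q in auto)
    have "x4 = 0 \<or> x4 = -1" "x2 = 0 \<or> x2 = -1" using x24 b by auto
    then have False
    proof (elim disjE)
      assume "x4 = 0" "x2 = 0"
      then have "q * q = 2" using f x3 by (simp add: algebra_simps)
      then show False using q mult_mono[of 2 q 2 q] by simp
    next
      assume "x4 = 0" "x2 = -1"
      then have "q * q = 1" using f x3 by (simp add: algebra_simps)
      then show False using q mult_mono[of 2 q 2 q] by simp
    next
      assume "x4 = -1" "x2 = 0"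
      then have "q * (q + 1) = 1" using f x3 by (simp add: algebra_simps)
      then show False using q mult_mono[of 2 q 2 "q+1"] by simp
    next
      assume "x4 = -1" "x2 = -1"
      then show False using x24 by simp
    qed
    then show ?thesis ..
  qed
qed

lemma generic_letters_5:
  fixes q x0 x1 x2 x3 x4 :: int
  assumes q: "2 \<le> q" and x: "x0 + x1 + x2 + x3 + x4 = 0" "max 0 x0 + max 0 x1 + max 0 x2 + max 0 x3 + max 0 x4 \<le> q"
    and e: "x1 + q\<^sup>2 * x2 + (q ^ 3 + q\<^sup>2 - q) * x3 + (q ^ 3 + q\<^sup>2) * x4 = 0"
  shows "x0 = 0 \<and> x1 = 0 \<and> x2 = 0 \<and> x3 = 0 \<and> x4 = 0"
proof (cases "0 < x1 \<or> x1 = 0 \<and> 0 \<le> x3")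
  case True then show ?thesis using generic_letters_5_aux[OF q x e] by simp
next
  case False
  have "max 0 (- x0) + max 0 (- x1) + max 0 (- x2) + max 0 (- x3) + max 0 (- x4) \<le> q" using x by linarith
  moreover have "- x1 + q\<^sup>2 * (- x2) + (q ^ 3 + q\<^sup>2 - q) * (- x3) + (q ^ 3 + q\<^sup>2) * (- x4) = 0"
    using e by (simp add: algebra_simps)
  moreover have "0 < - x1 \<or> - x1 = 0 \<and> 0 \<le> - x3" using False by auto
  ultimately show ?thesis using generic_letters_5_aux[OF q, of "- x0" "- x1" "- x2" "- x3" "- x4"] x by simp
qed

text \<open>The size of the left side leaves only \<open>z\<close> in \<open>-1, 0, 1\<close>, and
  the modulus is \<open>q * (q + 1) - 1\<close>, so a division by \<open>q + 1\<close> settles each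
  case. In the tuples below, \<open>\<alpha>\<close> and \<open>\<beta>\<close> are the coefficients
  of the two letters that are not congruent to the other three modulo \<open>w\<close>.\<close>

lemma gap_residues:
  fixes q \<alpha> \<beta> z :: int
  assumes q: "2 \<le> q" and b: "\<bar>\<alpha>\<bar> \<le> q" "\<bar>\<beta>\<bar> \<le> q" and e: "\<alpha> - \<beta> * (q + 1) = (q\<^sup>2 + q - 1) * z"
  shows "z = 0 \<and> \<alpha> = 0 \<and> \<beta> = 0 \<or> z = 1 \<and> \<alpha> = q \<and> \<beta> = 1 - q \<or> z = 1 \<and> \<alpha> = -1 \<and> \<beta> = - q \<or>
     z = -1 \<and> \<alpha> = - q \<and> \<beta> = q - 1 \<or> z = -1 \<and> \<alpha> = 1 \<and> \<beta> = q"
proof -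
  have qq: "2 * q \<le> q * q" using q by (intro mult_right_mono) auto
  have "\<bar>\<beta>\<bar> * (q + 1) \<le> q * (q + 1)" by (rule mult_right_mono) (use b q in auto)
  moreover have "\<bar>\<beta> * (q + 1)\<bar> = \<bar>\<beta>\<bar> * (q + 1)" using q by (simp add: abs_mult)
  ultimately have "\<bar>\<beta> * (q + 1)\<bar> \<le> q * q + q" by (simp only: distrib_left mult_1_right)
  then have "\<bar>\<alpha> - \<beta> * (q + 1)\<bar> \<le> q * q + 2 * q" using b by linarith
  then have "\<bar>\<alpha> - \<beta> * (q + 1)\<bar> < 2 * (q * q) + 2 * q - 2" using qq q by linarith
  then have "\<bar>z\<bar> < 2"
    using quotient_abs_less[OF e, of 2] qq q by (simp add: power2_eq_square algebra_simps)
  then consider "z = 0" | "z = 1" | "z = -1" by linarith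
  then show ?thesis
  proof cases
    case 1
    then have "\<alpha> = \<beta> * (q + 1)" using e by simp
    then have a: "\<alpha> = (q + 1) * \<beta>" by simp
    have "\<bar>\<alpha>\<bar> < q + 1" using b by linarith
    then have "\<bar>\<beta>\<bar> < 1" using quotient_abs_less[OF a, of 1] q by simp
    then have "\<beta> = 0" by simp
    then show ?thesis using 1 \<open>\<alpha> = \<beta> * (q + 1)\<close> by simp
  next
    case 2
    then have f: "\<alpha> - q = (q + 1) * (\<beta> + q - 1)" using e by (simp add: algebra_simps power2_eq_square)
    have f': "- (2 * (q + 1)) < \<alpha> - q" "\<alpha> - q < 1 * (q + 1)" using b q by (simp_all add: distrib_left)
    have "\<beta> = 1 - q \<or> \<beta> = - q" using quotient_between[OF f f'] q by linarith
    then show ?thesis using f 2 by auto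
  next
    case 3
    then have f: "\<alpha> + q = (q + 1) * (\<beta> - q + 1)" using e by (simp add: algebra_simps power2_eq_square)
    have f': "- (1 * (q + 1)) < \<alpha> + q" "\<alpha> + q < 2 * (q + 1)" using b q by (simp_all add: distrib_left)
    have "\<beta> = q - 1 \<or> \<beta> = q" using quotient_between[OF f f'] q by linarith
    then show ?thesis using f 3 by auto
  qed
qed


text \<open>Below, the short relations of an explicit tuple of diameter at most \<open>q\<^sup>3 + q\<^sup>2\<close> turn out to be
  multiples of the single relation that the tuple was built to satisfy.\<close>

lemma letters_zero_M_a_a:
  fixes q a x0 x1 x2 x3 x4 :: int
  assumes q: "2 \<le> q" and a: "1 \<le> a"
    and x: "x0 + x1 + x2 + x3 + x4 = 0" "max 0 x0 + max 0 x1 + max 0 x2 + max 0 x3 + max 0 x4 \<le> q"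
    and w: "w = q\<^sup>2 + q - 1"
    and e: "x1 + (1 + a * w) * x2 + (1 + a * w + (q + 1)) * x3 + (1 + q * w) * x4 = 0"
  shows "x0 = 0 \<and> x3 = 0 \<and> a * x2 + q * x4 = 0"
proof -
  from x(2) obtain p0 p1 p2 p3 p4 where "0 \<le> p0" "x0 \<le> p0" "0 \<le> p1" "x1 \<le> p1" "0 \<le> p2" "x2 \<le> p2"
    "0 \<le> p3" "x3 \<le> p3" "0 \<le> p4" "x4 \<le> p4" "p0 + p1 + p2 + p3 + p4 \<le> q" by (rule max_sum_witness5)
  note x = x(1) this
  \<comment> \<open>Modulo \<open>w\<close>, letters 1, 2 and 4 are congruent, while letters 0 and 3
    differ from them by \<open>-1\<close> and \<open>q + 1\<close>; \<open>z\<close> collects the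
    multiples of \<open>w\<close>.\<close>
  define z where "z = a * (x2 + x3) + q * x4"
  have b: "\<bar>x0\<bar> \<le> q" "\<bar>x3\<bar> \<le> q" using x by linarith+
  have "x0 - x3 * (q + 1) = w * z"
  proof -
    have "x0 = - x1 - x2 - x3 - x4" using x(1) by linarith
    then show ?thesis using e unfolding z_def by (simp add: algebra_simps)
  qed
  then consider "z = 0" "x0 = 0" "x3 = 0" | "z = 1" "x0 = q" "x3 = 1 - q" | "x0 = -1" "x3 = - q"
     | "z = -1" "x0 = - q" "x3 = q - 1" | "x0 = 1" "x3 = q"
    using gap_residues[OF q b, of z] w by blast
  then show ?thesis
  proof cases
    case 1 then show ?thesis by (simp add: z_def)
  next
    \<comment> \<open>\<open>x0 = q\<close> uses up the positive length, which makes
      \<open>z\<close> nonpositive. Solutions with \<open>x3\<close> equal to \<open>q\<close> or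
      \<open>- q\<close> exceed the length, because \<open>x0\<close> is nonzero of the same
      sign.\<close>
    case 2
    then have "x2 \<le> 0" "x4 \<le> 0" using x q by linarith+
    then have "a * (x2 + x3) \<le> 0" "q * x4 \<le> 0" using a q 2 by (simp_all add: mult_nonneg_nonpos)
    then show ?thesis using 2 z_def by simp
  next
    case 4
    then have "0 \<le> x2" "0 \<le> x4" using x q by linarith+
    then have "0 \<le> a * (x2 + x3)" "0 \<le> q * x4" using a q 4 by simp_all
    then show ?thesis using 4 z_def by simp
  qed (use x q in linarith)+
qed

text \<open>Now letters 0, 2 and 4 are divisible by \<open>w\<close>, and letters 1 and 3 have the
  residues \<open>1\<close> and \<open>- (q + 1)\<close>; again \<open>gap_residues\<close> and the
  length bound remove the latter two.\<close>

lemma letters_M_M_a_a: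
  fixes q a x0 x1 x2 x3 x4 :: int
  assumes q: "2 \<le> q" and a: "1 \<le> a"
    and x: "x0 + x1 + x2 + x3 + x4 = 0" "max 0 x0 + max 0 x1 + max 0 x2 + max 0 x3 + max 0 x4 \<le> q"
    and w: "w = q\<^sup>2 + q - 1"
    and e: "x1 + a * w * x2 + (q * w - (q + 1)) * x3 + q * w * x4 = 0"
  shows "x1 = 0 \<and> x3 = 0 \<and> a * x2 + q * x4 = 0"
proof -
  from x(2) obtain p0 p1 p2 p3 p4 where "0 \<le> p0" "x0 \<le> p0" "0 \<le> p1" "x1 \<le> p1" "0 \<le> p2" "x2 \<le> p2"
    "0 \<le> p3" "x3 \<le> p3" "0 \<le> p4" "x4 \<le> p4" "p0 + p1 + p2 + p3 + p4 \<le> q" by (rule max_sum_witness5)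
  note x = x(1) this
  define z where "z = - (a * x2 + q * x3 + q * x4)"
  have b: "\<bar>x1\<bar> \<le> q" "\<bar>x3\<bar> \<le> q" using x by linarith+
  have "x1 - x3 * (q + 1) = w * z"
    using e unfolding z_def by (simp add: algebra_simps)
  then consider "z = 0" "x1 = 0" "x3 = 0" | "z = 1" "x1 = q" "x3 = 1 - q" | "x1 = -1" "x3 = - q"
     | "z = -1" "x1 = - q" "x3 = q - 1" | "x1 = 1" "x3 = q"
    using gap_residues[OF q b, of z] w by blast
  then show ?thesis
  proof cases
    case 1 then show ?thesis by (simp add: z_def)
  next
    case 2
    then have "x2 \<le> 0" "x4 \<le> 0" using x q by linarith+
    then have "a * x2 \<le> 0" "q * x4 \<le> 0" using a q by (simp_all add: mult_nonneg_nonpos)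
    moreover have "q * x3 \<le> 2 * x3" by (rule mult_right_mono_neg) (use 2 q in auto)
    ultimately have "a * x2 + q * x3 + q * x4 \<le> -2" using 2 q by linarith
    then show ?thesis using 2 z_def by simp
  next
    case 4
    then have "0 \<le> x2" "0 \<le> x4" using x q by linarith+
    then have "0 \<le> a * x2" "0 \<le> q * x4" using a q by simp_all
    moreover have "2 * x3 \<le> q * x3" by (rule mult_right_mono) (use 4 q in auto)
    ultimately have "2 \<le> a * x2 + q * x3 + q * x4" using 4 q by linarith
    then show ?thesis using 4 z_def by simp
  qed (use x q in linarith)+
qed

text \<open>The last letter is \<open>q * (q^2 + q) - n * 1\<close>. The difference from this
  defining relation may be too long for \<open>generic_letters_4\<close>, so the divisions by
  \<open>q\<close> and by \<open>q + 1\<close> are done afresh.\<close>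

lemma letters_last_forced:
  fixes q n x0 x1 x2 x3 x4 :: int
  assumes q: "2 \<le> q" and n: "0 \<le> n" "n < q"
    and x: "x0 + x1 + x2 + x3 + x4 = 0" "max 0 x0 + max 0 x1 + max 0 x2 + max 0 x3 + max 0 x4 \<le> q"
    and e: "x1 + q\<^sup>2 * x2 + (q\<^sup>2 + q) * x3 + (q ^ 3 + q\<^sup>2 - n) * x4 = 0" and x4: "x4 = 1"
  shows "x1 = n \<and> x2 = 0 \<and> x3 = - q"
proof -
  from x(2) obtain p0 p1 p2 p3 p4 where "0 \<le> p0" "x0 \<le> p0" "0 \<le> p1" "x1 \<le> p1" "0 \<le> p2" "x2 \<le> p2"
    "0 \<le> p3" "x3 \<le> p3" "0 \<le> p4" "x4 \<le> p4" "p0 + p1 + p2 + p3 + p4 \<le> q" by (rule max_sum_witness5)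
  note x = x(1) this
  have "x1 - n = q * (- q * x2 - (q + 1) * x3 - (q\<^sup>2 + q))"
    using e x4 by (simp add: algebra_simps power2_eq_square power3_eq_cube)
  then obtain y where y: "x1 - n = q * y" by blast
  have "q * (y + q * x2 + (q + 1) * (x3 + q)) = 0"
    using e x4 y by (simp add: algebra_simps power2_eq_square power3_eq_cube)
  then have e': "y + q * x2 + (q + 1) * (x3 + q) = 0" using q by simp
  have x3: "- q \<le> x3" "\<bar>x2\<bar> \<le> q" "x1 \<le> q - 1" "- q \<le> x1" using x x4 by linarith+
  have y': "- (2 * q) < x1 - n" "x1 - n < 1 * q" using x3 n by linarith+
  have "y = 0 \<or> y = -1" using quotient_between[OF y y'] q by linarith
  then show ?thesis
  proof
    assume y0: "y = 0"
    then have "x3 + q = q * (- x2 - (x3 + q))" using e' by (simp add: algebra_simps)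
    then obtain l where l: "x3 + q = q * l" "l = - x2 - (x3 + q)" by blast
    have "x2 = - l - (x3 + q)" using l(2) by linarith
    then have x2: "x2 = (q + 1) * (- l)" unfolding l(1) by (simp add: algebra_simps)
    have "\<bar>x2\<bar> < q + 1" using x3 by linarith
    then have "\<bar>- l\<bar> < 1" using quotient_abs_less[OF x2, of 1] q by simp
    then have l0: "l = 0" by simp
    have "x3 = - q" using l(1) unfolding l0 by simp
    moreover have "x1 = n" using y y0 by simp
    ultimately show ?thesis using l(2) l0 by linarith
  next
    assume y1: "y = -1"
    then have "x3 + q - 1 = q * (- x2 - (x3 + q))" using e' by (simp add: algebra_simps)
    then obtain l where l: "x3 + q - 1 = q * l" "l = - x2 - (x3 + q)" by blast
    have "x2 + 1 = - l - (x3 + q - 1)" using l(2) by linarith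
    then have x2: "x2 + 1 = (q + 1) * (- l)" unfolding l(1) by (simp add: algebra_simps)
    have "\<bar>x2 + 1\<bar> < 2 * q + 2" using x3(2) q by linarith
    then have "\<bar>- l\<bar> < 2" using quotient_abs_less[OF x2, of 2] q by (simp add: algebra_simps)
    then consider "l = 0" | "l = 1" | "l = -1" by linarith
    then have False
    proof cases
      case 1
      have "x3 = 1 - q" using l(1) unfolding 1 by simp
      moreover have "x1 = n - q" using y y1 by simp
      ultimately show False using l(2) 1 x x4 n by linarith
    next
      case 2
      have "x3 = 1" using l(1) unfolding 2 by simp
      then show False using l(2) 2 x3 by linarith
    next
      case 3
      have "x3 + q - 1 = - q" using l(1) unfolding 3 by simp
      then show False using x3(1) q by linarith
    qed
    then show ?thesis ..
  qed
qed

text \<open>The first four letters are the mirror image of \<open>0, 1, q^2, q^2 + q\<close>, and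
  the last one is \<open>n * (q^2 + q - 1) + (q - n) * (q^2 + q)\<close>.\<close>

lemma letters_last_forced':
  fixes q n x0 x1 x2 x3 x4 :: int
  assumes q: "2 \<le> q" and n: "0 \<le> n" "n < q"
    and x: "x0 + x1 + x2 + x3 + x4 = 0" "max 0 x0 + max 0 x1 + max 0 x2 + max 0 x3 + max 0 x4 \<le> q"
    and e: "q * x1 + (q\<^sup>2 + q - 1) * x2 + (q\<^sup>2 + q) * x3 + (q ^ 3 + q\<^sup>2 - n) * x4 = 0" and x4: "x4 = 1"
  shows "x1 = 0 \<and> x2 = - n \<and> x3 = n - q"
proof -
  from x(2) obtain p0 p1 p2 p3 p4 where "0 \<le> p0" "x0 \<le> p0" "0 \<le> p1" "x1 \<le> p1" "0 \<le> p2" "x2 \<le> p2"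
    "0 \<le> p3" "x3 \<le> p3" "0 \<le> p4" "x4 \<le> p4" "p0 + p1 + p2 + p3 + p4 \<le> q" by (rule max_sum_witness5)
  note x = x(1) this
  have "x2 + n = q * (x1 + (q + 1) * x2 + (q + 1) * x3 + (q\<^sup>2 + q))"
    using e x4 by (simp add: algebra_simps power2_eq_square power3_eq_cube)
  then obtain y where y: "x2 + n = q * y" by blast
  have "q * (x1 - y + (q + 1) * (x2 + x3 + q)) = 0"
    using e x4 y by (simp add: algebra_simps power2_eq_square power3_eq_cube)
  then have e': "x1 = y - (q + 1) * (x2 + x3 + q)" using q by simp
  define T where "T = x2 + x3 + q"
  have b: "- q \<le> x2" "x2 \<le> q - 1" "0 \<le> T" "- q \<le> x1" "x1 \<le> q - 1" using x x4 unfolding T_def by linarith+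
  have "\<bar>x2 + n\<bar> < 2 * q" using b n by linarith
  then have "\<bar>y\<bar> < 2" by (rule quotient_abs_less[OF y]) (use q in simp)
  then have "y = -1 \<or> y = 0 \<or> y = 1" by linarith
  moreover have T: "y - x1 = (q + 1) * T" using e' by (simp add: T_def algebra_simps)
  have "\<bar>y - x1\<bar> < 2 * q + 2" using \<open>\<bar>y\<bar> < 2\<close> b q by linarith
  then have "\<bar>T\<bar> < 2" using quotient_abs_less[OF T, of 2] q by (simp add: algebra_simps)
  then have "T = 0 \<or> T = 1" using b by linarith
  ultimately show ?thesis
  proof (elim disjE)
    assume "y = 0" "T = 0"
    then show ?thesis using y e' by (simp add: T_def)
  next
    assume "y = 0" "T = 1"
    then have "x1 = - q - 1" using e' by (simp add: T_def)
    then show ?thesis using b by simp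
  next
    assume h: "y = 1" "T = 0"
    then have "x1 = 1" "x2 = q - n" "x3 = - q - x2" using y e' by (simp_all add: T_def)
    then show ?thesis using x x4 n by linarith
  next
    assume h: "y = 1" "T = 1"
    then have "x1 = - q" "x2 = q - n" "x3 = 1 - q - x2" using y e' by (simp_all add: T_def)
    then show ?thesis using x x4 n by linarith
  next
    assume h: "y = -1" "T = 0"
    then have "x1 = -1" "x2 = - q - n" using y e' by (simp_all add: T_def)
    then show ?thesis using x x4 n by linarith
  next
    assume h: "y = -1" "T = 1"
    then have "x1 = - 2 - q" using y e' by (simp_all add: T_def)
    then show ?thesis using b by simp
  qed
qed

text \<open>\<open>M * q - M - q\<close> is the Frobenius number of the coprime \<open>M\<close> and
  \<open>q\<close>, the largest integer that is not a sum of nonnegative multiples of them. Modulo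
  \<open>q\<close>, \<open>x1\<close> must be \<open>0\<close>, \<open>q\<close> or
  \<open>- q\<close>; if \<open>x1 = q\<close>, the other coefficients are nonpositive, and division
  by \<open>q\<close> would represent the Frobenius number.\<close>

lemma letters_a_a_M:
  fixes q M x0 x1 x2 x3 :: int
  assumes M: "2 \<le> M" "M < q" "coprime M q"
    and x: "x0 + x1 + x2 + x3 = 0" "max 0 x0 + max 0 x1 + max 0 x2 + max 0 x3 \<le> q"
    and e: "(M * q - M - q) * x1 + M * q * x2 + q\<^sup>2 * x3 = 0"
  shows "x1 = 0 \<and> M * x2 + q * x3 = 0"
proof -
  have aux: "x1 \<noteq> q" if x: "x0 + x1 + x2 + x3 = 0" "max 0 x0 + max 0 x1 + max 0 x2 + max 0 x3 \<le> q"
    and e: "(M * q - M - q) * x1 + M * q * x2 + q\<^sup>2 * x3 = 0" for x0 x1 x2 x3 :: int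
  proof
    from x(2) obtain p0 p1 p2 p3 where "0 \<le> p0" "x0 \<le> p0" "0 \<le> p1" "x1 \<le> p1" "0 \<le> p2" "x2 \<le> p2"
      "0 \<le> p3" "x3 \<le> p3" "p0 + p1 + p2 + p3 \<le> q" by (rule max_sum_witness4)
    note x = x(1) this
    assume x1: "x1 = q"
    have b: "x2 \<le> 0" "x3 \<le> 0" "x0 \<le> 0" using x x1 by linarith+
    have "q * ((M * q - M - q) + M * x2 + q * x3) = 0" using e x1 by (simp add: algebra_simps power2_eq_square)
    then have f: "(M * q - M - q) + M * x2 + q * x3 = 0" using M by simp
    then have "M * (1 - x2) = q * (M - 1 + x3)" by (simp add: algebra_simps)
    then have "q dvd M * (1 - x2)" by simp
    then have "q dvd 1 - x2" using M(3) by (simp add: coprime_commute coprime_dvd_mult_right_iff)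
    then obtain k where k: "1 - x2 = q * k" by blast
    have k': "- (0 * q) < 1 - x2" "1 - x2 < 2 * q" using b x x1 M by linarith+
    have "k = 1" using quotient_between[OF k k'] M by linarith
    then have x2: "x2 = 1 - q" using k by simp
    have "q * x3 = q" using f unfolding x2 by (simp add: algebra_simps)
    then have "x3 = 1" using M by simp
    then show False using b by simp
  qed
  have "q * (- M * x1 + x1 - M * x2 - q * x3) = - M * x1" using e by (simp add: algebra_simps power2_eq_square)
  then have "q dvd - M * x1" by (metis dvd_triv_left)
  then have "q dvd x1" using M(3) by (simp add: coprime_commute coprime_dvd_mult_right_iff)
  then obtain k where k: "x1 = q * k" by blast
  have "\<bar>x1\<bar> \<le> q" using x by linarith
  then have "\<bar>k\<bar> * q < 2 * q" using M k by (simp add: abs_mult mult.commute)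
  then have "\<bar>k\<bar> < 2" using M by (simp add: mult_less_cancel_right)
  then consider "k = 0" | "k = 1" | "k = -1" by linarith
  then show ?thesis
  proof cases
    case 1
    then have "q * (M * x2 + q * x3) = 0" using e k by (simp add: algebra_simps power2_eq_square)
    then show ?thesis using 1 k M by simp
  next
    case 2 then show ?thesis using aux[OF x e] k by simp
  next
    case 3
    have "max 0 (- x0) + max 0 (- x1) + max 0 (- x2) + max 0 (- x3) \<le> q" using x by linarith
    moreover have "(M * q - M - q) * (- x1) + M * q * (- x2) + q\<^sup>2 * (- x3) = 0" using e by (simp add: algebra_simps)
    ultimately show ?thesis using aux[of "- x0" "- x1" "- x2" "- x3"] x(1) 3 k by simp
  qed
qed

text \<open>A relation of a five letter alphabet is written \<open>c\<^sub>1 g\<^sub>1 + \<dots> + c\<^sub>4 g\<^sub>4 = 0\<close> in terms of the gaps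
  \<open>g\<^sub>j\<close>; its length is half the total variation of \<open>0, c\<^sub>1, \<dots>, c\<^sub>4, 0\<close>.  Closing gap \<open>j\<close> deletes \<open>c\<^sub>j\<close>,
  which is possible if entries of both signs remain, and shortens the relation if \<open>c\<^sub>j\<close> is a strict
  local extremum.  Up to sign and reversal, the tame patterns and the relations between just two gaps
  are those for which no gap does both.\<close>

definition tame_pattern :: "int \<Rightarrow> int \<Rightarrow> int \<Rightarrow> int \<Rightarrow> bool" where
  "tame_pattern c1 c2 c3 c4 \<longleftrightarrow>
     c1 = 0 \<and> 0 < c2 \<and> c3 < 0 \<and> c4 = c3 \<or> 0 < c1 \<and> c2 = c1 \<and> c3 < 0 \<and> c4 = c3 \<or>
     0 < c4 \<and> c2 < 0 \<and> c3 = c2 \<and> c2 \<le> c1 \<and> c1 \<le> 0 \<or> 0 < c4 \<and> c1 < 0 \<and> c2 = c1 \<and> c1 \<le> c3 \<and> c3 \<le> 0"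

definition mixed3 :: "int \<Rightarrow> int \<Rightarrow> int \<Rightarrow> bool" where
  "mixed3 a b c \<longleftrightarrow> (0 < a \<or> 0 < b \<or> 0 < c) \<and> (a < 0 \<or> b < 0 \<or> c < 0)"

definition peak :: "int \<Rightarrow> int \<Rightarrow> int \<Rightarrow> bool" where
  "peak a b c \<longleftrightarrow> a < b \<and> c < b \<or> b < a \<and> b < c"

lemma irreducible_patterns:
  assumes "0 < c1 \<or> 0 < c2 \<or> 0 < c3 \<or> 0 < c4" "c1 < 0 \<or> c2 < 0 \<or> c3 < 0 \<or> c4 < 0"
    and "mixed3 c2 c3 c4 \<Longrightarrow> \<not> peak 0 c1 c2" "mixed3 c1 c3 c4 \<Longrightarrow> \<not> peak c1 c2 c3"
    and "mixed3 c1 c2 c4 \<Longrightarrow> \<not> peak c2 c3 c4" "mixed3 c1 c2 c3 \<Longrightarrow> \<not> peak c3 c4 0"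
  shows "c1 = 0 \<and> c2 = 0 \<or> c1 = 0 \<and> c3 = 0 \<or> c1 = 0 \<and> c4 = 0 \<or> c2 = 0 \<and> c3 = 0 \<or> c2 = 0 \<and> c4 = 0 \<or> c3 = 0 \<and> c4 = 0 \<or>
    tame_pattern c1 c2 c3 c4 \<or> tame_pattern (- c1) (- c2) (- c3) (- c4) \<or>
    tame_pattern c4 c3 c2 c1 \<or> tame_pattern (- c4) (- c3) (- c2) (- c1)"
  using assms unfolding tame_pattern_def mixed3_def peak_def by smt

subsection \<open>Alphabets with at most four letters\<close>

lemma ip_3: "ip 3 x y = real_of_int (x 0) * y 0 + real_of_int (x 1) * y 1 + real_of_int (x 2) * y 2"
  by (simp add: ip_def eval_nat_numeral)

lemma ip_4: "ip 4 x y = real_of_int (x 0) * y 0 + real_of_int (x 1) * y 1 + real_of_int (x 2) * y 2 + real_of_int (x 3) * y 3"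
  by (simp add: ip_def eval_nat_numeral)

lemma ip_5: "ip 5 x y = real_of_int (x 0) * y 0 + real_of_int (x 1) * y 1 + real_of_int (x 2) * y 2
    + real_of_int (x 3) * y 3 + real_of_int (x 4) * y 4"
  by (simp add: ip_def eval_nat_numeral)

lemma shorts_3D: "x \<in> shorts 3 q \<Longrightarrow> x 0 + x 1 + x 2 = 0"
  "x \<in> shorts 3 q \<Longrightarrow> max 0 (x 0) + max 0 (x 1) + max 0 (x 2) \<le> int q"
  by (simp_all add: shorts_def eval_nat_numeral)

lemma shorts_4D: "x \<in> shorts 4 q \<Longrightarrow> x 0 + x 1 + x 2 + x 3 = 0"
  "x \<in> shorts 4 q \<Longrightarrow> max 0 (x 0) + max 0 (x 1) + max 0 (x 2) + max 0 (x 3) \<le> int q"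
  by (simp_all add: shorts_def eval_nat_numeral)

lemma shorts_5D: "x \<in> shorts 5 q \<Longrightarrow> x 0 + x 1 + x 2 + x 3 + x 4 = 0"
  "x \<in> shorts 5 q \<Longrightarrow> max 0 (x 0) + max 0 (x 1) + max 0 (x 2) + max 0 (x 3) + max 0 (x 4) \<le> int q"
  by (simp_all add: shorts_def eval_nat_numeral)

lemma shorts_zero: "x \<in> shorts m q \<Longrightarrow> m \<le> i \<Longrightarrow> x i = 0"
  by (simp add: shorts_def)

lemma all_gaps_5: "(\<forall>j. Suc j < 5 \<longrightarrow> P j) \<longleftrightarrow> P 0 \<and> P 1 \<and> P 2 \<and> P 3"
  by (auto simp: eval_nat_numeral less_Suc_eq)

lemma all_gaps_4: "(\<forall>j. Suc j < 4 \<longrightarrow> P j) \<longleftrightarrow> P 0 \<and> P 1 \<and> P 2"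
  by (auto simp: eval_nat_numeral less_Suc_eq)

lemma ip_int_4: "ip 4 x (\<lambda>i. real_of_int (s i)) = 0 \<longleftrightarrow> x 0 * s 0 + x 1 * s 1 + x 2 * s 2 + x 3 * s 3 = 0"
proof -
  have "ip 4 x (\<lambda>i. real_of_int (s i)) = real_of_int (x 0 * s 0 + x 1 * s 1 + x 2 * s 2 + x 3 * s 3)"
    by (simp add: ip_4)
  then show ?thesis by (simp only: of_int_eq_0_iff)
qed

lemma ip_int_5: "ip 5 x (\<lambda>i. real_of_int (s i)) = 0 \<longleftrightarrow> x 0 * s 0 + x 1 * s 1 + x 2 * s 2 + x 3 * s 3 + x 4 * s 4 = 0"
proof -
  have "ip 5 x (\<lambda>i. real_of_int (s i)) = real_of_int (x 0 * s 0 + x 1 * s 1 + x 2 * s 2 + x 3 * s 3 + x 4 * s 4)"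
    by (simp add: ip_5)
  then show ?thesis by (simp only: of_int_eq_0_iff)
qed

text \<open>The kernel of \<open>push i\<close> is spanned by \<open>gap i\<close>, which is no
  relation of a strictly increasing alphabet.\<close>

lemma push_nonzero:
  assumes x: "x \<in> shorts (Suc m) q" "x \<noteq> (\<lambda>_. 0)" "ip (Suc m) x t = 0" and t: "sinc (Suc m) t" and i: "Suc i < Suc m"
  shows "push i x \<noteq> (\<lambda>_. 0)"
proof
  assume z: "push i x = (\<lambda>_. 0)"
  have 1: "x j = 0" if "j < i" for j using fun_cong[OF z, of j] that by (simp add: push_def)
  have 2: "x i = - x (Suc i)" using fun_cong[OF z, of i] by (simp add: push_def)
  have 3: "x j = 0" if "Suc i < j" for j
    using fun_cong[OF z, of "j - 1"] that by (simp add: push_def split: if_splits)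
  have xg: "x j = x (Suc i) * gap i j" for j
  proof -
    consider "j < i" | "j = i" | "j = Suc i" | "Suc i < j" by linarith
    then show ?thesis by cases (use 1 2 3 in \<open>auto simp: gap_def\<close>)
  qed
  have "ip (Suc m) x t = real_of_int (x (Suc i)) * ip (Suc m) (gap i) t"
    unfolding ip_def sum_distrib_left
  proof (rule sum.cong[OF refl])
    fix j
    show "real_of_int (x j) * t j = real_of_int (x (Suc i)) * (real_of_int (gap i j) * t j)"
      by (subst xg[of j]) simp
  qed
  moreover have "ip (Suc m) (gap i) t \<noteq> 0" using t i by (auto simp: ip_gap sinc_def)
  ultimately have x0: "x (Suc i) = 0" using x(3) by simp
  have "x j = 0" for j by (subst xg) (simp add: x0)
  then have "x = (\<lambda>_. 0)" by (rule ext)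
  then show False using x(2) by simp
qed

text \<open>One relation fixes the ratio of the two gaps: \<open>c * g1 = d * g2\<close>, so the
  gaps \<open>d\<close> and \<open>c\<close> give a model. Unless both gaps vanish,
  \<open>v 0\<close> and \<open>v 2\<close> do not have opposite signs, hence \<open>c + d\<close>
  is \<open>abs (v 1)\<close>. This saves 1 against the general bound \<open>q + 1\<close>.\<close>

lemma three_letters_related:
  assumes u: "winc 3 u" and v: "v \<in> shorts 3 q" "v \<noteq> (\<lambda>_. 0)" "ip 3 v u = 0"
  shows "has_model 3 q u (int q)"
proof -
  define g1 where "g1 = u 1 - u 0"
  define g2 where "g2 = u 2 - u 1"
  have g: "0 \<le> g1" "0 \<le> g2" using u by (simp_all add: winc_def g1_def g2_def numeral_2_eq_2)
  have gaps: "ip 3 x y = real_of_int (- x 0) * (y 1 - y 0) + real_of_int (x 2) * (y 2 - y 1)" if "x \<in> shorts 3 q" for x y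
  proof -
    have e: "x 1 = - x 0 - x 2" using shorts_3D(1)[OF that] by linarith
    show ?thesis unfolding ip_3 e by (simp add: algebra_simps)
  qed
  define c where "c = \<bar>v 0\<bar>"
  define d where "d = \<bar>v 2\<bar>"
  have rel: "real_of_int (v 0) * g1 = real_of_int (v 2) * g2"
    using gaps[OF v(1), of u] v(3) by (simp add: g1_def g2_def)
  have cd: "real_of_int c * g1 = real_of_int d * g2"
    using arg_cong[OF rel, of abs] g by (simp add: c_def d_def abs_mult)
  have cd0: "c \<noteq> 0 \<or> d \<noteq> 0"
  proof (rule ccontr)
    assume "\<not> ?thesis"
    then have "v 0 = 0" "v 2 = 0" "v 1 = 0" using shorts_3D(1)[OF v(1)] by (simp_all add: c_def d_def)
    moreover have "v i = 0" if "3 \<le> i" for i using shorts_zero[OF v(1) that] .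
    ultimately have "v = (\<lambda>_. 0)"
      by (metis One_nat_def Suc_1 le_less_linear less_Suc_eq less_zeroE numeral_3_eq_3 ext)
    then show False using v(2) by simp
  qed
  show ?thesis
  proof (cases "g1 = 0 \<and> g2 = 0")
    case True
    have "models 3 q u (\<lambda>_. 0)"
      using True gaps by (auto simp: models_def winc_def g1_def g2_def)
    then show ?thesis unfolding has_model_def by (intro exI[of _ "\<lambda>_. 0"]) simp
  next
    case False
    have le: "c + d \<le> int q"
    proof -
      have "\<bar>v 0 + v 2\<bar> \<le> int q"
      proof -
        have "v 0 + v 2 = - v 1" using shorts_3D(1)[OF v(1)] by simp
        then show ?thesis using shorts_abs_le[OF v(1), of 1] by simp
      qed
      moreover have "0 \<le> v 0 \<and> 0 \<le> v 2 \<or> v 0 \<le> 0 \<and> v 2 \<le> 0"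
      proof (rule ccontr)
        assume n: "\<not> ?thesis"
        then have "v 0 * v 2 < 0" by (auto simp: mult_less_0_iff)
        have r: "0 < v 0 \<and> v 2 < 0 \<or> v 0 < 0 \<and> 0 < v 2" using n by auto
        then have "real_of_int (v 0) * g1 = 0 \<and> real_of_int (v 2) * g2 = 0"
        proof
          assume "0 < v 0 \<and> v 2 < 0"
          then have "0 \<le> real_of_int (v 0) * g1" "real_of_int (v 2) * g2 \<le> 0"
            using g by (simp_all add: mult_nonpos_nonneg)
          then show ?thesis using rel by simp
        next
          assume "v 0 < 0 \<and> 0 < v 2"
          then have "real_of_int (v 0) * g1 \<le> 0" "0 \<le> real_of_int (v 2) * g2"
            using g by (simp_all add: mult_nonpos_nonneg)
          then show ?thesis using rel by simp
        qed
        then show False using False r by auto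
      qed
      ultimately show ?thesis by (auto simp: c_def d_def)
    qed
    define s where "s j = (if j = 0 then 0 else if j = 1 then d else c + d)" for j :: nat
    have "models 3 q u s"
      unfolding models_def
    proof (intro conjI ballI)
      show "winc 3 s" by (auto simp: winc_def s_def c_def d_def)
      fix x assume x: "x \<in> shorts 3 q"
      let ?S = "ip 3 x (\<lambda>j. real_of_int (s j))"
      have S: "?S = real_of_int (- x 0) * d + real_of_int (x 2) * c"
        by (simp add: gaps[OF x] s_def)
      have U: "ip 3 x u = real_of_int (- x 0) * g1 + real_of_int (x 2) * g2"
        by (simp add: gaps[OF x] g1_def g2_def)
      \<comment> \<open>Two equations are needed, since one of \<open>c\<close>, \<open>d\<close> or
        one of the gaps may be 0.\<close>
      have 1: "real_of_int c * ip 3 x u = g2 * ?S"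
      proof -
        have "real_of_int c * ip 3 x u = real_of_int (- x 0) * (real_of_int c * g1) + real_of_int (x 2) * real_of_int c * g2"
          unfolding U by (simp add: algebra_simps)
        then show ?thesis unfolding cd S by (simp add: algebra_simps)
      qed
      have 2: "real_of_int d * ip 3 x u = g1 * ?S"
      proof -
        have "real_of_int d * ip 3 x u = real_of_int (- x 0) * real_of_int d * g1 + real_of_int (x 2) * (real_of_int d * g2)"
          unfolding U by (simp add: algebra_simps)
        then show ?thesis unfolding cd[symmetric] S by (simp add: algebra_simps)
      qed
      show "ip 3 x u = 0 \<longleftrightarrow> ?S = 0"
      proof
        assume "ip 3 x u = 0"
        then show "?S = 0" using 1 2 False by auto
      next
        assume "?S = 0"
        then show "ip 3 x u = 0" using 1 2 cd0 by auto
      qed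
    qed
    moreover have "s (3 - 1) - s 0 \<le> int q" using le by (simp add: s_def)
    ultimately show ?thesis unfolding has_model_def by blast
  qed
qed

lemma generic_facet_collapse:
  assumes q: "1 \<le> q" and m: "2 \<le> m" and t: "sinc (Suc m) t"
  obtains i t' where "generic_on_facet (Suc m) q t i t'" "winc m (\<lambda>j. t' (unsquash i j))"
    "\<And>x. x \<in> shorts (Suc m) q \<Longrightarrow> ip (Suc m) x t = 0 \<Longrightarrow> ip m (push i x) (\<lambda>j. t' (unsquash i j)) = 0"
proof -
  obtain i t' where g: "generic_on_facet (Suc m) q t i t'" "winc (Suc m) t'"
    using generic_facet_exists[of "Suc m" q t] m q t by auto
  have i: "Suc i < Suc m" "t' i = t' (Suc i)" and fl: "t' \<in> flat (Suc m) q t"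
    using g(1) by (auto simp: generic_on_facet_def)
  show thesis
  proof (rule that[OF g(1) winc_unsquash[OF g(2)]])
    fix x assume x: "x \<in> shorts (Suc m) q" "ip (Suc m) x t = 0"
    have "ip m (push i x) (\<lambda>j. t' (unsquash i j)) = ip (Suc m) x t'"
      using squash_unsquash[of t', OF i(2)] by (simp add: ip_push[OF i(1)])
    then show "ip m (push i x) (\<lambda>j. t' (unsquash i j)) = 0" using fl x by (simp add: flat_def)
  qed
qed

lemma model_from_collapse:
  assumes q: "1 \<le> q" and m: "2 \<le> m" and t: "sinc (Suc m) t" and pq: "p \<le> q"
    and B: "(\<exists>v\<in>shorts (Suc m) p. v \<noteq> (\<lambda>_. 0) \<and> ip (Suc m) v t = 0) \<and> B = int p * int q ^ (m - 2) \<or> B = int q ^ (m - 1)"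
    and g: "generic_on_facet (Suc m) q t i t'" and D: "has_model m q (\<lambda>j. t' (unsquash i j)) D"
  shows "has_model (Suc m) q t (D + B)"
proof (rule model_from_facet[OF _ q t pq _ g])
  have i: "Suc i < Suc m" "t' i = t' (Suc i)" using g by (auto simp: generic_on_facet_def)
  show "has_model (Suc m) q t' D" by (rule has_model_unsquash[where t' = t', OF i D])
  show "(\<exists>v\<in>shorts (Suc m) p. v \<noteq> (\<lambda>_. 0) \<and> ip (Suc m) v t = 0) \<and> B = int p * int q ^ (Suc m - 3) \<or> B = int q ^ (Suc m - 2)"
    using B m by (simp add: numeral_3_eq_3 numeral_2_eq_2)
qed (use m in simp)

text \<open>The relation survives on the facet, which therefore costs only \<open>q\<close>, and
  \<open>p\<close> replaces a factor \<open>q\<close> in the bound for the ray.\<close>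

lemma four_letters_related:
  assumes q: "1 \<le> q" and t: "sinc 4 t" and p: "p \<le> q" and v: "v \<in> shorts 4 p" "v \<noteq> (\<lambda>_. 0)" "ip 4 v t = 0"
  shows "has_model 4 q t (int q + int p * int q)"
proof -
  have 4: "4 = Suc 3" by simp
  obtain i t' where g: "generic_on_facet (Suc 3) q t i t'" "winc 3 (\<lambda>j. t' (unsquash i j))"
    "\<And>x. x \<in> shorts (Suc 3) q \<Longrightarrow> ip (Suc 3) x t = 0 \<Longrightarrow> ip 3 (push i x) (\<lambda>j. t' (unsquash i j)) = 0"
    using generic_facet_collapse[of q 3 t] q t by auto
  have i: "Suc i < Suc 3" using g(1) by (simp add: generic_on_facet_def)
  have vq: "v \<in> shorts (Suc 3) q" using v(1) shorts_mono[OF p] by auto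
  have "has_model 3 q (\<lambda>j. t' (unsquash i j)) (int q)"
  proof (rule three_letters_related[OF g(2) push_shorts[OF vq i] push_nonzero[OF vq v(2) _ _ i]])
    show "ip (Suc 3) v t = 0" "sinc (Suc 3) t" using v(3) t by simp_all
    show "ip 3 (push i v) (\<lambda>j. t' (unsquash i j)) = 0" using g(3)[OF vq] v(3) by simp
  qed
  then have "has_model (Suc 3) q t (int q + int p * int q)"
    by (rule model_from_collapse[OF q _ _ p _ g(1), rotated 3]) (use v t in \<open>auto intro!: bexI[of _ v]\<close>)
  then show ?thesis by simp
qed

text \<open>A relation saves 1 on the facet; without relations, any tuple free of short relations is
  a model.\<close>

theorem bnd_4:
  assumes q: "2 \<le> q"
  shows "bnd 4 q (int q ^ 2 + int q)"
  unfolding bnd_def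
proof (intro allI impI)
  fix t :: "nat \<Rightarrow> real" assume t: "sinc 4 t"
  show "has_model 4 q t (int q ^ 2 + int q)"
  proof (cases "\<exists>v\<in>shorts 4 q. v \<noteq> (\<lambda>_. 0) \<and> ip 4 v t = 0")
    case True
    then obtain v where "v \<in> shorts 4 q" "v \<noteq> (\<lambda>_. 0)" "ip 4 v t = 0" by blast
    then have "has_model 4 q t (int q + int q * int q)" using four_letters_related[OF _ t order_refl] q by simp
    then show ?thesis by (simp add: power2_eq_square add.commute)
  next
    case False
    define s :: "nat \<Rightarrow> int" where "s j = (if j = 0 then 0 else if j = 1 then 1 else if j = 2 then int q ^ 2 else int q ^ 2 + int q)" for j
    have sv: "s 0 = 0" "s 1 = 1" "s 2 = int q ^ 2" "s 3 = int q ^ 2 + int q" by (simp_all add: s_def)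
    have "models 4 q t s"
      unfolding models_def
    proof (intro conjI ballI)
      show "winc 4 s" unfolding winc_def all_gaps_4 using q by (simp add: s_def)
      fix x assume x: "x \<in> shorts 4 q"
      have "x = (\<lambda>_. 0)" if "ip 4 x (\<lambda>j. real_of_int (s j)) = 0"
      proof -
        have e: "x 1 + (int q)\<^sup>2 * x 2 + ((int q)\<^sup>2 + int q) * x 3 = 0"
          using that unfolding ip_int_4 sv by (simp add: mult.commute)
        have "x 0 = 0 \<and> x 1 = 0 \<and> x 2 = 0 \<and> x 3 = 0"
          by (rule generic_letters_4[OF _ shorts_4D[OF x] e]) (use q in simp)
        moreover have "x j = 0" if "4 \<le> j" for j using shorts_zero[OF x that] .
        moreover have "j = 0 \<or> j = 1 \<or> j = 2 \<or> j = 3 \<or> 4 \<le> j" for j :: nat by linarith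
        ultimately show ?thesis by (metis ext)
      qed
      moreover have "x = (\<lambda>_. 0)" if "ip 4 x t = 0" using False x that by blast
      ultimately show "ip 4 x t = 0 \<longleftrightarrow> ip 4 x (\<lambda>j. real_of_int (s j)) = 0"
        by (auto simp: ip_def)
    qed
    moreover have "s (4 - 1) - s 0 \<le> int q ^ 2 + int q" by (simp add: sv)
    ultimately show ?thesis unfolding has_model_def by blast
  qed
qed

lemma bnd_3: "1 \<le> q \<Longrightarrow> bnd 2 q 1 \<Longrightarrow> bnd 3 q (int q + 1)"
  using bnd_step[of 2 q 1] by (simp add: numeral_3_eq_3 add.commute)

lemma weak_four_letters:
  assumes q: "1 \<le> q" and b: "bnd 3 q D" and u: "winc 4 u" "\<not> sinc 4 u"
  shows "has_model 4 q u D"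
proof -
  obtain i where i: "Suc i < Suc 3" "u i = u (Suc i)"
    using u by (force simp: sinc_def winc_def)
  have "has_model 3 q (\<lambda>j. u (unsquash i j)) D"
    by (rule bnd_weak[OF b _ winc_unsquash]) (use u(1) in auto)
  then have "has_model (Suc 3) q u D" by (rule has_model_unsquash[where t' = u, OF i])
  then show ?thesis by simp
qed

section \<open>Independent relations\<close>

definition parallel :: "nat \<Rightarrow> (nat \<Rightarrow> int) \<Rightarrow> (nat \<Rightarrow> int) \<Rightarrow> bool" where
  "parallel m v x \<longleftrightarrow> (\<forall>i<m. \<forall>j<m. v i * x j = v j * x i)"

lemma parallel_ip:
  assumes "parallel m v x" "i < m"
  shows "real_of_int (v i) * ip m x y = real_of_int (x i) * ip m v y"
proof -
  have "real_of_int (v i) * ip m x y = (\<Sum>j<m. real_of_int (v i * x j) * y j)"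
    unfolding ip_def sum_distrib_left by (rule sum.cong) auto
  also have "\<dots> = (\<Sum>j<m. real_of_int (v j * x i) * y j)"
    by (rule sum.cong) (use assms in \<open>auto simp: parallel_def\<close>)
  also have "\<dots> = real_of_int (x i) * ip m v y"
    unfolding ip_def sum_distrib_left by (rule sum.cong) auto
  finally show ?thesis .
qed

lemma push_linear: "push i (\<lambda>k. a * x k - b * y k) j = a * push i x j - b * push i y j"
  by (simp add: push_def algebra_simps)

text \<open>If the images are proportional, a combination of \<open>v\<close> and \<open>x\<close>
  is mapped to 0; being a relation of \<open>t\<close>, it vanishes by
  \<open>push_nonzero\<close>.\<close>

lemma push_parallel_imp_parallel:
  assumes v: "v \<in> shorts (Suc m) q" "v \<noteq> (\<lambda>_. 0)" "ip (Suc m) v t = 0"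
    and x: "x \<in> shorts (Suc m) q" "ip (Suc m) x t = 0"
    and t: "sinc (Suc m) t" and i: "Suc i < Suc m"
    and p: "parallel m (push i v) (push i x)"
  shows "parallel (Suc m) v x"
proof -
  have pv: "push i v \<noteq> (\<lambda>_. 0)" by (rule push_nonzero[OF v t i])
  have pvs: "push i v \<in> shorts m q" by (rule push_shorts[OF v(1) i])
  obtain k where k: "push i v k \<noteq> 0" using pv by (auto simp: fun_eq_iff)
  then have km: "k < m" using shorts_zero[OF pvs, of k] by (metis not_le)
  let ?a = "push i v k" and ?b = "push i x k"
  define y where "y l = ?a * x l - ?b * v l" for l
  have y0: "y = (\<lambda>_. 0)"
  proof (rule ccontr)
    assume ne: "y \<noteq> (\<lambda>_. 0)"
    \<comment> \<open>The combination may be longer than \<open>q\<close>, so its own length serves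
      as the bound.\<close>
    have ys: "y \<in> shorts (Suc m) (nat (\<Sum>l<Suc m. max 0 (y l)))"
    proof -
      have "(\<Sum>l<Suc m. y l) = ?a * (\<Sum>l<Suc m. x l) - ?b * (\<Sum>l<Suc m. v l)"
        unfolding y_def sum_subtractf sum_distrib_left ..
      moreover have "(\<Sum>l<Suc m. x l) = 0" "(\<Sum>l<Suc m. v l) = 0"
        using x(1) v(1) unfolding shorts_def by blast+
      ultimately have "(\<Sum>l<Suc m. y l) = 0" by (simp only: mult_zero_right diff_self)
      moreover have "y l = 0" if "Suc m \<le> l" for l
        unfolding y_def shorts_zero[OF x(1) that] shorts_zero[OF v(1) that] by simp
      moreover have "0 \<le> (\<Sum>l<Suc m. max 0 (y l))" by (rule sum_nonneg) simp
      ultimately show ?thesis unfolding shorts_def by simp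
    qed
    have "ip (Suc m) y t = real_of_int ?a * ip (Suc m) x t - real_of_int ?b * ip (Suc m) v t"
      unfolding ip_def sum_distrib_left sum_subtractf[symmetric] y_def
      by (rule sum.cong) (auto simp: algebra_simps)
    then have yt: "ip (Suc m) y t = 0" using x(2) v(3) by simp
    have "push i y \<noteq> (\<lambda>_. 0)" by (rule push_nonzero[OF ys ne yt t i])
    moreover have "push i y l = 0" for l
    proof (cases "l < m")
      case True
      have "push i y l = ?a * push i x l - ?b * push i v l" unfolding y_def by (rule push_linear)
      then show ?thesis using p True km by (simp add: parallel_def mult.commute)
    next
      case False
      then show ?thesis using shorts_zero[OF push_shorts[OF ys i], of l] by simp
    qed
    ultimately show False by auto
  qed
  have e: "?a * x l = ?b * v l" for l using fun_cong[OF y0, of l] by (simp add: y_def)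
  show ?thesis
    unfolding parallel_def
  proof (intro allI impI)
    fix j l
    have "?a * (v j * x l) = v j * (?b * v l)" using e[of l] by (simp add: mult.left_commute)
    also have "\<dots> = v l * (?a * x j)" using e[of j] by (simp add: mult.left_commute)
    finally have "?a * (v j * x l) = ?a * (v l * x j)" by (simp add: mult.left_commute)
    then show "v j * x l = v l * x j" using k by simp
  qed
qed

text \<open>The cross product of the two vectors is a multiple of \<open>(g, h, k)\<close>, and its
  component at \<open>g > 0\<close> vanishes.\<close>

lemma cross_product_parallel:
  fixes a b c a' b' c' g h k :: real
  assumes "a * g + b * h + c * k = 0" "a' * g + b' * h + c' * k = 0" "0 < g"
    and "b * c' = c * b'"
  shows "a * b' = b * a'" "a * c' = c * a'"
proof -
  have "g * (a * b' - b * a') = (a * g) * b' - b * (a' * g)" by (simp add: algebra_simps)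
  also have "a * g = - (b * h + c * k)" using assms(1) by linarith
  also have "a' * g = - (b' * h + c' * k)" using assms(2) by linarith
  also have "- (b * h + c * k) * b' - b * - (b' * h + c' * k) = k * (b * c' - c * b')" by (simp add: algebra_simps)
  finally have "g * (a * b' - b * a') = 0" using assms(4) by simp
  then show "a * b' = b * a'" using assms(3) by simp
  have "g * (a * c' - c * a') = (a * g) * c' - c * (a' * g)" by (simp add: algebra_simps)
  also have "a * g = - (b * h + c * k)" using assms(1) by linarith
  also have "a' * g = - (b' * h + c' * k)" using assms(2) by linarith
  also have "- (b * h + c * k) * c' - c * - (b' * h + c' * k) = h * (c * b' - b * c')" by (simp add: algebra_simps)
  finally have "g * (a * c' - c * a') = 0" using assms(4) by simp
  then show "a * c' = c * a'" using assms(3) by simp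
qed

text \<open>Two independent relations determine a four letter alphabet up to an affine map, so the vector
  provided by \<open>integer_ray\<close> is itself a model.\<close>

lemma four_letters_rigid:
  assumes q: "1 \<le> q" and t: "sinc 4 t"
    and v: "v \<in> shorts 4 q" "ip 4 v t = 0" and x: "x \<in> shorts 4 q" "ip 4 x t = 0"
    and np: "\<not> parallel 4 v x"
  shows "has_model 4 q t (int q ^ 2)"
proof -
  have gaps: "ip 4 y z = real_of_int (y 1 + y 2 + y 3) * (z 1 - z 0) + real_of_int (y 2 + y 3) * (z 2 - z 1)
     + real_of_int (y 3) * (z 3 - z 2)" if "y \<in> shorts 4 q" for y z
  proof -
    have e: "y 0 = - y 1 - y 2 - y 3" using shorts_4D(1)[OF that] by linarith
    show ?thesis unfolding ip_4 e by (simp add: algebra_simps)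
  qed
  \<comment> \<open>Two independent relations leave a flat of dimension two, constants included, so
    closing gap 0 reduces it to constants. Hence the zero tuple, of diameter 0, is generic on the
    facet.\<close>
  have "generic_on_facet 4 q t 0 (\<lambda>_. 0)"
    unfolding generic_on_facet_def
  proof (intro conjI ballI impI)
    show "(\<lambda>_. 0) \<in> flat 4 q t" by (simp add: flat_def ip_def)
    fix y z assume y: "y \<in> shorts 4 q" and z: "z \<in> flat 4 q t" and z0: "z 0 = z (Suc 0)"
    have vz: "real_of_int (v 2 + v 3) * (z 2 - z 1) + real_of_int (v 3) * (z 3 - z 2) = 0"
      using gaps[OF v(1), of z] z v z0 by (simp add: flat_def)
    have xz: "real_of_int (x 2 + x 3) * (z 2 - z 1) + real_of_int (x 3) * (z 3 - z 2) = 0"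
      using gaps[OF x(1), of z] z x z0 by (simp add: flat_def)
    have flatz: "z 2 - z 1 = 0 \<and> z 3 - z 2 = 0"
    proof (rule ccontr)
      assume nz: "\<not> ?thesis"
      define D where "D = real_of_int (v 2 + v 3) * real_of_int (x 3) - real_of_int (v 3) * real_of_int (x 2 + x 3)"
      have "D * (z 2 - z 1) = real_of_int (x 3) * (real_of_int (v 2 + v 3) * (z 2 - z 1) + real_of_int (v 3) * (z 3 - z 2))
          - real_of_int (v 3) * (real_of_int (x 2 + x 3) * (z 2 - z 1) + real_of_int (x 3) * (z 3 - z 2))"
        unfolding D_def by (simp add: algebra_simps)
      then have 1: "D * (z 2 - z 1) = 0" unfolding vz xz by simp
      have "D * (z 3 - z 2) = real_of_int (v 2 + v 3) * (real_of_int (x 2 + x 3) * (z 2 - z 1) + real_of_int (x 3) * (z 3 - z 2))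
          - real_of_int (x 2 + x 3) * (real_of_int (v 2 + v 3) * (z 2 - z 1) + real_of_int (v 3) * (z 3 - z 2))"
        unfolding D_def by (simp add: algebra_simps)
      then have 2: "D * (z 3 - z 2) = 0" unfolding vz xz by simp
      have D0: "real_of_int (v 2 + v 3) * real_of_int (x 3) = real_of_int (v 3) * real_of_int (x 2 + x 3)"
        using 1 2 nz unfolding D_def by auto
      have g: "0 < t 1 - t 0" using t by (simp add: sinc_def)
      note cp = cross_product_parallel[OF v(2)[unfolded gaps[OF v(1)]] x(2)[unfolded gaps[OF x(1)]] g D0]
      have i0: "real_of_int ((v 2 + v 3) * x 3) = real_of_int (v 3 * (x 2 + x 3))" using D0 by simp
      have i1: "real_of_int ((v 1 + v 2 + v 3) * (x 2 + x 3)) = real_of_int ((v 2 + v 3) * (x 1 + x 2 + x 3))" using cp(1) by simp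
      have i2: "real_of_int ((v 1 + v 2 + v 3) * x 3) = real_of_int (v 3 * (x 1 + x 2 + x 3))" using cp(2) by simp
      have e0: "(v 2 + v 3) * x 3 = v 3 * (x 2 + x 3)" using i0 by (simp only: of_int_eq_iff)
      have e1: "(v 1 + v 2 + v 3) * (x 2 + x 3) = (v 2 + v 3) * (x 1 + x 2 + x 3)" using i1 by (simp only: of_int_eq_iff)
      have e2: "(v 1 + v 2 + v 3) * x 3 = v 3 * (x 1 + x 2 + x 3)" using i2 by (simp only: of_int_eq_iff)
      have f23: "v 2 * x 3 = v 3 * x 2" using e0 by (simp add: algebra_simps)
      have f13: "v 1 * x 3 = v 3 * x 1" using e2 f23 by (simp add: algebra_simps)
      have f12: "v 1 * x 2 = v 2 * x 1" using e1 f23 f13 by (simp add: algebra_simps)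
      have s: "v 0 = - v 1 - v 2 - v 3" "x 0 = - x 1 - x 2 - x 3"
        using shorts_4D(1)[OF v(1)] shorts_4D(1)[OF x(1)] by linarith+
      have f01: "v 0 * x 1 = v 1 * x 0" unfolding s using f12 f13 by (simp add: algebra_simps)
      have f02: "v 0 * x 2 = v 2 * x 0" unfolding s using f12 f23 by (simp add: algebra_simps)
      have f03: "v 0 * x 3 = v 3 * x 0" unfolding s using f13 f23 by (simp add: algebra_simps)
      have "parallel 4 v x"
        unfolding parallel_def
      proof (intro allI impI)
        fix i j :: nat assume "i < 4" "j < 4"
        then have "i = 0 \<or> i = 1 \<or> i = 2 \<or> i = 3" "j = 0 \<or> j = 1 \<or> j = 2 \<or> j = 3" by linarith+
        then show "v i * x j = v j * x i"
          by (elim disjE) (simp_all only: f01 f02 f03 f12 f13 f23)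
      qed
      then show False using np by simp
    qed
    show "ip 4 y z = 0" unfolding gaps[OF y] using flatz z0 by simp
  qed simp_all
  moreover have "has_model 4 q (\<lambda>_. 0) 0"
    unfolding has_model_def models_def winc_def by (intro exI[of _ "\<lambda>_. 0"]) (simp add: ip_def)
  ultimately have "has_model 4 q t (0 + int q ^ 2)"
    by (intro model_from_facet[OF _ q t order_refl]) auto
  then show ?thesis by simp
qed

subsection \<open>Five letters\<close>

text \<open>Here gap \<open>i\<close> is prescribed. A point \<open>z\<close> whose coincidences are
  all forced by closing gap \<open>i\<close> is perturbed by a small generic vector of the facet;
  this keeps the open gaps open and removes accidental relations.\<close>

lemma generic_facet_at:
  assumes q: "1 \<le> q" and i: "Suc i < m" and z: "z \<in> flat m q t" "winc m z" "z i = z (Suc i)"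
    and zg: "\<And>j w. Suc j < m \<Longrightarrow> z j = z (Suc j) \<Longrightarrow> w \<in> flat m q t \<Longrightarrow> w i = w (Suc i) \<Longrightarrow> w j = w (Suc j)"
  obtains t' where "generic_on_facet m q t i t'" "winc m t'"
    "\<And>j. Suc j < m \<Longrightarrow> z j < z (Suc j) \<Longrightarrow> t' j < t' (Suc j)"
    "\<And>j. Suc j < m \<Longrightarrow> z j = z (Suc j) \<Longrightarrow> t' j = t' (Suc j)"
proof -
  define W where "W = {w \<in> flat m q t. w i = w (Suc i)}"
  define F where "F = {ip m x | x. x \<in> shorts m q \<and> (\<exists>w\<in>W. ip m x w \<noteq> 0)}"
  have "F \<subseteq> ip m ` shorts m q" by (auto simp: F_def)
  then have finF: "finite F" by (rule finite_subset) (use finite_shorts in auto)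
  have "\<exists>w\<in>W. \<forall>f\<in>F. f w \<noteq> 0"
  proof (rule avoid_hyperplanes[OF finF])
    show "(\<lambda>i. y i + e * z i) \<in> W" if "y \<in> W" "z \<in> W" for y z e
      using that flat_closed[of y m q t z e] by (simp add: W_def)
    show "z \<in> W" using z by (simp add: W_def)
    show "linfun f" if "f \<in> F" for f
      using that by (auto simp: F_def linfun_def ip_add ip_scale)
    show "\<exists>w\<in>W. f w \<noteq> 0" if "f \<in> F" for f using that by (auto simp: F_def)
  qed
  then obtain w where w: "w \<in> W" "\<And>f. f \<in> F \<Longrightarrow> f w \<noteq> 0" by blast
  obtain e :: real where e: "0 < e" "\<And>x. x \<in> shorts m q \<Longrightarrow> ip m x z \<noteq> 0 \<Longrightarrow> 0 < ip m x z * (ip m x z + e * ip m x w)"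
    using small_positive[of "shorts m q" "\<lambda>x. ip m x z" "\<lambda>x. ip m x w"] finite_shorts by auto
  define t' where "t' = (\<lambda>j. z j + e * w j)"
  have ipt': "ip m x t' = ip m x z + e * ip m x w" for x by (simp add: t'_def ip_add ip_scale)
  have wW: "w \<in> flat m q t" "w i = w (Suc i)" using w(1) by (auto simp: W_def)
  have pos: "t' j < t' (Suc j)" if j: "Suc j < m" "z j < z (Suc j)" for j
  proof -
    have "0 < ip m (gap j) z" using j by (simp add: ip_gap)
    moreover have "0 < ip m (gap j) z * ip m (gap j) t'"
      using e(2)[OF gap_shorts[OF j(1) q]] calculation unfolding ipt' by simp
    ultimately have "0 < ip m (gap j) t'" by (simp add: zero_less_mult_iff)
    then show ?thesis using j(1) by (simp add: ip_gap)
  qed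
  have zer: "t' j = t' (Suc j)" if j: "Suc j < m" "z j = z (Suc j)" for j
    using zg[OF j wW] j(2) by (simp add: t'_def)
  show thesis
  proof (rule that)
    show "generic_on_facet m q t i t'"
      unfolding generic_on_facet_def
    proof (intro conjI ballI impI)
      show "Suc i < m" by fact
      show "t' \<in> flat m q t" unfolding t'_def by (rule flat_closed[OF z(1) wW(1)])
      show "t' i = t' (Suc i)" using zer[OF i z(3)] .
      fix x y assume x: "x \<in> shorts m q" "ip m x t' = 0" and y: "y \<in> flat m q t" "y i = y (Suc i)"
      have "ip m x z = 0"
      proof (rule ccontr)
        assume "ip m x z \<noteq> 0"
        then have "0 < ip m x z * ip m x t'" using e(2)[OF x(1)] unfolding ipt' by simp
        then show False using x(2) by simp
      qed
      then have "ip m x w = 0" using x(2) e(1) unfolding ipt' by simp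
      then have "ip m x \<notin> F" using w(2) by blast
      then show "ip m x y = 0" using x(1) y unfolding F_def W_def by blast
    qed
    show "winc m t'"
      unfolding winc_def
    proof (intro allI impI)
      fix j assume j: "Suc j < m"
      have "z j \<le> z (Suc j)" using z(2) j by (simp add: winc_def)
      then have "z j < z (Suc j) \<or> z j = z (Suc j)" by auto
      then show "t' j \<le> t' (Suc j)" using pos[OF j] zer[OF j] by auto
    qed
    show "t' j < t' (Suc j)" if "Suc j < m" "z j < z (Suc j)" for j by (rule pos[OF that])
    show "t' j = t' (Suc j)" if "Suc j < m" "z j = z (Suc j)" for j by (rule zer[OF that])
  qed
qed

lemma sinc_unsquash:
  assumes i: "Suc i < Suc m" and eq: "t' i = t' (Suc i)" and s: "\<And>j. Suc j < Suc m \<Longrightarrow> j \<noteq> i \<Longrightarrow> t' j < t' (Suc j)"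
  shows "sinc m (\<lambda>j. t' (unsquash i j))"
  unfolding sinc_def
proof (intro allI impI)
  fix j assume j: "Suc j < m"
  consider "Suc j \<le> i" | "j = i" | "i < j" by linarith
  then show "t' (unsquash i j) < t' (unsquash i (Suc j))"
  proof cases
    case 1 then show ?thesis using s[of j] j by (simp add: unsquash_def)
  next
    case 2 then show ?thesis using s[of "Suc j"] j eq by (simp add: unsquash_def)
  next
    case 3 then show ?thesis using s[of "Suc j"] j by (simp add: unsquash_def)
  qed
qed

definition only_relation :: "nat \<Rightarrow> nat \<Rightarrow> (nat \<Rightarrow> real) \<Rightarrow> (nat \<Rightarrow> int) \<Rightarrow> bool" where
  "only_relation m q t v \<longleftrightarrow> v \<in> shorts m q \<and> v \<noteq> (\<lambda>_. 0) \<and> ip m v t = 0 \<and>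
     (\<forall>x\<in>shorts m q. ip m x t = 0 \<longrightarrow> parallel m v x)"

lemma only_relation_transfer:
  assumes v: "only_relation m q t v" and x: "x \<in> shorts m q" "ip m x t = 0" and y: "ip m v y = 0"
  shows "ip m x y = 0"
proof -
  have vs: "v \<in> shorts m q" "v \<noteq> (\<lambda>_. 0)" and p: "parallel m v x" using v x by (auto simp: only_relation_def)
  obtain i where i: "v i \<noteq> 0" using vs(2) by (auto simp: fun_eq_iff)
  then have im: "i < m" using shorts_zero[OF vs(1), of i] by (metis not_le)
  have "real_of_int (v i) * ip m x y = 0" using parallel_ip[OF p im, of y] y by simp
  then show ?thesis using i by simp
qed

lemma flat_only_relation:
  assumes v: "only_relation m q t v"
  shows "z \<in> flat m q t \<longleftrightarrow> ip m v z = 0"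
proof
  assume "z \<in> flat m q t"
  then show "ip m v z = 0" using v unfolding flat_def only_relation_def by blast
next
  assume "ip m v z = 0"
  then show "z \<in> flat m q t" using only_relation_transfer[OF v] unfolding flat_def by blast
qed

text \<open>Every short relation of \<open>t\<close> is a multiple of \<open>v\<close>, so
  \<open>s\<close> inherits all of them from \<open>v\<close> alone.\<close>

lemma explicit_model:
  assumes v: "only_relation m q t v" and s: "winc m s" "ip m v (\<lambda>i. real_of_int (s i)) = 0"
    and x: "\<And>x. x \<in> shorts m q \<Longrightarrow> ip m x (\<lambda>i. real_of_int (s i)) = 0 \<Longrightarrow> ip m x t = 0"
    and D: "s (m - 1) - s 0 \<le> D"
  shows "has_model m q t D"
  unfolding has_model_def models_def using only_relation_transfer[OF v _ _ s(2)] s(1) x D by blast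

text \<open>The vector \<open>z\<close> certifies that gap \<open>i\<close> can be closed with the
  others open, so the facet has four distinct letters. A relation of length at most
  \<open>p < q\<close> there gives diameter \<open>q + p * q \<le> q^2\<close>, and the ray adds
  \<open>q^3\<close>.\<close>

lemma facet_reduction:
  assumes q: "2 \<le> q" and t: "sinc 5 t" and v: "only_relation 5 q t v" and i: "i < 4"
    and z: "ip 5 v z = 0" "z i = z (Suc i)" "\<And>j. j < 4 \<Longrightarrow> j \<noteq> i \<Longrightarrow> z j < z (Suc j)"
    and w: "w \<in> shorts 4 p" "w \<noteq> (\<lambda>_. 0)" "p < q"
      "\<And>y. y i = y (Suc i) \<Longrightarrow> ip 5 v y = 0 \<Longrightarrow> ip 4 w (\<lambda>j. y (unsquash i j)) = 0"
  shows "has_model 5 q t (int q ^ 3 + int q ^ 2)"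
proof -
  have i5: "Suc i < 5" "Suc i < Suc 4" and q1: "1 \<le> q" using i q by auto
  have zf: "z \<in> flat 5 q t" using flat_only_relation[OF v] z(1) by simp
  have zw: "winc 5 z" unfolding winc_def
  proof (intro allI impI)
    fix j :: nat assume "Suc j < 5"
    then show "z j \<le> z (Suc j)" using z(2) z(3)[of j] by (cases "j = i") (auto simp: less_imp_le)
  qed
  have zg: "w j = w (Suc j)" if "Suc j < 5" "z j = z (Suc j)" "w i = w (Suc i)" for j and w :: "nat \<Rightarrow> real"
  proof -
    have "j = i" using z(3)[of j] that by (cases "j = i") auto
    then show ?thesis using that by simp
  qed
  obtain t' where t': "generic_on_facet 5 q t i t'" "winc 5 t'"
    "\<And>j. Suc j < 5 \<Longrightarrow> z j < z (Suc j) \<Longrightarrow> t' j < t' (Suc j)"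
    using generic_facet_at[OF q1 i5(1) zf zw z(2)] zg by metis
  have eq: "t' i = t' (Suc i)" and fl: "t' \<in> flat 5 q t" using t'(1) by (auto simp: generic_on_facet_def)
  have "sinc 4 (\<lambda>j. t' (unsquash i j))"
    by (rule sinc_unsquash[OF i5(2) eq]) (use t'(3) z(3) in auto)
  moreover have "ip 4 w (\<lambda>j. t' (unsquash i j)) = 0"
    by (rule w(4)[OF eq]) (use fl flat_only_relation[OF v] in simp)
  ultimately have "has_model 4 q (\<lambda>j. t' (unsquash i j)) (int q + int p * int q)"
    using four_letters_related[OF q1 _ _ w(1,2)] w(3) by simp
  moreover have "int q + int p * int q \<le> int q ^ 2"
  proof -
    have "(int p + 1) * int q \<le> int q * int q" by (rule mult_right_mono) (use w(3) in auto)
    then show ?thesis by (simp add: algebra_simps power2_eq_square)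
  qed
  ultimately have m4: "has_model 4 q (\<lambda>j. t' (unsquash i j)) (int q ^ 2)" by (rule has_model_mono)
  have "has_model (Suc 4) q t (int q ^ 2 + int q ^ 3)"
    by (rule model_from_collapse[OF q1 _ _ order_refl _ _ m4]) (use t t'(1) in auto)
  then show ?thesis by (simp add: add.commute)
qed

lemma all_less_4: "(\<forall>j<4. P j) \<longleftrightarrow> P 0 \<and> P 1 \<and> P 2 \<and> P (3::nat)"
  by (auto simp: eval_nat_numeral less_Suc_eq)

lemma ip_5_gaps:
  assumes "v \<in> shorts 5 q"
  shows "ip 5 v y = real_of_int (v 1 + v 2 + v 3 + v 4) * (y 1 - y 0) + real_of_int (v 2 + v 3 + v 4) * (y 2 - y 1)
     + real_of_int (v 3 + v 4) * (y 3 - y 2) + real_of_int (v 4) * (y 4 - y 3)"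
proof -
  have e: "v 0 = - v 1 - v 2 - v 3 - v 4" using shorts_5D(1)[OF assms] by linarith
  show ?thesis unfolding ip_5 e by (simp add: algebra_simps)
qed

text \<open>Positive entries are weighted by the total \<open>N\<close> of the negative ones and
  conversely; zero entries get weight 1.\<close>

lemma mixed_weights:
  assumes "mixed3 a b c"
  obtains x y z :: real where "0 < x" "0 < y" "0 < z" "real_of_int a * x + real_of_int b * y + real_of_int c * z = 0"
proof -
  define P where "P = max 0 a + max 0 b + max 0 c"
  define N where "N = max 0 (- a) + max 0 (- b) + max 0 (- c)"
  define f where "f u = (if 0 < u then N else if u < 0 then P else 1)" for u :: int
  have PN: "0 < P" "0 < N" using assms unfolding mixed3_def P_def N_def by linarith+
  have fp: "0 < f u" for u using PN by (simp add: f_def)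
  have fe: "u * f u = N * max 0 u - P * max 0 (- u)" for u
  proof -
    consider "0 < u" | "u < 0" | "u = 0" by linarith
    then show ?thesis by cases (simp_all add: f_def mult.commute)
  qed
  have "a * f a + b * f b + c * f c = N * (max 0 a + max 0 b + max 0 c) - P * (max 0 (- a) + max 0 (- b) + max 0 (- c))"
    unfolding fe by (simp only: distrib_left)
  then have "a * f a + b * f b + c * f c = 0" by (simp only: P_def[symmetric] N_def[symmetric] mult.commute[of P N] diff_self)
  then have "real_of_int (a * f a + b * f b + c * f c) = 0" by (simp only: of_int_0)
  then show thesis using that[of "real_of_int (f a)" "real_of_int (f b)" "real_of_int (f c)"] fp by simp
qed

lemma sum_max_push_less:
  fixes x :: "nat \<Rightarrow> int"
  assumes "Suc i < Suc m" "x i * x (Suc i) < 0"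
  shows "(\<Sum>j<m. max 0 (push i x j)) + 1 \<le> (\<Sum>j<Suc m. max 0 (x j))"
  using assms(1)
proof (induction m)
  case (Suc m)
  show ?case
  proof (cases "i = m")
    case True
    have "(\<Sum>j<m. max 0 (push i x j)) = (\<Sum>j<m. max 0 (x j))"
      by (rule sum.cong) (use True in \<open>auto simp: push_def\<close>)
    moreover have "max 0 (x i + x (Suc i)) + 1 \<le> max 0 (x i) + max 0 (x (Suc i))"
      using assms(2) by (auto simp: mult_less_0_iff)
    ultimately show ?thesis using True by (simp add: push_def)
  next
    case False
    then show ?thesis using Suc by (simp add: push_def)
  qed
qed simp

lemma push_shorts_less:
  assumes x: "x \<in> shorts (Suc m) q" and i: "Suc i < Suc m" and neg: "x i * x (Suc i) < 0"
  shows "push i x \<in> shorts m (q - 1)"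
proof -
  have p: "push i x \<in> shorts m q" by (rule push_shorts[OF x i])
  have le: "(\<Sum>j<m. max 0 (push i x j)) + 1 \<le> (\<Sum>j<Suc m. max 0 (x j))" by (rule sum_max_push_less[OF i neg])
  have x': "(\<Sum>j<Suc m. max 0 (x j)) \<le> int q" using x unfolding shorts_def by blast
  have "0 \<le> (\<Sum>j<m. max 0 (push i x j))" by (rule sum_nonneg) simp
  then have "(\<Sum>j<m. max 0 (push i x j)) \<le> int (q - 1)" using le x' by linarith
  then show ?thesis using p unfolding shorts_def by blast
qed

lemma reducible_at:
  assumes q: "2 \<le> q" and t: "sinc 5 t" and v: "only_relation 5 q t v" and i: "i < 4"
    and z: "ip 5 v z = 0" "z i = z (Suc i)" "\<And>j. j < 4 \<Longrightarrow> j \<noteq> i \<Longrightarrow> z j < z (Suc j)"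
    and neg: "v i * v (Suc i) < 0"
  shows "has_model 5 q t (int q ^ 3 + int q ^ 2)"
proof (rule facet_reduction[OF q t v i z])
  have i': "Suc i < Suc 4" using i by simp
  have vs: "v \<in> shorts (Suc 4) q" "v \<noteq> (\<lambda>_. 0)" "ip (Suc 4) v t = 0" using v by (auto simp: only_relation_def)
  show "push i v \<in> shorts 4 (q - 1)" by (rule push_shorts_less[OF vs(1) i' neg])
  show "push i v \<noteq> (\<lambda>_. 0)" by (rule push_nonzero[OF vs _ i']) (use t in simp)
  show "q - 1 < q" using q by simp
  show "ip 4 (push i v) (\<lambda>j. y (unsquash i j)) = 0" if "y i = y (Suc i)" "ip 5 v y = 0" for y
    using that(2) squash_unsquash[of y, OF that(1)] by (simp add: ip_push[OF i'])
qed auto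

lemma reducible_model:
  assumes q: "2 \<le> q" and t: "sinc 5 t" and v: "only_relation 5 q t v"
    and c: "c1 = v 1 + v 2 + v 3 + v 4" "c2 = v 2 + v 3 + v 4" "c3 = v 3 + v 4" "c4 = v 4"
    and red: "mixed3 c2 c3 c4 \<and> peak 0 c1 c2 \<or> mixed3 c1 c3 c4 \<and> peak c1 c2 c3 \<or>
      mixed3 c1 c2 c4 \<and> peak c2 c3 c4 \<or> mixed3 c1 c2 c3 \<and> peak c3 c4 0"
  shows "has_model 5 q t (int q ^ 3 + int q ^ 2)"
proof -
  have vs: "v \<in> shorts 5 q" using v by (simp add: only_relation_def)
  have vc: "v 0 = - c1" "v 1 = c1 - c2" "v 2 = c2 - c3" "v 3 = c3 - c4" "v 4 = c4"
    using c shorts_5D(1)[OF vs] by linarith+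
  note g = ip_5_gaps[OF vs, folded c]
  \<comment> \<open>The coefficients of \<open>v\<close> are differences of consecutive gap
    coefficients, so an extremum at a gap is a sign change between the two letters that are merged
    when it closes.\<close>
  have pk: "(a - b) * (b - d) < 0" if "peak a b d" for a b d using that by (auto simp: peak_def mult_less_0_iff)
  from red show ?thesis
  proof (elim disjE conjE)
    assume m: "mixed3 c2 c3 c4" and p: "peak 0 c1 c2"
    obtain x y w :: real where h: "0 < x" "0 < y" "0 < w" "real_of_int c2 * x + real_of_int c3 * y + real_of_int c4 * w = 0"
      using mixed_weights[OF m] by blast
    let ?z = "\<lambda>j. [0, 0, x, x + y, x + y + w] ! j"
    have "\<forall>j<4. j \<noteq> 0 \<longrightarrow> ?z j < ?z (Suc j)" unfolding all_less_4 using h by simp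
    moreover have "ip 5 v ?z = 0" unfolding g using h(4) by simp
    ultimately show ?thesis using reducible_at[OF q t v, of 0 ?z] pk[OF p] vc by simp
  next
    assume m: "mixed3 c1 c3 c4" and p: "peak c1 c2 c3"
    obtain x y w :: real where h: "0 < x" "0 < y" "0 < w" "real_of_int c1 * x + real_of_int c3 * y + real_of_int c4 * w = 0"
      using mixed_weights[OF m] by blast
    let ?z = "\<lambda>j. [0, x, x, x + y, x + y + w] ! j"
    have "\<forall>j<4. j \<noteq> 1 \<longrightarrow> ?z j < ?z (Suc j)" unfolding all_less_4 using h by simp
    moreover have "ip 5 v ?z = 0" unfolding g using h(4) by simp
    ultimately show ?thesis using reducible_at[OF q t v, of 1 ?z] pk[OF p] vc by (simp add: numeral_2_eq_2)
  next
    assume m: "mixed3 c1 c2 c4" and p: "peak c2 c3 c4"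
    obtain x y w :: real where h: "0 < x" "0 < y" "0 < w" "real_of_int c1 * x + real_of_int c2 * y + real_of_int c4 * w = 0"
      using mixed_weights[OF m] by blast
    let ?z = "\<lambda>j. [0, x, x + y, x + y, x + y + w] ! j"
    have "\<forall>j<4. j \<noteq> 2 \<longrightarrow> ?z j < ?z (Suc j)" unfolding all_less_4 using h by simp
    moreover have "ip 5 v ?z = 0" unfolding g using h(4) by simp
    ultimately show ?thesis using reducible_at[OF q t v, of 2 ?z] pk[OF p] vc by simp
  next
    assume m: "mixed3 c1 c2 c3" and p: "peak c3 c4 0"
    obtain x y w :: real where h: "0 < x" "0 < y" "0 < w" "real_of_int c1 * x + real_of_int c2 * y + real_of_int c3 * w = 0"
      using mixed_weights[OF m] by blast
    let ?z = "\<lambda>j. [0, x, x + y, x + y + w, x + y + w] ! j"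
    have "\<forall>j<4. j \<noteq> 3 \<longrightarrow> ?z j < ?z (Suc j)" unfolding all_less_4 using h by simp
    moreover have "ip 5 v ?z = 0" unfolding g using h(4) by simp
    ultimately show ?thesis using reducible_at[OF q t v, of 3 ?z] pk[OF p] vc by simp
  qed
qed

text \<open>Closing gap \<open>a\<close> forces gap \<open>b\<close> to close as well, so the facet
  has at most three distinct letters and a model of diameter \<open>q + 1\<close>.\<close>

lemma two_free_gaps_model:
  assumes q: "2 \<le> q" and t: "sinc 5 t" and v: "only_relation 5 q t v" and ab: "a < 4" "b < 4" "a \<noteq> b"
    and e: "\<And>y. ip 5 v y = real_of_int ca * (y (Suc a) - y a) + real_of_int cb * (y (Suc b) - y b)" and cb: "cb \<noteq> 0"
  shows "has_model 5 q t (int q ^ 3 + int q ^ 2)"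
proof -
  have q1: "1 \<le> q" and a5: "Suc a < 5" "Suc a < Suc 4" using q ab by auto
  define z where "z j = real (\<Sum>l<j. if l = a \<or> l = b then 0 else 1)" for j
  have zS: "z (Suc j) = z j + (if j = a \<or> j = b then 0 else 1)" for j by (simp add: z_def)
  have "ip 5 v z = 0" unfolding e zS by simp
  then have zf: "z \<in> flat 5 q t" using flat_only_relation[OF v] by simp
  have zw: "winc 5 z" by (simp add: winc_def zS)
  have za: "z a = z (Suc a)" by (simp add: zS)
  have zg: "w j = w (Suc j)" if "z j = z (Suc j)" "w \<in> flat 5 q t" "w a = w (Suc a)" for j w
  proof -
    have "j = a \<or> j = b" using that(1) by (auto simp: zS split: if_splits)
    moreover have "w b = w (Suc b)" using that(2,3) cb flat_only_relation[OF v] e[of w] by simp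
    ultimately show ?thesis using that(3) by auto
  qed
  obtain t' where t': "generic_on_facet 5 q t a t'" "winc 5 t'"
    "\<And>j. Suc j < 5 \<Longrightarrow> z j = z (Suc j) \<Longrightarrow> t' j = t' (Suc j)"
    using generic_facet_at[OF q1 a5(1) zf zw za] zg by metis
  have tb: "t' b = t' (Suc b)" by (rule t'(3)) (use ab in \<open>simp_all add: zS\<close>)
  have ta: "t' a = t' (Suc a)" by (rule t'(3)) (use ab in \<open>simp_all add: zS\<close>)
  let ?u = "\<lambda>j. t' (unsquash a j)"
  have uw: "winc 4 ?u" by (rule winc_unsquash) (use t'(2) in simp)
  have "\<not> sinc 4 ?u"
  proof (cases "b < a")
    case True
    then have "?u b = ?u (Suc b)" using tb by (simp add: unsquash_def)
    moreover have "Suc b < 4" using True ab by simp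
    ultimately show ?thesis unfolding sinc_def by (metis less_irrefl)
  next
    case False
    then have ba: "a < b" using ab by simp
    then obtain b' where b': "b = Suc b'" by (metis less_imp_Suc_add)
    have "?u b' = t' b" using ba b' ta by (cases "a = b'") (auto simp: unsquash_def)
    moreover have "?u (Suc b') = t' (Suc b)" using ba b' by (simp add: unsquash_def)
    ultimately have "?u b' = ?u (Suc b')" using tb by simp
    moreover have "Suc b' < 4" using b' ab by simp
    ultimately show ?thesis unfolding sinc_def by (metis less_irrefl)
  qed
  then have u: "has_model 4 q ?u (int q + 1)" by (rule weak_four_letters[OF q1 bnd_3[OF q1 bnd_2] uw])
  have "has_model (Suc 4) q t (int q + 1 + int q ^ 3)"
    by (rule model_from_collapse[OF q1 _ _ order_refl _ _ u]) (use t t'(1) in auto)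
  moreover have "int q + 1 \<le> int q ^ 2"
  proof -
    have "2 * int q \<le> int q * int q" by (rule mult_right_mono) (use q in auto)
    then show ?thesis using q unfolding power2_eq_square by linarith
  qed
  ultimately show ?thesis using has_model_mono[of "Suc 4" q t] by simp
qed

section \<open>Explicit models for the tame patterns\<close>

lemma winc_5: "winc 5 s \<longleftrightarrow> s 0 \<le> s 1 \<and> s 1 \<le> s 2 \<and> s 2 \<le> s 3 \<and> s 3 \<le> s (4::nat)"
  unfolding winc_def all_gaps_5 by (simp add: eval_nat_numeral)

text \<open>The name lists the gap coefficients \<open>0, M, - a, - a\<close>. By the relation, the
  distances between letters 1, 2 and 4 are in the ratio \<open>a : M\<close>, so these letters are
  put at 1 plus multiples of \<open>w\<close>; letters 0 and 3 are shifted off this progression by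
  \<open>-1\<close> and \<open>q + 1\<close>. The factor \<open>w\<close> makes \<open>q * w\<close>
  equal to \<open>q^3 + q^2 - q\<close>.\<close>

lemma pattern_zero_M_a_a:
  assumes q: "2 \<le> q" and v: "only_relation 5 q t v" and M: "1 \<le> M" "1 \<le> a" "M + a = int q"
    and vv: "v 0 = 0" "v 1 = - M" "v 2 = int q" "v 3 = 0" "v 4 = - a"
  shows "has_model 5 q t (int q ^ 3 + int q ^ 2)"
proof -
  define Q where "Q = int q"
  define w where "w = Q\<^sup>2 + Q - 1"
  define s where "s = (\<lambda>j. [0, 1, 1 + a * w, 1 + a * w + (Q + 1), 1 + Q * w] ! j)"
  have sv: "s 0 = 0" "s 1 = 1" "s 2 = 1 + a * w" "s 3 = 1 + a * w + (Q + 1)" "s 4 = 1 + Q * w" by (simp_all add: s_def)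
  have Q: "2 \<le> Q" "Q = M + a" using q M by (simp_all add: Q_def)
  have QQ: "2 * Q \<le> Q * Q" by (rule mult_right_mono) (use Q in auto)
  have wQ: "Q + 1 \<le> w" using QQ Q(1) unfolding w_def power2_eq_square by linarith
  have Mw: "1 * w \<le> M * w" by (rule mult_right_mono) (use M wQ Q in auto)
  have aw: "0 \<le> a * w" using M wQ Q by simp
  have Qw: "Q * w = M * w + a * w" unfolding Q(2) by (simp add: distrib_right)
  show ?thesis
  proof (rule explicit_model[OF v, of s])
    show "winc 5 s" unfolding winc_5 sv using aw Qw Mw wQ Q(1) by linarith
    have "- M + Q * (1 + a * w) - a * (1 + Q * w) = 0" unfolding Q(2) by (simp add: algebra_simps)
    then show "ip 5 v (\<lambda>i. real_of_int (s i)) = 0"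
      unfolding ip_int_5 sv vv Q_def[symmetric] by (simp add: algebra_simps)
    have "Q * w = Q ^ 3 + Q ^ 2 - Q" by (simp add: w_def algebra_simps power2_eq_square power3_eq_cube)
    then show "s (5 - 1) - s 0 \<le> int q ^ 3 + int q ^ 2" using Q(1) by (simp add: sv Q_def)
    fix x assume x: "x \<in> shorts 5 q" "ip 5 x (\<lambda>i. real_of_int (s i)) = 0"
    have e: "x 1 + (1 + a * w) * x 2 + (1 + a * w + (Q + 1)) * x 3 + (1 + Q * w) * x 4 = 0"
      using x(2) unfolding ip_int_5 sv by (simp only: mult.commute mult_zero_left mult_1_left mult_zero_right mult_1_right add_0)
    have *: "x 0 = 0 \<and> x 3 = 0 \<and> a * x 2 + Q * x 4 = 0"
      by (rule letters_zero_M_a_a[OF Q(1) M(2) shorts_5D[OF x(1), folded Q_def] w_def e])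
    have x1: "x 1 = - x 2 - x 4" using shorts_5D(1)[OF x(1)] * by linarith
    \<comment> \<open>Given \<open>*\<close>, \<open>a * x\<close> is a multiple of
      \<open>v\<close>.\<close>
    have "real_of_int a * ip 5 x t = - real_of_int (x 4) * ip 5 v t + real_of_int (a * x 2 + Q * x 4) * (t 2 - t 1)"
      unfolding ip_5 vv Q_def[symmetric] x1 Q(2) using * by (simp add: algebra_simps)
    then have "real_of_int a * ip 5 x t = 0" using * v by (simp add: only_relation_def)
    then show "ip 5 x t = 0" using M by simp
  qed
qed

lemma pattern_M_M_a_a:
  assumes q: "2 \<le> q" and v: "only_relation 5 q t v" and M: "1 \<le> M" "1 \<le> a" "M + a = int q"
    and vv: "v 0 = - M" "v 1 = 0" "v 2 = int q" "v 3 = 0" "v 4 = - a"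
  shows "has_model 5 q t (int q ^ 3 + int q ^ 2)"
proof -
  define Q where "Q = int q"
  define w where "w = Q\<^sup>2 + Q - 1"
  define s where "s = (\<lambda>j. [0, 1, a * w, Q * w - (Q + 1), Q * w] ! j)"
  have sv: "s 0 = 0" "s 1 = 1" "s 2 = a * w" "s 3 = Q * w - (Q + 1)" "s 4 = Q * w" by (simp_all add: s_def)
  have Q: "2 \<le> Q" "Q = M + a" using q M by (simp_all add: Q_def)
  have QQ: "2 * Q \<le> Q * Q" by (rule mult_right_mono) (use Q in auto)
  have wQ: "Q + 1 \<le> w" using QQ Q(1) unfolding w_def power2_eq_square by linarith
  have Mw: "1 * w \<le> M * w" by (rule mult_right_mono) (use M wQ Q in auto)
  have aw: "1 * w \<le> a * w" by (rule mult_right_mono) (use M wQ Q in auto)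
  have Qw: "Q * w = M * w + a * w" unfolding Q(2) by (simp add: distrib_right)
  show ?thesis
  proof (rule explicit_model[OF v, of s])
    show "winc 5 s" unfolding winc_5 sv using aw Qw Mw wQ Q(1) by linarith
    show "ip 5 v (\<lambda>i. real_of_int (s i)) = 0"
      unfolding ip_int_5 sv vv Q_def[symmetric] by (simp add: algebra_simps)
    have "Q * w = Q ^ 3 + Q ^ 2 - Q" by (simp add: w_def algebra_simps power2_eq_square power3_eq_cube)
    then show "s (5 - 1) - s 0 \<le> int q ^ 3 + int q ^ 2" using Q(1) by (simp add: sv Q_def)
    fix x assume x: "x \<in> shorts 5 q" "ip 5 x (\<lambda>i. real_of_int (s i)) = 0"
    have e: "x 1 + a * w * x 2 + (Q * w - (Q + 1)) * x 3 + Q * w * x 4 = 0"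
      using x(2) unfolding ip_int_5 sv by (simp add: mult.commute)
    have *: "x 1 = 0 \<and> x 3 = 0 \<and> a * x 2 + Q * x 4 = 0"
      by (rule letters_M_M_a_a[OF Q(1) M(2) shorts_5D[OF x(1), folded Q_def] w_def e])
    have x0: "x 0 = - x 2 - x 4" using shorts_5D(1)[OF x(1)] * by linarith
    have "real_of_int a * ip 5 x t = - real_of_int (x 4) * ip 5 v t + real_of_int (a * x 2 + Q * x 4) * (t 2 - t 0)"
      unfolding ip_5 vv Q_def[symmetric] x0 Q(2) using * by (simp add: algebra_simps)
    then have "real_of_int a * ip 5 x t = 0" using * v by (simp add: only_relation_def)
    then show "ip 5 x t = 0" using M by simp
  qed
qed

text \<open>If \<open>x4 \<ge> 2\<close>, the top letter contributes at least \<open>2 * s4\<close>,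
  while the negative coefficients take away at most \<open>q * s3\<close>.\<close>

lemma top_coefficient_le_1:
  fixes x0 x1 x2 x3 x4 s1 s2 s3 s4 q :: int
  assumes x: "x0 + x1 + x2 + x3 + x4 = 0" "max 0 x0 + max 0 x1 + max 0 x2 + max 0 x3 + max 0 x4 \<le> q"
    and s: "0 \<le> s1" "s1 \<le> s3" "0 \<le> s2" "s2 \<le> s3" "q * s3 < 2 * s4" "0 \<le> s4"
    and e: "s1 * x1 + s2 * x2 + s3 * x3 + s4 * x4 = 0"
  shows "x4 \<le> 1"
proof (rule ccontr)
  assume "\<not> x4 \<le> 1"
  then have x4: "2 \<le> x4" by simp
  from x(2) obtain p0 p1 p2 p3 p4 where p: "0 \<le> p0" "x0 \<le> p0" "0 \<le> p1" "x1 \<le> p1" "0 \<le> p2" "x2 \<le> p2"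
    "0 \<le> p3" "x3 \<le> p3" "0 \<le> p4" "x4 \<le> p4" "p0 + p1 + p2 + p3 + p4 \<le> q" by (rule max_sum_witness5)
  have neg: "- (s3 * (p - y)) \<le> s * y" if "0 \<le> s" "s \<le> s3" "0 \<le> p" "y \<le> p" for s y p
  proof -
    have "s * (p - y) \<le> s3 * (p - y)" by (rule mult_right_mono) (use that in auto)
    moreover have "0 \<le> s * p" using that by simp
    ultimately show ?thesis by (simp add: right_diff_distrib)
  qed
  have s3: "0 \<le> s3" using s by linarith
  have "s4 * 2 \<le> s4 * x4" by (rule mult_left_mono) (use x4 s in auto)
  moreover have "s3 * ((p1 - x1) + (p2 - x2) + (p3 - x3)) \<le> s3 * q"
    by (rule mult_left_mono) (use x(1) p s3 in linarith)+
  then have "s3 * (p1 - x1) + s3 * (p2 - x2) + s3 * (p3 - x3) \<le> q * s3" by (simp only: distrib_left mult.commute)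
  ultimately show False
    using neg[OF s(1,2) p(3,4)] neg[OF s(3,4) p(5,6)] neg[OF s3 order_refl p(7,8)] e s(5) by linarith
qed

lemma negate_short:
  fixes x0 x1 x2 x3 x4 q :: int
  assumes x: "x0 + x1 + x2 + x3 + x4 = 0" "max 0 x0 + max 0 x1 + max 0 x2 + max 0 x3 + max 0 x4 \<le> q"
  shows "- x0 + - x1 + - x2 + - x3 + - x4 = 0"
    "max 0 (- x0) + max 0 (- x1) + max 0 (- x2) + max 0 (- x3) + max 0 (- x4) \<le> q"
proof -
  have m: "max 0 (- x) = max 0 x - x" for x :: int by simp
  show "- x0 + - x1 + - x2 + - x3 + - x4 = 0" using x(1) by linarith
  show "max 0 (- x0) + max 0 (- x1) + max 0 (- x2) + max 0 (- x3) + max 0 (- x4) \<le> q"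
    unfolding m using x by linarith
qed

lemma top_coefficient_abs:
  fixes x0 x1 x2 x3 x4 s1 s2 s3 s4 q :: int
  assumes x: "x0 + x1 + x2 + x3 + x4 = 0" "max 0 x0 + max 0 x1 + max 0 x2 + max 0 x3 + max 0 x4 \<le> q"
    and s: "0 \<le> s1" "s1 \<le> s3" "0 \<le> s2" "s2 \<le> s3" "q * s3 < 2 * s4" "0 \<le> s4"
    and e: "s1 * x1 + s2 * x2 + s3 * x3 + s4 * x4 = 0"
  shows "x4 = -1 \<or> x4 = 0 \<or> x4 = 1"
proof -
  have "s1 * - x1 + s2 * - x2 + s3 * - x3 + s4 * - x4 = 0" using e by simp
  then have "- x4 \<le> 1" by (rule top_coefficient_le_1[OF negate_short[OF x] s])
  moreover have "x4 \<le> 1" by (rule top_coefficient_le_1[OF x s e])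
  ultimately show ?thesis by linarith
qed

lemma top_letter_large:
  fixes q n :: int
  assumes "2 \<le> q" "0 \<le> n" "n < q"
  shows "q * (q\<^sup>2 + q) < 2 * (q ^ 3 + q\<^sup>2 - n)" "q\<^sup>2 + q \<le> q ^ 3 + q\<^sup>2 - n"
proof -
  have qq: "2 * q \<le> q * q" by (rule mult_right_mono) (use assms in auto)
  have "2 * (q * q) \<le> q * (q * q)" by (rule mult_right_mono) (use assms in auto)
  then have 3: "2 * q\<^sup>2 \<le> q ^ 3" "2 * q \<le> q\<^sup>2" using qq by (simp_all add: power2_eq_square power3_eq_cube)
  have l: "q * (q\<^sup>2 + q) = q ^ 3 + q\<^sup>2" by (simp add: power2_eq_square power3_eq_cube distrib_left)
  have r: "2 * (q ^ 3 + q\<^sup>2 - n) = 2 * q ^ 3 + 2 * q\<^sup>2 - 2 * n" by (simp add: algebra_simps)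
  show "q * (q\<^sup>2 + q) < 2 * (q ^ 3 + q\<^sup>2 - n)" unfolding l r using 3 assms by linarith
  show "q\<^sup>2 + q \<le> q ^ 3 + q\<^sup>2 - n" using 3 assms by linarith
qed

text \<open>\<open>x4\<close> is \<open>-1\<close>, \<open>0\<close> or \<open>1\<close>: the value
  0 leaves a relation of four letters that have none, and up to negation the others are settled by
  \<open>letters_last_forced\<close>.\<close>

lemma letters_b_a_a_1:
  fixes q n x0 x1 x2 x3 x4 :: int
  assumes q: "2 \<le> q" and n: "0 \<le> n" "n < q"
    and x: "x0 + x1 + x2 + x3 + x4 = 0" "max 0 x0 + max 0 x1 + max 0 x2 + max 0 x3 + max 0 x4 \<le> q"
    and e: "x1 + q\<^sup>2 * x2 + (q\<^sup>2 + q) * x3 + (q ^ 3 + q\<^sup>2 - n) * x4 = 0"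
  shows "x0 = x4 * (q - 1 - n) \<and> x1 = x4 * n \<and> x2 = 0 \<and> x3 = - (x4 * q)"
proof -
  have q2: "0 \<le> q\<^sup>2" by simp
  have "x4 = -1 \<or> x4 = 0 \<or> x4 = 1"
  proof (rule top_coefficient_abs[OF x, of 1 "q\<^sup>2 + q" "q\<^sup>2" "q ^ 3 + q\<^sup>2 - n"])
    show "1 \<le> q\<^sup>2 + q" using q q2 by linarith
    show "q * (q\<^sup>2 + q) < 2 * (q ^ 3 + q\<^sup>2 - n)" by (rule top_letter_large[OF q n])
    show "0 \<le> q ^ 3 + q\<^sup>2 - n" using top_letter_large(2)[OF q n] q q2 by linarith
    show "1 * x1 + q\<^sup>2 * x2 + (q\<^sup>2 + q) * x3 + (q ^ 3 + q\<^sup>2 - n) * x4 = 0" using e by simp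
  qed (use q in simp_all)
  then show ?thesis
  proof (elim disjE)
    assume x4: "x4 = 1"
    have "x1 = n \<and> x2 = 0 \<and> x3 = - q" by (rule letters_last_forced[OF q n x e x4])
    then show ?thesis using x(1) x4 by auto
  next
    assume x4: "x4 = 0"
    have "x0 = 0 \<and> x1 = 0 \<and> x2 = 0 \<and> x3 = 0"
      by (rule generic_letters_4[OF q]) (use x e x4 in simp_all)
    then show ?thesis using x4 by simp
  next
    assume x4: "x4 = -1"
    have e': "- x1 + q\<^sup>2 * - x2 + (q\<^sup>2 + q) * - x3 + (q ^ 3 + q\<^sup>2 - n) * - x4 = 0"
      unfolding mult_minus_right using e by linarith
    have "- x1 = n \<and> - x2 = 0 \<and> - x3 = - q" by (rule letters_last_forced[OF q n negate_short[OF x] e']) (use x4 in simp)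
    then show ?thesis using x(1) x4 by auto
  qed
qed

lemma letters_a_a_b_1:
  fixes q n x0 x1 x2 x3 x4 :: int
  assumes q: "2 \<le> q" and n: "0 \<le> n" "n < q"
    and x: "x0 + x1 + x2 + x3 + x4 = 0" "max 0 x0 + max 0 x1 + max 0 x2 + max 0 x3 + max 0 x4 \<le> q"
    and e: "q * x1 + (q\<^sup>2 + q - 1) * x2 + (q\<^sup>2 + q) * x3 + (q ^ 3 + q\<^sup>2 - n) * x4 = 0"
  shows "x0 = x4 * (q - 1) \<and> x1 = 0 \<and> x2 = - (x4 * n) \<and> x3 = x4 * (n - q)"
proof -
  have q2: "0 \<le> q\<^sup>2" by simp
  have "x4 = -1 \<or> x4 = 0 \<or> x4 = 1"
  proof (rule top_coefficient_abs[OF x, of q "q\<^sup>2 + q" "q\<^sup>2 + q - 1" "q ^ 3 + q\<^sup>2 - n"])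
    show "0 \<le> q\<^sup>2 + q - 1" using q q2 by linarith
    show "q * (q\<^sup>2 + q) < 2 * (q ^ 3 + q\<^sup>2 - n)" by (rule top_letter_large[OF q n])
    show "0 \<le> q ^ 3 + q\<^sup>2 - n" using top_letter_large(2)[OF q n] q q2 by linarith
    show "q * x1 + (q\<^sup>2 + q - 1) * x2 + (q\<^sup>2 + q) * x3 + (q ^ 3 + q\<^sup>2 - n) * x4 = 0" by (rule e)
  qed (use q in simp_all)
  then show ?thesis
  proof (elim disjE)
    assume x4: "x4 = 1"
    have "x1 = 0 \<and> x2 = - n \<and> x3 = n - q" by (rule letters_last_forced'[OF q n x e x4])
    then show ?thesis using x(1) x4 by auto
  next
    assume x4: "x4 = 0"
    \<comment> \<open>Eliminating \<open>x3\<close> instead of \<open>x0\<close> turns the first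
      four letters into their mirror image \<open>0, 1, q^2, q^2 + q\<close>.\<close>
    have x3: "x3 = - x0 - x1 - x2" using x(1) x4 by linarith
    have "q * x1 + (q\<^sup>2 + q - 1) * x2 + (q\<^sup>2 + q) * (- x0 - x1 - x2) = 0" using e unfolding x4 x3 by simp
    then have "x2 + q\<^sup>2 * x1 + (q\<^sup>2 + q) * x0 = 0" by (simp add: algebra_simps)
    then have "x3 = 0 \<and> x2 = 0 \<and> x1 = 0 \<and> x0 = 0"
      using generic_letters_4[OF q, of x3 x2 x1 x0] x x4 by (simp add: add.commute add.left_commute)
    then show ?thesis using x4 by simp
  next
    assume x4: "x4 = -1"
    have e': "q * - x1 + (q\<^sup>2 + q - 1) * - x2 + (q\<^sup>2 + q) * - x3 + (q ^ 3 + q\<^sup>2 - n) * - x4 = 0"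
      unfolding mult_minus_right using e by linarith
    have "- x1 = 0 \<and> - x2 = - n \<and> - x3 = n - q" by (rule letters_last_forced'[OF q n negate_short[OF x] e']) (use x4 in simp)
    then show ?thesis using x(1) x4 by auto
  qed
qed

text \<open>As letter 4 has coefficient 1, it is computed from the other four, which are chosen
  without short relations.\<close>

lemma pattern_b_a_a_1:
  assumes q: "2 \<le> q" and v: "only_relation 5 q t v" and n: "0 \<le> n" "n < int q"
    and vv: "v 0 = int q - 1 - n" "v 1 = n" "v 2 = 0" "v 3 = - int q" "v 4 = 1"
  shows "has_model 5 q t (int q ^ 3 + int q ^ 2)"
proof -
  define Q where "Q = int q"
  define s where "s = (\<lambda>j. [0, 1, Q\<^sup>2, Q\<^sup>2 + Q, Q ^ 3 + Q\<^sup>2 - n] ! j)"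
  have sv: "s 0 = 0" "s 1 = 1" "s 2 = Q\<^sup>2" "s 3 = Q\<^sup>2 + Q" "s 4 = Q ^ 3 + Q\<^sup>2 - n" by (simp_all add: s_def)
  have Q: "2 \<le> Q" "n < Q" using q n by (simp_all add: Q_def)
  show ?thesis
  proof (rule explicit_model[OF v, of s])
    have "1 \<le> Q\<^sup>2" using Q by simp
    then show "winc 5 s" unfolding winc_5 sv using top_letter_large(2)[OF Q(1) n(1) Q(2)] Q(1) by linarith
    show "ip 5 v (\<lambda>i. real_of_int (s i)) = 0"
      unfolding ip_int_5 sv vv Q_def[symmetric] by (simp add: algebra_simps power2_eq_square power3_eq_cube)
    show "s (5 - 1) - s 0 \<le> int q ^ 3 + int q ^ 2" using n by (simp add: sv Q_def)
    fix x assume x: "x \<in> shorts 5 q" "ip 5 x (\<lambda>i. real_of_int (s i)) = 0"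
    have e: "x 1 + Q\<^sup>2 * x 2 + (Q\<^sup>2 + Q) * x 3 + (Q ^ 3 + Q\<^sup>2 - n) * x 4 = 0"
      using x(2) unfolding ip_int_5 sv by (simp add: mult.commute)
    have *: "x 0 = x 4 * (Q - 1 - n) \<and> x 1 = x 4 * n \<and> x 2 = 0 \<and> x 3 = - (x 4 * Q)"
      by (rule letters_b_a_a_1[OF Q(1) n(1) Q(2) shorts_5D[OF x(1), folded Q_def] e])
    have xs: "x 0 = x 4 * (Q - 1 - n)" "x 1 = x 4 * n" "x 2 = 0" "x 3 = - (x 4 * Q)" using * by simp_all
    have "ip 5 x t = real_of_int (x 4) * ip 5 v t"
      unfolding ip_5 vv Q_def[symmetric] xs by (simp add: algebra_simps)
    then show "ip 5 x t = 0" using v by (simp add: only_relation_def)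
  qed
qed

lemma pattern_a_a_b_1:
  assumes q: "2 \<le> q" and v: "only_relation 5 q t v" and n: "0 \<le> n" "n < int q"
    and vv: "v 0 = int q - 1" "v 1 = 0" "v 2 = - n" "v 3 = n - int q" "v 4 = 1"
  shows "has_model 5 q t (int q ^ 3 + int q ^ 2)"
proof -
  define Q where "Q = int q"
  define s where "s = (\<lambda>j. [0, Q, Q\<^sup>2 + Q - 1, Q\<^sup>2 + Q, Q ^ 3 + Q\<^sup>2 - n] ! j)"
  have sv: "s 0 = 0" "s 1 = Q" "s 2 = Q\<^sup>2 + Q - 1" "s 3 = Q\<^sup>2 + Q" "s 4 = Q ^ 3 + Q\<^sup>2 - n" by (simp_all add: s_def)
  have Q: "2 \<le> Q" "n < Q" using q n by (simp_all add: Q_def)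
  show ?thesis
  proof (rule explicit_model[OF v, of s])
    have "1 \<le> Q\<^sup>2" using Q by simp
    then show "winc 5 s" unfolding winc_5 sv using top_letter_large(2)[OF Q(1) n(1) Q(2)] Q(1) by linarith
    show "ip 5 v (\<lambda>i. real_of_int (s i)) = 0"
      unfolding ip_int_5 sv vv Q_def[symmetric] by (simp add: algebra_simps power2_eq_square power3_eq_cube)
    show "s (5 - 1) - s 0 \<le> int q ^ 3 + int q ^ 2" using n by (simp add: sv Q_def)
    fix x assume x: "x \<in> shorts 5 q" "ip 5 x (\<lambda>i. real_of_int (s i)) = 0"
    have e: "Q * x 1 + (Q\<^sup>2 + Q - 1) * x 2 + (Q\<^sup>2 + Q) * x 3 + (Q ^ 3 + Q\<^sup>2 - n) * x 4 = 0"
      using x(2) unfolding ip_int_5 sv by (simp add: mult.commute)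
    have *: "x 0 = x 4 * (Q - 1) \<and> x 1 = 0 \<and> x 2 = - (x 4 * n) \<and> x 3 = x 4 * (n - Q)"
      by (rule letters_a_a_b_1[OF Q(1) n(1) Q(2) shorts_5D[OF x(1), folded Q_def] e])
    have xs: "x 0 = x 4 * (Q - 1)" "x 1 = 0" "x 2 = - (x 4 * n)" "x 3 = x 4 * (n - Q)" using * by simp_all
    have "ip 5 x t = real_of_int (x 4) * ip 5 v t"
      unfolding ip_5 vv Q_def[symmetric] xs by (simp add: algebra_simps)
    then show "ip 5 x t = 0" using v by (simp add: only_relation_def)
  qed
qed

text \<open>Closing gap \<open>i\<close> leaves the gap coefficients \<open>- a, - a, M\<close>. If
  \<open>M\<close> and \<open>q\<close> have a common factor, dividing by it shortens the relation
  on the facet. Otherwise \<open>0, M * q - M - q, M * q, q^2\<close> is a generic point of the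
  facet and, being integral, its own model.\<close>

lemma pattern_facet_a_a_M:
  assumes q: "2 \<le> q" and t: "sinc 5 t" and v: "only_relation 5 q t v" and i: "i < 4"
    and M: "2 \<le> M" "1 \<le> a" "M + a = int q"
    and z: "ip 5 v z = 0" "z i = z (Suc i)" "\<And>j. j < 4 \<Longrightarrow> j \<noteq> i \<Longrightarrow> z j < z (Suc j)"
    and e: "\<And>y. y i = y (Suc i) \<Longrightarrow> ip 5 v y = - real_of_int a * (y (unsquash i 2) - y (unsquash i 0))
       + real_of_int M * (y (unsquash i 3) - y (unsquash i 2))"
  shows "has_model 5 q t (int q ^ 3 + int q ^ 2)"
proof (cases "coprime M (int q)")
  case False
  define Q where "Q = int q"
  define g where "g = gcd M Q"
  have Q: "Q = M + a" "0 < Q" using M by (simp_all add: Q_def)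
  have g: "g dvd M" "g dvd Q" by (simp_all add: g_def)
  then have ga: "g dvd a" unfolding Q(1) by (simp add: dvd_add_right_iff)
  have "g \<noteq> 1" using False by (simp add: g_def Q_def coprime_iff_gcd_eq_1)
  moreover have "0 < g" using M by (simp add: g_def)
  ultimately have g2: "2 \<le> g" by linarith
  obtain M' where M': "M = g * M'" using g(1) by blast
  obtain a' where a': "a = g * a'" using ga by blast
  have "0 < g * M'" "0 < g * a'" using M(1,2) unfolding M'[symmetric] a'[symmetric] by linarith+
  then have pos: "0 < M'" "0 < a'" using g2 by (simp_all add: zero_less_mult_iff)
  have Q': "Q = g * (M' + a')" unfolding Q(1) M' a' by (simp add: distrib_left)
  define w where "w j = (if j = 0 then a' else if j = 2 then - (M' + a') else if j = 3 then M' else 0)" for j :: nat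
  have wv: "w 0 = a'" "w 1 = 0" "w 2 = - (M' + a')" "w 3 = M'" by (simp_all add: w_def)
  have w4: "w \<in> shorts 4 (nat (M' + a'))"
    using pos by (simp add: shorts_def eval_nat_numeral w_def)
  have "2 * (M' + a') \<le> Q" unfolding Q' by (rule mult_right_mono) (use g2 pos in auto)
  then have "M' + a' < Q" using pos by simp
  then have lt: "nat (M' + a') < q" using pos unfolding Q_def by simp
  show ?thesis
  proof (rule facet_reduction[OF q t v i z w4 _ lt])
    show "w \<noteq> (\<lambda>_. 0)" using pos wv(1) by auto
    fix y :: "nat \<Rightarrow> real" assume y: "y i = y (Suc i)" "ip 5 v y = 0"
    have "real_of_int g * ip 4 w (\<lambda>j. y (unsquash i j)) = ip 5 v y"
      unfolding e[OF y(1)] ip_4 wv M' a' by (simp add: algebra_simps)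
    then show "ip 4 w (\<lambda>j. y (unsquash i j)) = 0" using y(2) g2 by simp
  qed auto
next
  case True
  define Q where "Q = int q"
  have Q: "Q = M + a" "3 \<le> Q" using M by (simp_all add: Q_def)
  have q1: "1 \<le> q" and i5: "Suc i < 5" "Suc i < Suc 4" using q i by auto
  define s where "s = (\<lambda>j. [0, M * Q - M - Q, M * Q, Q\<^sup>2] ! j)"
  have sv: "s 0 = 0" "s 1 = M * Q - M - Q" "s 2 = M * Q" "s 3 = Q\<^sup>2" by (simp_all add: s_def)
  define u where "u = (\<lambda>j. real_of_int (s j))"
  define t' where "t' = (\<lambda>j. u (squash i j))"
  have un: "t' (unsquash i j) = u j" for j
    by (cases "j \<le> i") (auto simp: t'_def squash_def unsquash_def)
  have teq: "t' i = t' (Suc i)" by (simp add: t'_def squash_def)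
  have "ip 5 v t' = - real_of_int a * real_of_int (M * Q) + real_of_int M * (real_of_int (Q\<^sup>2) - real_of_int (M * Q))"
    unfolding e[OF teq] un by (simp add: u_def sv)
  also have "\<dots> = real_of_int M * real_of_int Q * (real_of_int Q - real_of_int M - real_of_int a)"
    by (simp add: algebra_simps power2_eq_square)
  also have "\<dots> = 0" unfolding Q(1) by simp
  finally have t'f: "t' \<in> flat 5 q t" using flat_only_relation[OF v] by simp
  have gen: "generic_on_facet 5 q t i t'"
    unfolding generic_on_facet_def
  proof (intro conjI ballI impI)
    fix x y assume x: "x \<in> shorts 5 q" "ip 5 x t' = 0" and y: "y \<in> flat 5 q t" "y i = y (Suc i)"
    let ?x = "push i x"
    have xs: "?x \<in> shorts 4 q" by (rule push_shorts[OF _ i5(2)]) (use x in simp)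
    have ipx: "ip 5 x w = ip 4 ?x (\<lambda>j. w (unsquash i j))" if "w i = w (Suc i)" for w
      using squash_unsquash[of w, OF that] by (simp add: ip_push[OF i5(2)])
    have "ip 4 ?x u = 0" using x(2) ipx[OF teq] un by simp
    then have e4: "(M * Q - M - Q) * ?x 1 + M * Q * ?x 2 + Q\<^sup>2 * ?x 3 = 0"
      unfolding u_def ip_int_4 sv by (simp add: mult.commute)
    have c: "?x 1 = 0 \<and> M * ?x 2 + Q * ?x 3 = 0"
      by (rule letters_a_a_M[OF M(1) _ True[folded Q_def] shorts_4D[OF xs, folded Q_def] e4]) (use Q M in simp)
    have x0: "?x 0 = - ?x 2 - ?x 3" using shorts_4D(1)[OF xs] c by linarith
    have "real_of_int M * ip 5 x y = real_of_int (?x 3) * ip 5 v y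
       + real_of_int (M * ?x 2 + Q * ?x 3) * (y (unsquash i 2) - y (unsquash i 0))"
      unfolding ipx[OF y(2)] e[OF y(2)] ip_4 x0 Q(1) using c by (simp add: algebra_simps)
    also have "\<dots> = 0" using c y(1) flat_only_relation[OF v] by simp
    finally show "ip 5 x y = 0" using M by simp
  qed (use i5 t'f teq in auto)
  have "has_model 4 q u (Q\<^sup>2)"
    unfolding has_model_def models_def
  proof (intro exI[of _ s] conjI ballI)
    \<comment> \<open>The second letter is \<open>(M - 1) * (Q - 1) - 1\<close>, nonnegative because
      \<open>M \<ge> 2\<close>.\<close>
    have "2 * 1 \<le> (M - 1) * (Q - 1)" 
      using mult_mono[of 1 "M - 1" 2 "Q - 1"] M Q by simp
    then have "0 \<le> M * Q - M - Q" by (simp add: algebra_simps)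
    moreover have "M * Q \<le> Q * Q" by (rule mult_right_mono) (use M Q in auto)
    ultimately show "winc 4 s" unfolding winc_def all_gaps_4 using M Q by (simp add: s_def power2_eq_square)
    show "s (4 - 1) - s 0 \<le> Q\<^sup>2" by (simp add: sv)
  qed (simp add: u_def)
  then have m4: "has_model 4 q (\<lambda>j. t' (unsquash i j)) (Q\<^sup>2)" by (simp add: un)
  have "has_model (Suc 4) q t (Q\<^sup>2 + int q ^ 3)"
    by (rule model_from_collapse[OF q1 _ _ order_refl _ _ m4]) (use t gen in auto)
  then show ?thesis by (simp add: add.commute Q_def)
qed

text \<open>In the last two patterns the gap with the free coefficient is closed, provided that
  \<open>c4 \<ge> 2\<close>. For \<open>c4 = 1\<close> the Frobenius number degenerates to
  \<open>-1\<close>; then the last letter is expressed by the others instead.\<close>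

lemma tame_pattern_model:
  assumes q: "2 \<le> q" and t: "sinc 5 t" and v: "only_relation 5 q t v" and ex: "v \<notin> shorts 5 (q - 1)"
    and p: "tame_pattern (v 1 + v 2 + v 3 + v 4) (v 2 + v 3 + v 4) (v 3 + v 4) (v 4)"
  shows "has_model 5 q t (int q ^ 3 + int q ^ 2)"
proof -
  have vs: "v \<in> shorts 5 q" using v by (simp add: only_relation_def)
  define c1 where "c1 = v 1 + v 2 + v 3 + v 4"
  define c2 where "c2 = v 2 + v 3 + v 4"
  define c3 where "c3 = v 3 + v 4"
  define c4 where "c4 = v 4"
  have vc: "v 0 = - c1" "v 1 = c1 - c2" "v 2 = c2 - c3" "v 3 = c3 - c4" "v 4 = c4"
    unfolding c1_def c2_def c3_def c4_def using shorts_5D(1)[OF vs] by linarith+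
  note g = ip_5_gaps[OF vs, folded c1_def c2_def c3_def c4_def]
  \<comment> \<open>\<open>v\<close> is short for \<open>q\<close> but not for \<open>q - 1\<close>,
    so its length is exactly \<open>q\<close>; this fixes the sum of the two pattern parameters
    \<open>M\<close> and \<open>a\<close>.\<close>
  have norm: "max 0 (v 0) + max 0 (v 1) + max 0 (v 2) + max 0 (v 3) + max 0 (v 4) = int q"
  proof -
    have 5: "(\<Sum>i<5. max 0 (v i)) = max 0 (v 0) + max 0 (v 1) + max 0 (v 2) + max 0 (v 3) + max 0 (v 4)"
      by (simp add: eval_nat_numeral)
    have "\<not> (\<Sum>i<5. max 0 (v i)) \<le> int (q - 1)"
      using ex vs unfolding shorts_def by blast
    then have "\<not> (max 0 (v 0) + max 0 (v 1) + max 0 (v 2) + max 0 (v 3) + max 0 (v 4) \<le> int (q - 1))"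
      unfolding 5 .
    then show ?thesis using shorts_5D(2)[OF vs] q by linarith
  qed
  from p consider "c1 = 0" "0 < c2" "c3 < 0" "c4 = c3" | "0 < c1" "c2 = c1" "c3 < 0" "c4 = c3"
    | "0 < c4" "c2 < 0" "c3 = c2" "c2 \<le> c1" "c1 \<le> 0" | "0 < c4" "c1 < 0" "c2 = c1" "c1 \<le> c3" "c3 \<le> 0"
    unfolding tame_pattern_def c1_def c2_def c3_def c4_def by blast
  then show ?thesis
  proof cases
    case 1
    have "c2 - c3 = int q" using norm unfolding vc using 1 by simp
    then show ?thesis
      by (intro pattern_zero_M_a_a[OF q v, of c2 "- c3"]) (use 1 vc in simp_all)
  next
    case 2
    have "c1 - c3 = int q" using norm unfolding vc using 2 by simp
    then show ?thesis
      by (intro pattern_M_M_a_a[OF q v, of c1 "- c3"]) (use 2 vc in simp_all)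
  next
    case 3
    have n: "c4 - c2 = int q" using norm unfolding vc using 3 by simp
    show ?thesis
    proof (cases "c4 = 1")
      case True
      show ?thesis
        by (rule pattern_b_a_a_1[OF q v, of "c1 - c2"]) (use True n 3 vc in linarith)+
    next
      case False
      \<comment> \<open>The gaps are \<open>0, c4, c4, - 2 * c2\<close>; they satisfy the relation
        because \<open>c3 = c2\<close>.\<close>
      let ?z = "\<lambda>j. [0, 0, real_of_int c4, 2 * real_of_int c4, 2 * real_of_int c4 - 2 * real_of_int c2] ! j"
      show ?thesis
      proof (rule pattern_facet_a_a_M[OF q t v, of 0 c4 "- c2" ?z])
        have "\<forall>j<4. j \<noteq> 0 \<longrightarrow> ?z j < ?z (Suc j)" unfolding all_less_4 using 3 by simp
        then show "?z j < ?z (Suc j)" if "j < 4" "j \<noteq> 0" for j using that by blast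
        show "ip 5 v ?z = 0" unfolding g using 3 by (simp add: algebra_simps)
        fix y :: "nat \<Rightarrow> real" assume "y 0 = y (Suc 0)"
        then show "ip 5 v y = - real_of_int (- c2) * (y (unsquash 0 2) - y (unsquash 0 0))
           + real_of_int c4 * (y (unsquash 0 3) - y (unsquash 0 2))"
          unfolding g using 3(3) by (simp add: unsquash_def eval_nat_numeral algebra_simps)
      qed (use False 3 n in simp_all)
    qed
  next
    case 4
    have n: "c4 - c1 = int q" using norm unfolding vc using 4 by simp
    show ?thesis
    proof (cases "c4 = 1")
      case True
      show ?thesis
        by (rule pattern_a_a_b_1[OF q v, of "c3 - c1"]) (use True n 4 vc in linarith)+
    next
      case False
      let ?z = "\<lambda>j. [0, real_of_int c4, 2 * real_of_int c4, 2 * real_of_int c4, 2 * real_of_int c4 - 2 * real_of_int c1] ! j"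
      show ?thesis
      proof (rule pattern_facet_a_a_M[OF q t v, of 2 c4 "- c1" ?z])
        have "\<forall>j<4. j \<noteq> 2 \<longrightarrow> ?z j < ?z (Suc j)" unfolding all_less_4 using 4 by simp
        then show "?z j < ?z (Suc j)" if "j < 4" "j \<noteq> 2" for j using that by blast
        show "ip 5 v ?z = 0" unfolding g using 4 by (simp add: algebra_simps)
        fix y :: "nat \<Rightarrow> real" assume "y 2 = y (Suc 2)"
        then show "ip 5 v y = - real_of_int (- c1) * (y (unsquash 2 2) - y (unsquash 2 0))
           + real_of_int c4 * (y (unsquash 2 3) - y (unsquash 2 2))"
          unfolding g using 4(3) by (simp add: unsquash_def eval_nat_numeral algebra_simps)
      qed (use False 4 n in simp_all)
    qed
  qed
qed

section \<open>Reflection of alphabets\<close>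

definition reversed :: "nat \<Rightarrow> (nat \<Rightarrow> int) \<Rightarrow> nat \<Rightarrow> int" where
  "reversed m x j = (if j < m then x (m - Suc j) else 0)"

lemma reversed_reversed: "x \<in> shorts m q \<Longrightarrow> reversed m (reversed m x) = x"
  by (rule ext) (auto simp: reversed_def shorts_def)

lemma sum_reversed: "(\<Sum>j<m. f (reversed m x j)) = (\<Sum>j<m. f (x j))"
proof -
  have "(\<Sum>j<m. f (reversed m x j)) = (\<Sum>j<m. f (x (m - Suc j)))" by (rule sum.cong) (auto simp: reversed_def)
  then show ?thesis using sum.nat_diff_reindex[of "\<lambda>j. f (x j)" m] by simp
qed

lemma reversed_shorts: "x \<in> shorts m q \<Longrightarrow> reversed m x \<in> shorts m q"
  using sum_reversed[of "\<lambda>u. u" m x] sum_reversed[of "max 0" m x] by (simp add: shorts_def reversed_def)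

lemma ip_reversed: "ip m (reversed m x) (\<lambda>j. - y (m - Suc j)) = - ip m x y"
proof -
  have "ip m (reversed m x) (\<lambda>j. - y (m - Suc j)) = (\<Sum>j<m. - (real_of_int (x (m - Suc j)) * y (m - Suc j)))"
    unfolding ip_def by (rule sum.cong) (auto simp: reversed_def)
  also have "\<dots> = (\<Sum>j<m. - (real_of_int (x j) * y j))"
    by (rule sum.nat_diff_reindex[of "\<lambda>j. - (real_of_int (x j) * y j)" m])
  finally show ?thesis by (simp add: ip_def sum_negf)
qed

lemma has_model_reversed:
  assumes M: "has_model m q (\<lambda>j. - t (m - Suc j)) D" and m: "1 \<le> m"
  shows "has_model m q t D"
proof -
  obtain s where s: "models m q (\<lambda>j. - t (m - Suc j)) s" "s (m - 1) - s 0 \<le> D"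
    using M by (auto simp: has_model_def)
  define r where "r j = - s (m - Suc j)" for j
  have "models m q t r"
    unfolding models_def
  proof (intro conjI ballI)
    show "winc m r"
      unfolding winc_def
    proof (intro allI impI)
      fix j assume j: "Suc j < m"
      have "Suc (m - Suc (Suc j)) = m - Suc j" using j by simp
      moreover have "s (m - Suc (Suc j)) \<le> s (Suc (m - Suc (Suc j)))"
        using s(1) j by (simp add: models_def winc_def)
      ultimately show "r j \<le> r (Suc j)" by (simp add: r_def)
    qed
    fix x assume x: "x \<in> shorts m q"
    have 1: "ip m (reversed m x) (\<lambda>j. - t (m - Suc j)) = - ip m x t" by (rule ip_reversed)
    have "ip m (reversed m x) (\<lambda>j. real_of_int (s j)) = ip m (reversed m x) (\<lambda>j. - real_of_int (r (m - Suc j)))"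
      by (rule ip_cong) (simp add: r_def)
    also have "\<dots> = - ip m x (\<lambda>j. real_of_int (r j))" by (rule ip_reversed)
    finally have 2: "ip m (reversed m x) (\<lambda>j. real_of_int (s j)) = - ip m x (\<lambda>j. real_of_int (r j))" .
    have "ip m (reversed m x) (\<lambda>j. - t (m - Suc j)) = 0 \<longleftrightarrow> ip m (reversed m x) (\<lambda>j. real_of_int (s j)) = 0"
      using s(1) reversed_shorts[OF x] unfolding models_def by blast
    then show "ip m x t = 0 \<longleftrightarrow> ip m x (\<lambda>i. real_of_int (r i)) = 0"
      unfolding 1 2 by simp
  qed
  moreover have "r (m - 1) - r 0 = s (m - 1) - s 0" using m by (simp add: r_def)
  ultimately show ?thesis using s(2) unfolding has_model_def by (intro exI[of _ r]) simp
qed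

lemma only_relation_reversed:
  assumes v: "only_relation m q t v"
  shows "only_relation m q (\<lambda>j. - t (m - Suc j)) (reversed m v)"
  unfolding only_relation_def
proof (intro conjI ballI impI)
  have vs: "v \<in> shorts m q" "v \<noteq> (\<lambda>_. 0)" "ip m v t = 0" using v by (auto simp: only_relation_def)
  show "reversed m v \<in> shorts m q" by (rule reversed_shorts[OF vs(1)])
  show "reversed m v \<noteq> (\<lambda>_. 0)"
  proof
    assume "reversed m v = (\<lambda>_. 0)"
    then have "reversed m (reversed m v) = reversed m (\<lambda>_. 0)" by simp
    also have "\<dots> = (\<lambda>_. 0)" by (simp add: reversed_def fun_eq_iff)
    finally show False using reversed_reversed[OF vs(1)] vs(2) by simp
  qed
  show "ip m (reversed m v) (\<lambda>j. - t (m - Suc j)) = 0" using vs(3) by (simp add: ip_reversed)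
  fix x assume x: "x \<in> shorts m q" "ip m x (\<lambda>j. - t (m - Suc j)) = 0"
  have "ip m (reversed m (reversed m x)) (\<lambda>j. - t (m - Suc j)) = - ip m (reversed m x) t" by (rule ip_reversed)
  then have "ip m (reversed m x) t = 0" using x(2) reversed_reversed[OF x(1)] by simp
  then have p: "parallel m v (reversed m x)" using v reversed_shorts[OF x(1)] by (simp add: only_relation_def)
  show "parallel m (reversed m v) x"
    unfolding parallel_def
  proof (intro allI impI)
    fix i j assume ij: "i < m" "j < m"
    have "v (m - Suc i) * reversed m x (m - Suc j) = v (m - Suc j) * reversed m x (m - Suc i)"
      using p ij by (simp add: parallel_def)
    then show "reversed m v i * x j = reversed m v j * x i" using ij by (simp add: reversed_def)
  qed
qed

lemma neg_shorts: "x \<in> shorts m q \<Longrightarrow> (\<lambda>j. - x j) \<in> shorts m q"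
  using shorts_neg_sum[of x m q] by (simp add: shorts_def sum_negf)

lemma only_relation_neg:
  assumes v: "only_relation m q t v"
  shows "only_relation m q t (\<lambda>j. - v j)"
proof -
  have "ip m (\<lambda>j. - v j) t = - ip m v t" by (simp add: ip_def sum_negf)
  then show ?thesis
    using v neg_shorts[of v m q] by (auto simp: only_relation_def parallel_def fun_eq_iff)
qed

lemma sum_of_nonpos_products:
  fixes a b c d w x y z :: real
  assumes "a \<le> 0" "b \<le> 0" "c \<le> 0" "d \<le> 0" "0 < w" "0 < x" "0 < y" "0 < z" "a * w + b * x + c * y + d * z = 0"
  shows "a = 0 \<and> b = 0 \<and> c = 0 \<and> d = 0"
proof -
  have "a * w \<le> 0" "b * x \<le> 0" "c * y \<le> 0" "d * z \<le> 0" using assms by (simp_all add: mult_nonpos_nonneg)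
  then have "a * w = 0" "b * x = 0" "c * y = 0" "d * z = 0" using assms(9) by linarith+
  then show ?thesis using assms by simp
qed

text \<open>All gaps of \<open>t\<close> are positive, so the gap coefficients of a nonzero relation
  cannot all be nonpositive.\<close>

lemma only_relation_has_positive:
  assumes t: "sinc 5 t" and v: "only_relation 5 q t v"
  shows "0 < v 1 + v 2 + v 3 + v 4 \<or> 0 < v 2 + v 3 + v 4 \<or> 0 < v 3 + v 4 \<or> 0 < v 4"
proof (rule ccontr)
  assume n: "\<not> ?thesis"
  have vs: "v \<in> shorts 5 q" "v \<noteq> (\<lambda>_. 0)" "ip 5 v t = 0" using v by (auto simp: only_relation_def)
  have tg: "0 < t 1 - t 0" "0 < t 2 - t 1" "0 < t 3 - t 2" "0 < t 4 - t 3"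
    using sinc_less[OF t, of 0 1] sinc_less[OF t, of 1 2] sinc_less[OF t, of 2 3] sinc_less[OF t, of 3 4] by simp_all
  have "real_of_int (v 1 + v 2 + v 3 + v 4) = 0 \<and> real_of_int (v 2 + v 3 + v 4) = 0 \<and> real_of_int (v 3 + v 4) = 0 \<and> real_of_int (v 4) = 0"
    by (rule sum_of_nonpos_products[OF _ _ _ _ tg vs(3)[unfolded ip_5_gaps[OF vs(1)]]])
      (use n in \<open>simp_all only: of_int_le_0_iff not_less de_Morgan_disj\<close>)
  then have z: "v 4 = 0" "v 3 = 0" "v 2 = 0" "v 1 = 0" by (simp_all only: of_int_eq_0_iff) simp_all
  then have "v 0 = 0" using shorts_5D(1)[OF vs(1)] by simp
  moreover have "v j = 0" if "5 \<le> j" for j using shorts_zero[OF vs(1) that] .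
  moreover have "j = 0 \<or> j = 1 \<or> j = 2 \<or> j = 3 \<or> j = 4 \<or> 5 \<le> j" for j :: nat by linarith
  ultimately have "v j = 0" for j using z by metis
  then show False using vs(2) by auto
qed


lemma rank_one_model:
  assumes q: "2 \<le> q" and t: "sinc 5 t" and v: "only_relation 5 q t v" and ex: "v \<notin> shorts 5 (q - 1)"
  shows "has_model 5 q t (int q ^ 3 + int q ^ 2)"
proof -
  have vs: "v \<in> shorts 5 q" using v by (simp add: only_relation_def)
  define c1 where "c1 = v 1 + v 2 + v 3 + v 4"
  define c2 where "c2 = v 2 + v 3 + v 4"
  define c3 where "c3 = v 3 + v 4"
  define c4 where "c4 = v 4"
  note cd = c1_def c2_def c3_def c4_def
  note g = ip_5_gaps[OF vs, folded cd]
  have pos: "0 < c1 \<or> 0 < c2 \<or> 0 < c3 \<or> 0 < c4" unfolding cd by (rule only_relation_has_positive[OF t v])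
  have "0 < - c1 \<or> 0 < - c2 \<or> 0 < - c3 \<or> 0 < - c4"
    using only_relation_has_positive[OF t only_relation_neg[OF v]] unfolding cd by linarith
  then have neg: "c1 < 0 \<or> c2 < 0 \<or> c3 < 0 \<or> c4 < 0" by linarith
  have exn: "(\<lambda>j. - v j) \<notin> shorts 5 (q - 1)" using neg_shorts[of "\<lambda>j. - v j"] ex by auto
  let ?r = "reversed 5 v"
  let ?t = "\<lambda>j. - t (5 - Suc j)"
  have rv: "?r 0 = v 4" "?r 1 = v 3" "?r 2 = v 2" "?r 3 = v 1" "?r 4 = v 0" by (simp_all add: reversed_def)
  have v0: "v 0 = - c1" unfolding cd using shorts_5D(1)[OF vs] by linarith
  \<comment> \<open>Reflection turns the gap coefficients \<open>c1, c2, c3, c4\<close> into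
    \<open>- c4, - c3, - c2, - c1\<close>; together with negation this reaches all four variants of
    a pattern.\<close>
  have rc: "?r 1 + ?r 2 + ?r 3 + ?r 4 = - c4" "?r 2 + ?r 3 + ?r 4 = - c3" "?r 3 + ?r 4 = - c2" "?r 4 = - c1"
    unfolding rv v0 cd by linarith+
  have exr: "?r \<notin> shorts 5 (q - 1)" using reversed_shorts[of ?r 5 "q - 1"] reversed_reversed[OF vs] ex by auto
  have exrn: "(\<lambda>j. - ?r j) \<notin> shorts 5 (q - 1)" using neg_shorts[of "\<lambda>j. - ?r j"] exr by auto
  have ts: "sinc 5 ?t"
    unfolding sinc_def
  proof (intro allI impI)
    fix j :: nat assume "Suc j < 5"
    then show "?t j < ?t (Suc j)" using sinc_less[OF t, of "5 - Suc (Suc j)" "5 - Suc j"] by simp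
  qed
  show ?thesis
  proof (cases "mixed3 c2 c3 c4 \<and> peak 0 c1 c2 \<or> mixed3 c1 c3 c4 \<and> peak c1 c2 c3 \<or>
      mixed3 c1 c2 c4 \<and> peak c2 c3 c4 \<or> mixed3 c1 c2 c3 \<and> peak c3 c4 0")
    case True
    then show ?thesis by (rule reducible_model[OF q t v cd])
  next
    case False
    have two: ?thesis if "a < 4" "b < 4" "a \<noteq> b" "cb \<noteq> 0" "sa = Suc a" "sb = Suc b"
      "\<And>y. ip 5 v y = real_of_int ca * (y sa - y a) + real_of_int cb * (y sb - y b)" for a b sa sb ca cb
      by (rule two_free_gaps_model[OF q t v that(1,2,3) that(7)[unfolded that(5,6)] that(4)])
    have "c1 = 0 \<and> c2 = 0 \<or> c1 = 0 \<and> c3 = 0 \<or> c1 = 0 \<and> c4 = 0 \<or> c2 = 0 \<and> c3 = 0 \<or> c2 = 0 \<and> c4 = 0 \<or> c3 = 0 \<and> c4 = 0 \<or>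
      tame_pattern c1 c2 c3 c4 \<or> tame_pattern (- c1) (- c2) (- c3) (- c4) \<or>
      tame_pattern c4 c3 c2 c1 \<or> tame_pattern (- c4) (- c3) (- c2) (- c1)"
      by (rule irreducible_patterns[OF pos neg]) (use False in blast)+
    then show ?thesis
    proof (elim disjE conjE)
      assume "c1 = 0" "c2 = 0"
      then show ?thesis using pos neg by (intro two[of 2 3 c4 3 4 c3]) (auto simp: g)
    next
      assume "c1 = 0" "c3 = 0"
      then show ?thesis using pos neg by (intro two[of 1 3 c4 2 4 c2]) (auto simp: g)
    next
      assume "c1 = 0" "c4 = 0"
      then show ?thesis using pos neg by (intro two[of 1 2 c3 2 3 c2]) (auto simp: g)
    next
      assume "c2 = 0" "c3 = 0"
      then show ?thesis using pos neg by (intro two[of 0 3 c4 1 4 c1]) (auto simp: g)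
    next
      assume "c2 = 0" "c4 = 0"
      then show ?thesis using pos neg by (intro two[of 0 2 c3 1 3 c1]) (auto simp: g)
    next
      assume "c3 = 0" "c4 = 0"
      then show ?thesis using pos neg by (intro two[of 0 1 c2 1 2 c1]) (auto simp: g)
    next
      assume "tame_pattern c1 c2 c3 c4"
      then show ?thesis unfolding cd by (rule tame_pattern_model[OF q t v ex])
    next
      assume p: "tame_pattern (- c1) (- c2) (- c3) (- c4)"
      have "- v 1 + - v 2 + - v 3 + - v 4 = - c1" "- v 2 + - v 3 + - v 4 = - c2" "- v 3 + - v 4 = - c3" "- v 4 = - c4"
        unfolding cd by linarith+
      then show ?thesis using tame_pattern_model[OF q t only_relation_neg[OF v] exn] p by (simp only:)
    next
      assume p: "tame_pattern c4 c3 c2 c1"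
      have "- ?r 1 + - ?r 2 + - ?r 3 + - ?r 4 = c4" "- ?r 2 + - ?r 3 + - ?r 4 = c3" "- ?r 3 + - ?r 4 = c2" "- ?r 4 = c1"
        using rc by linarith+
      then have "has_model 5 q ?t (int q ^ 3 + int q ^ 2)"
        using tame_pattern_model[OF q ts only_relation_neg[OF only_relation_reversed[OF v]] exrn] p by (simp only:)
      then show ?thesis by (rule has_model_reversed) simp
    next
      assume p: "tame_pattern (- c4) (- c3) (- c2) (- c1)"
      then have "has_model 5 q ?t (int q ^ 3 + int q ^ 2)"
        using tame_pattern_model[OF q ts only_relation_reversed[OF v] exr] rc by (simp only:)
      then show ?thesis by (rule has_model_reversed) simp
    qed
  qed
qed

theorem bnd_5:
  assumes q: "2 \<le> q"
  shows "bnd 5 q (int q ^ 3 + int q ^ 2)"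
  unfolding bnd_def
proof (intro allI impI)
  fix t :: "nat \<Rightarrow> real" assume t: "sinc 5 t"
  have q1: "1 \<le> q" and t': "sinc (Suc 4) t" using q t by auto
  have qq: "2 * int q \<le> int q ^ 2" unfolding power2_eq_square by (rule mult_right_mono) (use q in auto)
  obtain i s where g: "generic_on_facet (Suc 4) q t i s" "winc 4 (\<lambda>j. s (unsquash i j))"
    "\<And>x. x \<in> shorts (Suc 4) q \<Longrightarrow> ip (Suc 4) x t = 0 \<Longrightarrow> ip 4 (push i x) (\<lambda>j. s (unsquash i j)) = 0"
    using generic_facet_collapse[OF q1 _ t'] by auto
  have i: "Suc i < Suc 4" using g(1) by (simp add: generic_on_facet_def)
  consider "\<not> (\<exists>v\<in>shorts 5 q. v \<noteq> (\<lambda>_. 0) \<and> ip 5 v t = 0)"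
    | v where "v \<in> shorts 5 (q - 1)" "v \<noteq> (\<lambda>_. 0)" "ip 5 v t = 0"
    | v x where "v \<in> shorts 5 q" "v \<noteq> (\<lambda>_. 0)" "ip 5 v t = 0" "x \<in> shorts 5 q" "ip 5 x t = 0" "\<not> parallel 5 v x"
    | v where "v \<notin> shorts 5 (q - 1)" "only_relation 5 q t v"
    unfolding only_relation_def by blast
  then show "has_model 5 q t (int q ^ 3 + int q ^ 2)"
  proof cases
    case 1
    define Q where "Q = int q"
    define r where "r = (\<lambda>j. [0, 1, Q\<^sup>2, Q ^ 3 + Q\<^sup>2 - Q, Q ^ 3 + Q\<^sup>2] ! j)"
    have rv: "r 0 = 0" "r 1 = 1" "r 2 = Q\<^sup>2" "r 3 = Q ^ 3 + Q\<^sup>2 - Q" "r 4 = Q ^ 3 + Q\<^sup>2" by (simp_all add: r_def)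
    have Q: "2 \<le> Q" using q by (simp add: Q_def)
    have "models 5 q t r"
      unfolding models_def
    proof (intro conjI ballI)
      have "Q * 1 \<le> Q * Q\<^sup>2" by (rule mult_left_mono) (use Q in simp_all)
      moreover have "1 \<le> Q\<^sup>2" using Q by simp
      ultimately show "winc 5 r" unfolding winc_5 rv using Q by (simp add: power3_eq_cube power2_eq_square)
      fix x assume x: "x \<in> shorts 5 q"
      have "x = (\<lambda>_. 0)" if "ip 5 x (\<lambda>j. real_of_int (r j)) = 0"
      proof -
        have e: "x 1 + Q\<^sup>2 * x 2 + (Q ^ 3 + Q\<^sup>2 - Q) * x 3 + (Q ^ 3 + Q\<^sup>2) * x 4 = 0"
          using that unfolding ip_int_5 rv by (simp add: mult.commute)
        have "x 0 = 0 \<and> x 1 = 0 \<and> x 2 = 0 \<and> x 3 = 0 \<and> x 4 = 0"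
          by (rule generic_letters_5[OF Q shorts_5D[OF x, folded Q_def] e])
        moreover have "x j = 0" if "5 \<le> j" for j using shorts_zero[OF x that] .
        moreover have "j = 0 \<or> j = 1 \<or> j = 2 \<or> j = 3 \<or> j = 4 \<or> 5 \<le> j" for j :: nat by linarith
        ultimately show ?thesis by (metis ext)
      qed
      moreover have "x = (\<lambda>_. 0)" if "ip 5 x t = 0" using 1 x that by blast
      ultimately show "ip 5 x t = 0 \<longleftrightarrow> ip 5 x (\<lambda>j. real_of_int (r j)) = 0"
        by (auto simp: ip_def)
    qed
    moreover have "r (5 - 1) - r 0 \<le> int q ^ 3 + int q ^ 2" by (simp add: rv Q_def)
    ultimately show ?thesis unfolding has_model_def by blast
  next
    case 2
    have u: "has_model 4 q (\<lambda>j. s (unsquash i j)) (int q ^ 2 + int q)"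
      by (rule bnd_weak[OF bnd_4[OF q] _ g(2)]) simp
    have "has_model (Suc 4) q t (int q ^ 2 + int q + int (q - 1) * int q ^ 2)"
      by (rule model_from_collapse[OF q1 _ t' _ _ g(1) u, of "q - 1"]) (use 2 in auto)
    moreover have "int q ^ 2 + int q + int (q - 1) * int q ^ 2 \<le> int q ^ 3 + int q ^ 2"
    proof -
      have "int (q - 1) * int q ^ 2 = int q ^ 3 - int q ^ 2"
        using q by (simp add: of_nat_diff algebra_simps power2_eq_square power3_eq_cube)
      then show ?thesis using qq by linarith
    qed
    ultimately show ?thesis using has_model_mono[of "Suc 4" q t] by simp
  next
    case 3
    have v: "v \<in> shorts (Suc 4) q" "v \<noteq> (\<lambda>_. 0)" "ip (Suc 4) v t = 0" and x: "x \<in> shorts (Suc 4) q" "ip (Suc 4) x t = 0"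
      using 3 by simp_all
    \<comment> \<open>Both relations survive on the facet and stay independent there, so the facet
      costs \<open>q^2\<close>; if letters coincide, it costs at most \<open>q + 1\<close>.\<close>
    have np: "\<not> parallel 4 (push i v) (push i x)"
      using push_parallel_imp_parallel[OF v x t' i] 3(6) by auto
    have u: "has_model 4 q (\<lambda>j. s (unsquash i j)) (int q ^ 2)"
    proof (cases "sinc 4 (\<lambda>j. s (unsquash i j))")
      case True
      show ?thesis
        by (rule four_letters_rigid[OF q1 True push_shorts[OF v(1) i] g(3)[OF v(1,3)] push_shorts[OF x(1) i] g(3)[OF x] np])
    next
      case False
      have "has_model 4 q (\<lambda>j. s (unsquash i j)) (int q + 1)"
        by (rule weak_four_letters[OF q1 bnd_3[OF q1 bnd_2] g(2) False])
      then show ?thesis by (rule has_model_mono) (use qq q in linarith)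
    qed
    have "has_model (Suc 4) q t (int q ^ 2 + int q ^ 3)"
      by (rule model_from_collapse[OF q1 _ t' order_refl _ g(1) u]) auto
    then show ?thesis by (simp add: add.commute)
  next
    case 4
    then show ?thesis using rank_one_model[OF q t] by blast
  qed
qed

section \<open>Exact values and their consequences\<close>

lemma H_4: "2 \<le> q \<Longrightarrow> H 4 q = q ^ 2 + q"
  using H_le[of 4 q "q ^ 2 + q"] bnd_4[of q] H_ge[of 4 q] by (simp add: order_antisym)

lemma H_5: "2 \<le> q \<Longrightarrow> H 5 q = q ^ 3 + q ^ 2"
  using H_le[of 5 q "q ^ 3 + q ^ 2"] bnd_5[of q] H_ge[of 5 q] by (simp add: order_antisym)

lemma H_3: "2 \<le> q \<Longrightarrow> H 3 q = q + 1"
  using H_rec[of 3 q] H_2[of q] H_ge[of 3 q] by simp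

text \<open>The induction starts at five letters, where the sharp value \<open>q^3 + q^2\<close>
  contains no lower powers.\<close>

lemma H_le_sum_powers: "5 \<le> m \<Longrightarrow> 2 \<le> q \<Longrightarrow> H m q \<le> (\<Sum>j=2..m - 2. q ^ j)"
proof (induction m rule: nat_induct_at_least)
  case base
  have "{2..5 - 2} = {2, 3 :: nat}" by auto
  then show ?case using base by (simp add: H_5)
next
  case (Suc m)
  have "H (Suc m) q \<le> q ^ (m - 1) + H m q" using H_rec[of "Suc m" q] Suc by (simp add: numeral_2_eq_2)
  moreover have "(\<Sum>j=2..Suc m - 2. q ^ j) = q ^ (m - 1) + (\<Sum>j=2..m - 2. q ^ j)"
  proof -
    have "{2..Suc m - 2} = insert (m - 1) {2..m - 2}" using Suc(1) by auto
    then have "(\<Sum>j=2..Suc m - 2. q ^ j) = (\<Sum>j\<in>insert (m - 1) {2..m - 2}. q ^ j)" by (rule arg_cong)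
    also have "\<dots> = q ^ (m - 1) + (\<Sum>j=2..m - 2. q ^ j)" by (rule sum.insert) (use Suc(1) in auto)
    finally show ?thesis .
  qed
  ultimately show ?case using Suc by simp
qed

theorem theorem4:
  "(\<forall>m\<ge>2. \<forall>q\<ge>2. \<exists>D. universal_bound m q D) \<and>
   (\<forall>m\<ge>3. \<forall>q\<ge>2. q ^ (m - 2) + q ^ (m - 3) \<le> H m q \<and>
                 H m q \<le> q ^ (m - 2) + H (m - 1) q) \<and>
   (\<forall>q\<ge>2. H 2 q = 1) \<and>
   (\<forall>m\<ge>5. \<forall>q\<ge>2. H m q \<le> (\<Sum>j=2..m - 2. q ^ j)) \<and>
   (\<forall>m\<ge>4. (\<lambda>q. real (H m q) - (real q ^ (m - 2) + real q ^ (m - 3)))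
              \<in> O(\<lambda>q. real q ^ (m - 4))) \<and>
   (\<forall>m\<in>{3, 4, 5}. \<forall>q\<ge>2. H m q = q ^ (m - 2) + q ^ (m - 3)) \<and>
   (\<forall>q\<ge>2. q ^ 4 + q ^ 3 \<le> H 6 q \<and> H 6 q \<le> q ^ 4 + q ^ 3 + q ^ 2)"
proof (intro conjI allI impI ballI)
  fix m q :: nat assume m: "2 \<le> m" and q: "2 \<le> q"
  obtain D where "bnd m q (int D)" using bnd_exists[OF m, of q] q by auto
  then show "\<exists>D. universal_bound m q D" using universal_bound_iff_bnd[of m q D] m q by auto
next
  fix m q :: nat assume m: "3 \<le> m" and q: "2 \<le> q"
  show "q ^ (m - 2) + q ^ (m - 3) \<le> H m q" by (rule H_ge[OF m q])
  show "H m q \<le> q ^ (m - 2) + H (m - 1) q" by (rule H_rec[OF m]) (use q in simp)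
next
  fix q :: nat assume "2 \<le> q"
  then show "H 2 q = 1" by (intro H_2) simp
next
  fix m q :: nat assume "5 \<le> m" "2 \<le> q"
  then show "H m q \<le> (\<Sum>j=2..m - 2. q ^ j)" by (rule H_le_sum_powers)
next
  fix m :: nat assume "4 \<le> m"
  then show "(\<lambda>q. real (H m q) - (real q ^ (m - 2) + real q ^ (m - 3))) \<in> O(\<lambda>q. real q ^ (m - 4))"
    by (rule H_asymptotic)
next
  fix m q :: nat assume "m \<in> {3, 4, 5}" and q: "2 \<le> q"
  then consider "m = 3" | "m = 4" | "m = 5" by auto
  then show "H m q = q ^ (m - 2) + q ^ (m - 3)"
    by cases (use H_3[OF q] H_4[OF q] H_5[OF q] in simp_all)
next
  fix q :: nat assume q: "2 \<le> q"
  show "q ^ 4 + q ^ 3 \<le> H 6 q" using H_ge[of 6 q] q by simp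
  show "H 6 q \<le> q ^ 4 + q ^ 3 + q ^ 2" using H_rec[of 6 q] H_5[OF q] q by simp
qed

end
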